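(* Let $(X,\sigma_X)$ be an irreducible (one-step) shift of finite type, $(Y,\sigma_Y)$ a subshift and $\pi:X\to Y$ a one-block factor map. Suppose there exists $\mu$ such that $\mu$ is an invariant weak Gibbs measure for $f\in C(X)$. Let $g_n$ be the functions on $Y$ associated to $f$ and $\pi$ as in the context. Then: (1) $\pi\mu$ is an invariant weak Gibbs measure for $\mathcal G=\{\log g_n\}_{n=1}^\infty$ on $Y$. (2) There exists $h\in C(Y)$ such that $\lim_{n\to\infty}\frac1n\int\log g_n\,dm=\int h\,dm$ for all $m\in M(Y,\sigma_Y)$ if and only if one of the following equivalent statements holds (for some $h\in C(Y)$): (i) $P(\sigma_X,\pi,f-h\circ\pi)(y)=0$ for every periodic point $y\in Y$ (equivalently, $\lim_{n\to\infty}\frac1n\log(g_n(y)/e^{(S_nh)(y)})=0$ for every periodic point $y\in Y$); (ii) $f-h\circ\pi$ is a compensation function for $\pi$; (iii) $\lim_{n\to\infty}\frac1n\log(g_n(y)/e^{(S_nh)(y)})=0$ for every $y\in Y$; (iv) $\mathcal G$ is asymptotically additive on $Y$ and $\lim_{n\to\infty}\frac1n\lVert\log(g_n/e^{S_nh})\rVert_\infty=0$. (3) Moreover, a function $h$ as in (2) exists if and only if the invariant measure $\pi\mu$ is a weak Gibbs measure for a continuous function on $Y$.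
   Context: $\mathbb N=\{1,2,\dots\}$. A (one-sided) subshift $(X,\sigma_X)$ is a closed set $X\subseteq\{1,\dots,k\}^{\mathbb N}$ (some $k\ge1$) with $\sigma_X(X)\subseteq X$, where $(\sigma_Xx)_i=x_{i+1}$. The metric is $d(x,x')=2^{-k}$ if $x_i=x_i'$ for $1\le i\le k$ and $x_{k+1}\ne x'_{k+1}$, $d(x,x')=1$ if $x_1\neq x_1'$, and $d(x,x)=0$. $B_n(X)$ is the set of words of length $n$ appearing in points of $X$, $B_0(X)=\{\epsilon\}$ (empty word), $B(X)=\bigcup_{n\ge0}B_n(X)$. The cylinder $[x_1\dots x_n]$ is the set of $z\in X$ with $z_i=x_i$ for $1\le i\le n$. $X$ is irreducible if for all $u,v\in B(X)$ there is $w\in B(X)$ with $uwv\in B(X)$. Shifts of finite type are one-step: $X$ is the set of all sequences in $\{1,\dots,k\}^{\mathbb N}$ in which no word of a given set of forbidden blocks of length $\le2$ appears. $x$ is periodic if $\sigma_X^lx=x$ for some $l\in\mathbb N$. $M(X,\sigma_X)$ is the set of $\sigma_X$-invariant Borel probability measures; $h_\mu(\sigma_X)$ is measure-theoretic entropy; $(S_nf)(x)=\sum_{i=0}^{n-1}f(\sigma_X^ix)$. A factor map $\pi:X\to Y$ is a continuous surjection with $\pi\circ\sigma_X=\sigma_Y\circ\pi$; it is one-block if $\pi(x)_i$ depends only on $x_i$, so $\pi$ acts on words. $\pi\mu$ is the push-forward measure $\mu\circ\pi^{-1}$. Relative pressure: for $f\in C(X)$, $n\in\mathbb N$, $\delta>0$,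 $y\in Y$, let $P_n(\sigma_X,\pi,f,\delta)(y)=\sup\{\sum_{x\in E}e^{(S_nf)(x)}: E\text{ is an }(n,\delta)\text{-separated subset of }\pi^{-1}(\{y\})\}$, $P(\sigma_X,\pi,f,\delta)(y)=\limsup_{n\to\infty}\frac1n\log P_n(\sigma_X,\pi,f,\delta)(y)$, and $P(\sigma_X,\pi,f)(y)=\lim_{\delta\to0}P(\sigma_X,\pi,f,\delta)(y)$. The functions $g_n$: for $y\in Y$ let $E_n(y)$ denote a set consisting of exactly one point from each cylinder $[x_1\dots x_n]$ in $X$ such that $\pi(x_1\dots x_n)=y_1\dots y_n$; set $g_n(y)=\sup_{E_n(y)}\sum_{x\in E_n(y)}e^{(S_nf)(x)}$, the supremum over all such choices $E_n(y)$. (The sequence $\mathcal G$ is subadditive.) $F\in C(X)$ is a compensation function for $\pi$ if $\sup_{\mu\in M(X,\sigma_X)}\{h_\mu(\sigma_X)+\int F\,d\mu+\int\phi\circ\pi\,d\mu\}=\sup_{\nu\in M(Y,\sigma_Y)}\{h_\nu(\sigma_Y)+\int\phi\,d\nu\}$ for every $\phi\in C(Y)$. Let $\mathcal F=\{\log f_n\}_{n=1}^\infty$ with $f_n:X\to(0,\infty)$ continuous on a subshift $X$. $\mathcal F$ is asymptotically additive if for every $\epsilon>0$ there is a continuous function $\rho_\epsilon$ with $\limsup_{n\to\infty}\frac1n\lVert\log f_n-S_n\rho_\epsilon\rVert_\infty<\epsilon$ (supremum norm). The topological pressure is $P(\mathcal F)=\limsup_{n\to\infty}\frac1n\log\sum_{u\in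 B_n(X)}\sup\{f_n(x):x\in[u]\}$. If $P(\mathcal F)\ne-\infty$, a measure $\mu\in M(X,\sigma_X)$ is an (invariant) weak Gibbs measure for $\mathcal F$ if there are $C_n>0$ with $\lim_{n\to\infty}\frac1n\log C_n=0$ and $\frac1{C_n}<\frac{\mu[x_1\dots x_n]}{e^{-nP(\mathcal F)}f_n(x)}<C_n$ for every $x\in X$, $n\in\mathbb N$. For a continuous function $f$, these notions refer to $f_n=e^{S_nf}$. *)

theory Defs
  imports "HOL-Probability.Probability"
begin

text \<open>
  Sequences are functions \<open>nat \<Rightarrow> nat\<close> and coordinates are counted from 0, so \<open>x i\<close> is
  the coordinate $x_{i+1}$ of the sequence $(x_1, x_2, \dots)$. The topology and the
  Borel sets on \<open>nat \<Rightarrow> nat\<close> are those of the product of discrete spaces, and \<open>C(X)\<close>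
  is rendered by \<open>continuous_on X\<close>.
\<close>

section \<open>Subshifts\<close>

definition shift :: "(nat \<Rightarrow> nat) \<Rightarrow> nat \<Rightarrow> nat" where
  "shift x = (\<lambda>i. x (Suc i))"

definition full_shift :: "nat \<Rightarrow> (nat \<Rightarrow> nat) set" where
  "full_shift k = {x. \<forall>i. x i \<in> {1..k}}"

definition subshift :: "(nat \<Rightarrow> nat) set \<Rightarrow> bool" where
  "subshift X \<longleftrightarrow> (\<exists>k\<ge>1. X \<subseteq> full_shift k) \<and> closed X \<and> shift ` X \<subseteq> X"

definition block :: "(nat \<Rightarrow> nat) \<Rightarrow> nat \<Rightarrow> nat \<Rightarrow> nat list" where
  "block x i n = map x [i..<i + n]"

definition words :: "(nat \<Rightarrow> nat) set \<Rightarrow> nat \<Rightarrow> nat list set" where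
  "words X n = {block x i n | x i. x \<in> X}"

definition language :: "(nat \<Rightarrow> nat) set \<Rightarrow> nat list set" where
  "language X = (\<Union>n. words X n)"

definition cylinder :: "(nat \<Rightarrow> nat) set \<Rightarrow> nat list \<Rightarrow> (nat \<Rightarrow> nat) set" where
  "cylinder X u = {z \<in> X. block z 0 (length u) = u}"

definition irreducible_shift :: "(nat \<Rightarrow> nat) set \<Rightarrow> bool" where
  "irreducible_shift X \<longleftrightarrow>
     (\<forall>u\<in>language X. \<forall>v\<in>language X. \<exists>w\<in>language X. u @ w @ v \<in> language X)"

definition one_step_sft :: "(nat \<Rightarrow> nat) set \<Rightarrow> bool" where
  "one_step_sft X \<longleftrightarrow> (\<exists>k\<ge>1. \<exists>F \<subseteq> lists {1..k}. (\<forall>w\<in>F. length w \<le> 2) \<and>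
     X = {x \<in> full_shift k. \<forall>w\<in>F. \<forall>i. block x i (length w) \<noteq> w})"

definition periodic_point :: "(nat \<Rightarrow> nat) \<Rightarrow> bool" where
  "periodic_point x \<longleftrightarrow> (\<exists>l\<ge>1. (shift ^^ l) x = x)"

text \<open>The exponent is the number of initial coordinates on which the two points agree.\<close>

definition shift_dist :: "(nat \<Rightarrow> nat) \<Rightarrow> (nat \<Rightarrow> nat) \<Rightarrow> real" where
  "shift_dist x x' = (if x = x' then 0 else (1 / 2) ^ (LEAST k. x k \<noteq> x' k))"

definition birkhoff_sum :: "((nat \<Rightarrow> nat) \<Rightarrow> real) \<Rightarrow> nat \<Rightarrow> (nat \<Rightarrow> nat) \<Rightarrow> real" where
  "birkhoff_sum f n x = (\<Sum>i<n. f ((shift ^^ i) x))"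


section \<open>Factor maps\<close>

definition factor_map ::
  "(nat \<Rightarrow> nat) set \<Rightarrow> (nat \<Rightarrow> nat) set \<Rightarrow> ((nat \<Rightarrow> nat) \<Rightarrow> nat \<Rightarrow> nat) \<Rightarrow> bool" where
  "factor_map X Y \<pi> \<longleftrightarrow>
     continuous_on X \<pi> \<and> \<pi> ` X = Y \<and> (\<forall>x\<in>X. \<pi> (shift x) = shift (\<pi> x))"

text \<open>
  The symbol map \<open>p\<close> through which \<open>\<pi>\<close> acts is determined on the symbols occurring in
  \<open>X\<close>; the action of \<open>\<pi>\<close> on words of \<open>X\<close> is \<open>map p\<close>.
\<close>

definition one_block ::
  "(nat \<Rightarrow> nat) set \<Rightarrow> (nat \<Rightarrow> nat) \<Rightarrow> ((nat \<Rightarrow> nat) \<Rightarrow> nat \<Rightarrow> nat) \<Rightarrow> bool" where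
  "one_block X p \<pi> \<longleftrightarrow> (\<forall>x\<in>X. \<forall>i. \<pi> x i = p (x i))"


section \<open>Invariant measures and entropy\<close>

definition invariant_measures :: "(nat \<Rightarrow> nat) set \<Rightarrow> (nat \<Rightarrow> nat) measure set" where
  "invariant_measures X = {\<mu>. sets \<mu> = sets (restrict_space borel X) \<and> prob_space \<mu> \<and>
     (\<forall>A\<in>sets \<mu>. emeasure \<mu> (shift -` A \<inter> X) = emeasure \<mu> A)}"

definition push_forward ::
  "(nat \<Rightarrow> nat) set \<Rightarrow> ((nat \<Rightarrow> nat) \<Rightarrow> nat \<Rightarrow> nat) \<Rightarrow> (nat \<Rightarrow> nat) measure \<Rightarrow>
     (nat \<Rightarrow> nat) measure" where
  "push_forward Y \<pi> \<mu> = distr \<mu> (restrict_space borel Y) \<pi>"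

text \<open>Since \<open>ln 0 = 0\<close>, null sets contribute 0.\<close>

definition partition_entropy :: "'a measure \<Rightarrow> 'a set set \<Rightarrow> real" where
  "partition_entropy \<mu> P = - (\<Sum>A\<in>P. measure \<mu> A * ln (measure \<mu> A))"

text \<open>
  The join of the preimages of \<open>P\<close> under the first \<open>n\<close> iterates of \<open>T\<close>. It may contain the
  empty set, which does not affect the entropy.
\<close>

definition iterated_join :: "'a measure \<Rightarrow> ('a \<Rightarrow> 'a) \<Rightarrow> 'a set set \<Rightarrow> nat \<Rightarrow> 'a set set" where
  "iterated_join \<mu> T P n =
     (\<lambda>A. {x \<in> space \<mu>. \<forall>i<n. (T ^^ i) x \<in> A i}) ` ({..<n} \<rightarrow>\<^sub>E P)"

definition measure_entropy :: "'a measure \<Rightarrow> ('a \<Rightarrow> 'a) \<Rightarrow> ereal" where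
  "measure_entropy \<mu> T =
     (SUP P\<in>{P. finite P \<and> P \<subseteq> sets \<mu> \<and> partition_on (space \<mu>) P}.
        ereal (lim (\<lambda>n. partition_entropy \<mu> (iterated_join \<mu> T P n) / real n)))"

definition compensation_function ::
  "(nat \<Rightarrow> nat) set \<Rightarrow> (nat \<Rightarrow> nat) set \<Rightarrow> ((nat \<Rightarrow> nat) \<Rightarrow> nat \<Rightarrow> nat) \<Rightarrow>
     ((nat \<Rightarrow> nat) \<Rightarrow> real) \<Rightarrow> bool" where
  "compensation_function X Y \<pi> F \<longleftrightarrow> continuous_on X F \<and>
     (\<forall>\<phi>. continuous_on Y \<phi> \<longrightarrow>
        (SUP \<mu>\<in>invariant_measures X.
           measure_entropy \<mu> shift + ereal (\<integral>x. F x \<partial>\<mu>) + ereal (\<integral>x. \<phi> (\<pi> x) \<partial>\<mu>)) =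
        (SUP \<nu>\<in>invariant_measures Y. measure_entropy \<nu> shift + ereal (\<integral>y. \<phi> y \<partial>\<nu>)))"


section \<open>Relative pressure\<close>

definition separated :: "nat \<Rightarrow> real \<Rightarrow> (nat \<Rightarrow> nat) set \<Rightarrow> bool" where
  "separated n \<delta> E \<longleftrightarrow> (\<forall>x\<in>E. \<forall>x'\<in>E. x \<noteq> x' \<longrightarrow>
     (MAX i\<in>{..<n}. shift_dist ((shift ^^ i) x) ((shift ^^ i) x')) > \<delta>)"

text \<open>
  For \<open>\<delta> > 0\<close> separated subsets of a subshift are finite with uniformly bounded cardinality,
  so for continuous \<open>f\<close> the supremum below is one of a bounded set of finite sums.
\<close>

definition rel_pressure_sup ::
  "(nat \<Rightarrow> nat) set \<Rightarrow> ((nat \<Rightarrow> nat) \<Rightarrow> nat \<Rightarrow> nat) \<Rightarrow> ((nat \<Rightarrow> nat) \<Rightarrow> real) \<Rightarrow>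
     real \<Rightarrow> nat \<Rightarrow> (nat \<Rightarrow> nat) \<Rightarrow> real" where
  "rel_pressure_sup X \<pi> f \<delta> n y =
     (SUP E\<in>{E. E \<subseteq> {x \<in> X. \<pi> x = y} \<and> separated n \<delta> E}. \<Sum>x\<in>E. exp (birkhoff_sum f n x))"

definition rel_pressure_scale ::
  "(nat \<Rightarrow> nat) set \<Rightarrow> ((nat \<Rightarrow> nat) \<Rightarrow> nat \<Rightarrow> nat) \<Rightarrow> ((nat \<Rightarrow> nat) \<Rightarrow> real) \<Rightarrow>
     real \<Rightarrow> (nat \<Rightarrow> nat) \<Rightarrow> ereal" where
  "rel_pressure_scale X \<pi> f \<delta> y =
     limsup (\<lambda>n. ereal (ln (rel_pressure_sup X \<pi> f \<delta> n y) / real n))"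

definition rel_pressure ::
  "(nat \<Rightarrow> nat) set \<Rightarrow> ((nat \<Rightarrow> nat) \<Rightarrow> nat \<Rightarrow> nat) \<Rightarrow> ((nat \<Rightarrow> nat) \<Rightarrow> real) \<Rightarrow>
     (nat \<Rightarrow> nat) \<Rightarrow> ereal" where
  "rel_pressure X \<pi> f y = Lim (at_right 0) (\<lambda>\<delta>. rel_pressure_scale X \<pi> f \<delta> y)"


section \<open>The functions \<open>g\<^sub>n\<close>\<close>

text \<open>The admissible choices of the set $E_n(y)$.\<close>

definition cylinder_choices ::
  "(nat \<Rightarrow> nat) set \<Rightarrow> (nat \<Rightarrow> nat) \<Rightarrow> nat \<Rightarrow> (nat \<Rightarrow> nat) \<Rightarrow> (nat \<Rightarrow> nat) set set" where
  "cylinder_choices X p n y =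
     (let W = {u \<in> words X n. map p u = block y 0 n}
      in {E. E \<subseteq> (\<Union>u\<in>W. cylinder X u) \<and> (\<forall>u\<in>W. \<exists>!x. x \<in> E \<inter> cylinder X u)})"

definition fiber_sum ::
  "(nat \<Rightarrow> nat) set \<Rightarrow> (nat \<Rightarrow> nat) \<Rightarrow> ((nat \<Rightarrow> nat) \<Rightarrow> real) \<Rightarrow> nat \<Rightarrow> (nat \<Rightarrow> nat) \<Rightarrow> real" where
  "fiber_sum X p f n y =
     (SUP E\<in>cylinder_choices X p n y. \<Sum>x\<in>E. exp (birkhoff_sum f n x))"


section \<open>Sequences of potentials and weak Gibbs measures\<close>

text \<open>
  A sequence \<open>{log f\<^sub>n}\<close> is represented by the functions \<open>f n\<close>; the value at \<open>n = 0\<close> is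
  irrelevant.
\<close>

definition potential_seq :: "(nat \<Rightarrow> nat) set \<Rightarrow> (nat \<Rightarrow> (nat \<Rightarrow> nat) \<Rightarrow> real) \<Rightarrow> bool" where
  "potential_seq X f \<longleftrightarrow> (\<forall>n\<ge>1. continuous_on X (f n) \<and> (\<forall>x\<in>X. f n x > 0))"

definition exp_birkhoff :: "((nat \<Rightarrow> nat) \<Rightarrow> real) \<Rightarrow> nat \<Rightarrow> (nat \<Rightarrow> nat) \<Rightarrow> real" where
  "exp_birkhoff f n x = exp (birkhoff_sum f n x)"

definition sup_norm :: "(nat \<Rightarrow> nat) set \<Rightarrow> ((nat \<Rightarrow> nat) \<Rightarrow> real) \<Rightarrow> real" where
  "sup_norm X \<phi> = (SUP x\<in>X. \<bar>\<phi> x\<bar>)"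

definition asymptotically_additive ::
  "(nat \<Rightarrow> nat) set \<Rightarrow> (nat \<Rightarrow> (nat \<Rightarrow> nat) \<Rightarrow> real) \<Rightarrow> bool" where
  "asymptotically_additive X f \<longleftrightarrow> potential_seq X f \<and>
     (\<forall>\<epsilon>>0. \<exists>\<rho>. continuous_on X \<rho> \<and>
        limsup (\<lambda>n. ereal (sup_norm X (\<lambda>x. ln (f n x) - birkhoff_sum \<rho> n x) / real n))
          < ereal \<epsilon>)"

definition pressure :: "(nat \<Rightarrow> nat) set \<Rightarrow> (nat \<Rightarrow> (nat \<Rightarrow> nat) \<Rightarrow> real) \<Rightarrow> ereal" where
  "pressure X f =
     limsup (\<lambda>n. ereal (ln (\<Sum>u\<in>words X n. SUP x\<in>cylinder X u. f n x) / real n))"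

text \<open>
  The factor \<open>exp (- n P)\<close> in the Gibbs inequality also presupposes that the pressure is
  not \<open>\<infinity>\<close>.
\<close>

definition weak_gibbs ::
  "(nat \<Rightarrow> nat) set \<Rightarrow> (nat \<Rightarrow> (nat \<Rightarrow> nat) \<Rightarrow> real) \<Rightarrow> (nat \<Rightarrow> nat) measure \<Rightarrow> bool" where
  "weak_gibbs X f \<mu> \<longleftrightarrow>
     potential_seq X f \<and> \<mu> \<in> invariant_measures X \<and>
     pressure X f \<noteq> - \<infinity> \<and> pressure X f \<noteq> \<infinity> \<and>
     (\<exists>C::nat \<Rightarrow> real. (\<forall>n\<ge>1. C n > 0) \<and> (\<lambda>n. ln (C n) / real n) \<longlonglongrightarrow> 0 \<and>
        (\<forall>x\<in>X. \<forall>n\<ge>1.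
           (let q = measure \<mu> (cylinder X (block x 0 n)) /
                      (exp (- real n * real_of_ereal (pressure X f)) * f n x)
            in 1 / C n < q \<and> q < C n)))"

end

theory Submission
  imports Defs
begin

text \<open>
  Write $g_n(v)$ for the total weight $\sum_{\pi(u) = v} \sup_{[u]} e^{S_n f}$ of the fibre of a word $v$ of $Y$;
  the function $g_n$ of the theorem is $y \mapsto g_n(y_1 \dots y_n)$. Every condition on $h$ is shown to be
  equivalent to $\log g_n - S_n h = o(n)$ uniformly on $Y$.

  From periodic points to the uniform statement: in an irreducible shift of finite type a definite
  proportion of the weight of the fibre of $v$ is carried by words that can be concatenated freely
  after inserting one connecting word of bounded length. These concatenations lie over a periodic
  point $y'$ that starts with $v$, so subadditivity gives $\log g_n(v) = n \lim_m \frac1m \log g_m(y') + o(n)$.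
  Over a periodic point a path that stays in the fibre long enough repeats a state and can be
  continued for ever inside the fibre, hence the relative pressure is the growth rate of $g_n$.

  Compensation functions are reduced to topological pressures by the variational principle. For
  the upper bound, Gibbs' inequality compares an arbitrary finite partition with cylinders; for
  the lower bound, independent concatenations of free words, averaged over shifts, have
  almost maximal free energy. If the pressures agree for all potentials, then
  adding a large penalty away from a periodic orbit isolates the growth rate of $g_n$ along that orbit.
\<close>

section \<open>Words and Birkhoff sums\<close>

text \<open>A merely continuous potential has no bounded distortion: the Birkhoff sums of two points
  of one n-cylinder may drift apart, and uniform continuity only bounds the difference by \<epsilon>
  * n + K with K depending on \<epsilon>. All comparisons are therefore kept in the form
  \<open>\<bar>a n - b n\<bar> \<le> \<epsilon> * real n + K\<close> for every \<epsilon> > 0. This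
  is o(n) without division, and it survives sums, concatenation and bounded changes of length. The
  obstacle is uniformity: a limit along a single periodic point brings a constant that depends on
  the point. It disappears because the word length n is fixed while the number q of repetitions
  tends to infinity; what remains per repetition is distortion and the cost of a connecting word of
  bounded length. Y need not be of finite type, so the variational principle is derived from free
  concatenation, a property of weighted sets of words that passes to factors, and is then applied to
  X and Y alike.\<close>

lemma shift_funpow: "(shift ^^ i) x = (\<lambda>j. x (i + j))"
  by (induction i arbitrary: x) (auto simp: shift_def funpow_Suc_right simp del: funpow.simps(2))

lemma length_block [simp]: "length (block x i n) = n"
  by (simp add: block_def)

lemma nth_block [simp]: "t < n \<Longrightarrow> block x i n ! t = x (i + t)"
  by (simp add: block_def)

lemma block_eq_iff: "block x i n = block y j n \<longleftrightarrow> (\<forall>t<n. x (i + t) = y (j + t))"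
  by (auto simp: list_eq_iff_nth_eq)

lemma block_funpow [simp]: "block ((shift ^^ i) x) j n = block x (i + j) n"
  by (auto simp: list_eq_iff_nth_eq shift_funpow add.assoc)

lemma block_eqD: "block x 0 n = block y 0 n \<Longrightarrow> t < n \<Longrightarrow> x t = y t"
  by (auto simp: block_eq_iff)

lemma block_2: "block x i 2 = [x i, x (Suc i)]"
  by (simp add: block_def numeral_2_eq_2)

lemma block_add: "block x i (n + m) = block x i n @ block x (i + n) m"
  by (auto simp: list_eq_iff_nth_eq nth_append)

lemma take_block: "m \<le> n \<Longrightarrow> take m (block x i n) = block x i m"
  by (auto simp: list_eq_iff_nth_eq)

lemma drop_block: "drop m (block x i n) = block x (i + m) (n - m)"
  by (auto simp: list_eq_iff_nth_eq add.assoc)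

lemma subshift_funpow: "subshift X \<Longrightarrow> x \<in> X \<Longrightarrow> (shift ^^ i) x \<in> X"
  by (induction i) (auto simp: subshift_def)

lemma subshift_shift: "subshift X \<Longrightarrow> x \<in> X \<Longrightarrow> shift x \<in> X"
  by (auto simp: subshift_def)

lemma shift_funpow_mult:
  assumes "(shift ^^ l) y = y" shows "(shift ^^ (q * l)) y = y"
  by (induction q) (simp_all add: funpow_add assms)

text \<open>Forward invariance turns an occurrence at position i into one at position 0 of the
  shifted point.\<close>

lemma words_eq: "subshift X \<Longrightarrow> words X n = (\<lambda>x. block x 0 n) ` X"
  unfolding words_def
  by (auto simp: image_iff) (metis add.right_neutral block_funpow subshift_funpow)

lemma wordsE:
  assumes "subshift X" "u \<in> words X n"
  obtains x where "x \<in> X" "u = block x 0 n"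
  using assms by (auto simp: words_eq)

lemma block_in_words: "x \<in> X \<Longrightarrow> block x i n \<in> words X n"
  by (auto simp: words_def)

lemma length_words: "u \<in> words X n \<Longrightarrow> length u = n"
  by (auto simp: words_def)

lemma subshift_symbols: "subshift X \<Longrightarrow> \<exists>k. \<forall>x\<in>X. \<forall>i. x i \<in> {1..k}"
  unfolding subshift_def full_shift_def by fast

lemma card_words_le:
  assumes "subshift X"
  obtains k where "k \<ge> 1" "\<And>x i. x \<in> X \<Longrightarrow> x i \<in> {1..k}" 
    "\<And>n. finite (words X n)" "\<And>n. card (words X n) \<le> k ^ n"
proof -
  obtain k where k: "k \<ge> 1" "X \<subseteq> full_shift k"
    using assms by (auto simp: subshift_def)
  have sub: "words X n \<subseteq> {xs. set xs \<subseteq> {1..k} \<and> length xs = n}" for n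
    using k(2) by (auto simp: words_def full_shift_def block_def subset_iff)
  have "finite (words X n)" for n
    by (rule finite_subset[OF sub finite_lists_length_eq]) auto
  moreover have "card (words X n) \<le> k ^ n" for n
    using card_mono[OF finite_lists_length_eq sub, of n] card_lists_length_eq[of "{1..k}" n] by simp
  ultimately show ?thesis
    using that[of k] k by (auto simp: full_shift_def)
qed

lemma finite_words: "subshift X \<Longrightarrow> finite (words X n)"
  by (metis card_words_le)

text \<open>The full shift on k symbols is a product of finite sets, hence compact by Tychonoff; X
  is closed in it.\<close>

lemma compact_subshift:
  assumes "subshift X" shows "compact X"
proof -
  obtain k where k: "X \<subseteq> full_shift k"
    using assms by (auto simp: subshift_def)
  have *: "full_shift k = (\<Pi>\<^sub>E i\<in>UNIV. {1..k})"
    by (auto simp: full_shift_def PiE_def)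
  have "compactin (product_topology (\<lambda>i::nat. euclidean :: nat topology) UNIV) (\<Pi>\<^sub>E i\<in>UNIV. {1..k})"
    by (subst compactin_PiE) (auto intro: finite_imp_compact)
  then have "compact (full_shift k)"
    using * by (simp add: euclidean_product_topology)
  moreover have "closed X" using assms by (simp add: subshift_def)
  ultimately show ?thesis
    using k by (metis compact_Int_closed inf.absorb2)
qed

lemma open_block: "open {x :: nat \<Rightarrow> nat. block x 0 n = u}"
proof (cases "length u = n")
  case True
  have "{x. block x 0 n = u} = (\<Inter>t\<in>{..<n}. (\<lambda>x. x t) -` {u ! t})"
    using True by (auto simp: list_eq_iff_nth_eq)
  moreover have "open ((\<lambda>x::nat \<Rightarrow> nat. x t) -` {u ! t})" for t
    by (rule open_vimage) (auto intro: discrete_topology_class.open_discrete continuous_on_product_coordinates)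
  ultimately show ?thesis by auto
next
  case False
  then have "{x :: nat \<Rightarrow> nat. block x 0 n = u} = {}" by auto
  then show ?thesis by simp
qed

lemma closed_block: "closed {x :: nat \<Rightarrow> nat. block x 0 n = u}"
proof -
  have "- {x :: nat \<Rightarrow> nat. block x 0 n = u} = (\<Union>v\<in>-{u}. {x. block x 0 n = v})" by auto
  then show ?thesis unfolding closed_def using open_block by auto
qed

text \<open>The sets of points with a prescribed initial block are open, so F is locally constant on
  X. This is how \<pi>, the penalties and the functions log g_n are seen to be continuous.\<close>

lemma continuous_on_if_block:
  fixes F :: "(nat \<Rightarrow> nat) \<Rightarrow> 'a :: topological_space"
  assumes "\<And>x y. x \<in> X \<Longrightarrow> y \<in> X \<Longrightarrow> block x 0 n = block y 0 n \<Longrightarrow> F x = F y"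
  shows "continuous_on X F"
  unfolding continuous_on_topological
proof safe
  fix x B assume "x \<in> X" "open B" "F x \<in> B"
  have "F y \<in> B" if "y \<in> X" "block y 0 n = block x 0 n" for y
    using assms[OF that(1) \<open>x \<in> X\<close> that(2)] \<open>F x \<in> B\<close> by simp
  then show "\<exists>A. open A \<and> x \<in> A \<and> (\<forall>y\<in>X. y \<in> A \<longrightarrow> F y \<in> B)"
    using open_block[of n "block x 0 n"]
    by (intro exI[of _ "{y. block y 0 n = block x 0 n}"]) simp
qed

lemma continuous_on_shift: "continuous_on X shift"
proof (rule continuous_on_coordinatewise_then_product)
  fix i show "continuous_on X (\<lambda>x. shift x i)"
    unfolding shift_def by (rule continuous_on_subset[OF continuous_on_product_coordinates subset_UNIV])
qed

lemma continuous_on_shift_funpow: "continuous_on X (shift ^^ i)"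
  by (induction i) (auto simp: comp_def intro: continuous_on_compose2[OF continuous_on_shift[of UNIV]])

lemma measurable_shift_restrict:
  assumes "subshift X"
  shows "shift \<in> measurable (restrict_space borel X) (restrict_space borel X)"
  using subshift_shift[OF assms]
  by (intro measurable_restrict_space2 borel_measurable_continuous_on_restrict continuous_on_shift)
     (auto simp: space_restrict_space)

lemma vimage_shift_sets:
  assumes "subshift X" "A \<in> sets (restrict_space borel X)"
  shows "shift -` A \<inter> X \<in> sets (restrict_space borel X)"
  using measurable_sets[OF measurable_shift_restrict[OF assms(1)] assms(2)] by (simp add: space_restrict_space)

lemma continuous_on_birkhoff_sum:
  assumes "subshift X" "continuous_on X F"
  shows "continuous_on X (birkhoff_sum F n)"
proof -
  have "continuous_on X (\<lambda>x. F ((shift ^^ i) x))" for i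
    by (rule continuous_on_compose2[OF assms(2) continuous_on_shift_funpow])
       (auto simp: subshift_funpow assms)
  then show ?thesis
    unfolding birkhoff_sum_def by (intro continuous_intros)
qed

text \<open>Uniform continuity with closeness measured by common initial blocks, proved by
  sequential compactness: counterexamples for every L would have subsequences whose limits agree in
  every coordinate.\<close>

lemma continuous_on_subshift_uniform:
  fixes F :: "(nat \<Rightarrow> nat) \<Rightarrow> real"
  assumes "subshift X" "continuous_on X F" "\<epsilon> > 0"
  shows "\<exists>L. \<forall>x\<in>X. \<forall>y\<in>X. block x 0 L = block y 0 L \<longrightarrow> \<bar>F x - F y\<bar> < \<epsilon>"
proof (rule ccontr)
  assume "\<not> ?thesis"
  then have "\<forall>L. \<exists>x y. x \<in> X \<and> y \<in> X \<and> block x 0 L = block y 0 L \<and> \<epsilon> \<le> \<bar>F x - F y\<bar>"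
    by (simp add: not_less) blast
  then obtain a b where ab: "\<And>L. a L \<in> X" "\<And>L. b L \<in> X" "\<And>L. block (a L) 0 L = block (b L) 0 L"
    "\<And>L. \<epsilon> \<le> \<bar>F (a L) - F (b L)\<bar>"
    by metis
  have seq: "seq_compact X"
    using compact_imp_seq_compact[OF compact_subshift[OF assms(1)]] .
  obtain x r where r: "x \<in> X" "strict_mono r" "(a \<circ> r) \<longlonglongrightarrow> x"
    using seq_compactE[OF seq, of a] ab(1) by metis
  obtain y q where q: "y \<in> X" "strict_mono q" "((b \<circ> r) \<circ> q) \<longlonglongrightarrow> y"
    using seq_compactE[OF seq, of "b \<circ> r"] ab(2) by (metis comp_apply)
  have a': "(a \<circ> r \<circ> q) \<longlonglongrightarrow> x"
    using LIMSEQ_subseq_LIMSEQ[OF r(3) q(2)] .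
  have rq: "strict_mono (r \<circ> q)"
    using r(2) q(2) by (simp add: strict_mono_o)
  \<comment> \<open>Coordinate i agrees along the subsequence as soon as the block length (r \<circ>
    q) n exceeds i.\<close>
  have "x i = y i" for i
  proof -
    have lim: "(\<lambda>n. (a \<circ> r \<circ> q) n i) \<longlonglongrightarrow> x i" "(\<lambda>n. (b \<circ> r \<circ> q) n i) \<longlonglongrightarrow> y i"
      using continuous_on_tendsto_compose[OF continuous_on_product_coordinates[of i] a']
        continuous_on_tendsto_compose[OF continuous_on_product_coordinates[of i] q(3)] by auto
    have "\<forall>\<^sub>F n in sequentially. (a \<circ> r \<circ> q) n i = (b \<circ> r \<circ> q) n i"
    proof (rule eventually_sequentiallyI[of "Suc i"])
      fix n assume "Suc i \<le> n"
      then have "i < (r \<circ> q) n"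
        using strict_mono_imp_increasing[OF rq, of n] by linarith
      then show "(a \<circ> r \<circ> q) n i = (b \<circ> r \<circ> q) n i"
        using ab(3)[of "(r \<circ> q) n"] by (auto simp: block_eq_iff)
    qed
    then have "(\<lambda>n. (b \<circ> r \<circ> q) n i) \<longlonglongrightarrow> x i"
      using lim(1) by (rule Lim_transform_eventually[rotated])
    then show ?thesis
      using lim(2) LIMSEQ_unique by blast
  qed
  then have "x = y" by auto
  have "(\<lambda>n. F ((a \<circ> r \<circ> q) n)) \<longlonglongrightarrow> F x"
    by (rule continuous_on_tendsto_compose[OF assms(2) a' r(1)]) (auto simp: ab)
  moreover have "(\<lambda>n. F ((b \<circ> r \<circ> q) n)) \<longlonglongrightarrow> F x"
    unfolding \<open>x = y\<close> by (rule continuous_on_tendsto_compose[OF assms(2) q(3,1)]) (auto simp: ab)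
  ultimately have "(\<lambda>n. F ((a \<circ> r \<circ> q) n) - F ((b \<circ> r \<circ> q) n)) \<longlonglongrightarrow> F x - F x"
    by (rule tendsto_diff)
  then have "(\<lambda>n. \<bar>F ((a \<circ> r \<circ> q) n) - F ((b \<circ> r \<circ> q) n)\<bar>) \<longlonglongrightarrow> 0"
    using tendsto_rabs by fastforce
  then have "\<epsilon> \<le> 0"
    by (rule LIMSEQ_le_const) (use ab(4) in auto)
  then show False using assms(3) by simp
qed

lemma continuous_on_subshift_bounded:
  fixes F :: "(nat \<Rightarrow> nat) \<Rightarrow> real"
  assumes "subshift X" "continuous_on X F"
  obtains B where "B \<ge> 0" "\<And>x. x \<in> X \<Longrightarrow> \<bar>F x\<bar> \<le> B"
proof -
  have "bounded (F ` X)"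
    using assms compact_continuous_image compact_imp_bounded compact_subshift by blast
  then obtain B where "\<forall>y\<in>F ` X. \<bar>y\<bar> \<le> B"
    by (auto simp: bounded_iff)
  then show ?thesis
    by (intro that[of "max B 0"]) (auto simp: le_max_iff_disj)
qed

section \<open>Birkhoff sums and their variation on cylinders\<close>

lemma birkhoff_sum_0 [simp]: "birkhoff_sum F 0 x = 0"
  by (simp add: birkhoff_sum_def)

lemma birkhoff_sum_add:
  "birkhoff_sum F (n + m) x = birkhoff_sum F n x + birkhoff_sum F m ((shift ^^ n) x)"
  by (induction m) (auto simp: birkhoff_sum_def shift_funpow add.assoc)

lemma birkhoff_sum_Suc_right: "birkhoff_sum F (Suc n) x = birkhoff_sum F n x + F ((shift ^^ n) x)"
  by (simp add: birkhoff_sum_def)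

lemma birkhoff_sum_diff: "birkhoff_sum (\<lambda>x. F x - G x) n x = birkhoff_sum F n x - birkhoff_sum G n x"
  by (simp add: birkhoff_sum_def sum_subtractf)

lemma birkhoff_sum_plus: "birkhoff_sum (\<lambda>x. F x + G x) n x = birkhoff_sum F n x + birkhoff_sum G n x"
  by (simp add: birkhoff_sum_def sum.distrib)

lemma birkhoff_sum_plus_const: "birkhoff_sum (\<lambda>x. F x + c) n x = birkhoff_sum F n x + real n * c"
  by (simp add: birkhoff_sum_def sum.distrib)

lemma birkhoff_sum_bound:
  assumes "subshift X" "\<And>x. x \<in> X \<Longrightarrow> \<bar>F x\<bar> \<le> B" "x \<in> X"
  shows "\<bar>birkhoff_sum F n x\<bar> \<le> real n * B"
proof (induction n)
  case (Suc n)
  have "\<bar>F ((shift ^^ n) x)\<bar> \<le> B" using assms by (simp add: subshift_funpow)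
  then show ?case using Suc by (simp add: birkhoff_sum_Suc_right algebra_simps)
qed simp

lemma birkhoff_sum_mult_blocks:
  "birkhoff_sum F (j * N) x = (\<Sum>i<j. birkhoff_sum F N ((shift ^^ (i * N)) x))"
proof (induction j)
  case (Suc j)
  have "birkhoff_sum F (Suc j * N) x = birkhoff_sum F (j * N + N) x" by (simp add: add.commute)
  then show ?case using Suc by (simp only: birkhoff_sum_add) simp
qed simp

text \<open>With L from uniform continuity, the term at time i sees a common block of length L as
  long as i + L \<le> n and differs by less than \<epsilon>. Only the last L terms are uncontrolled;
  they cost at most 2 * B each, which gives the constant K.\<close>

lemma birkhoff_sum_variation:
  fixes \<epsilon> :: real
  assumes X: "subshift X" "continuous_on X F" and "\<epsilon> > 0"
  obtains K :: real where "K \<ge> 0" "\<And>n x y. x \<in> X \<Longrightarrow> y \<in> X \<Longrightarrow> block x 0 n = block y 0 n \<Longrightarrow>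
    \<bar>birkhoff_sum F n x - birkhoff_sum F n y\<bar> \<le> \<epsilon> * n + K"
proof -
  obtain L where L: "\<And>x y. x \<in> X \<Longrightarrow> y \<in> X \<Longrightarrow> block x 0 L = block y 0 L \<Longrightarrow> \<bar>F x - F y\<bar> < \<epsilon>"
    using continuous_on_subshift_uniform[OF assms] by blast
  obtain B where B: "B \<ge> 0" "\<And>x. x \<in> X \<Longrightarrow> \<bar>F x\<bar> \<le> B"
    using continuous_on_subshift_bounded[OF X] by blast
  have "\<bar>birkhoff_sum F n x - birkhoff_sum F n y\<bar> \<le> \<epsilon> * n + real L * (2 * B)"
    if xy: "x \<in> X" "y \<in> X" "block x 0 n = block y 0 n" for n x y
  proof -
    have "\<bar>birkhoff_sum F n x - birkhoff_sum F n y\<bar> \<le>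
        (\<Sum>i<n. \<bar>F ((shift ^^ i) x) - F ((shift ^^ i) y)\<bar>)"
      unfolding birkhoff_sum_def sum_subtractf[symmetric] by (rule sum_abs)
    also have "\<dots> \<le> (\<Sum>i<n. \<epsilon> + (if i \<in> {n - L..<n} then 2 * B else 0))"
    proof (rule sum_mono)
      fix i assume "i \<in> {..<n}"
      have mem: "(shift ^^ i) x \<in> X" "(shift ^^ i) y \<in> X"
        using xy subshift_funpow[OF X(1)] by auto
      show "\<bar>F ((shift ^^ i) x) - F ((shift ^^ i) y)\<bar> \<le> \<epsilon> + (if i \<in> {n - L..<n} then 2 * B else 0)"
      proof (cases "i + L \<le> n")
        case True
        then have "block ((shift ^^ i) x) 0 L = block ((shift ^^ i) y) 0 L"
          using xy(3) by (auto simp: block_eq_iff shift_funpow)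
        from L[OF mem this] show ?thesis using B(1) by auto
      next
        case False
        then show ?thesis using B(2)[OF mem(1)] B(2)[OF mem(2)] \<open>\<epsilon> > 0\<close> \<open>i \<in> {..<n}\<close> by auto
      qed
    qed
    also have "\<dots> = \<epsilon> * n + (\<Sum>i\<in>{n - L..<n}. 2 * B)"
    proof -
      have "(\<Sum>i<n. if i \<in> {n - L..<n} then 2 * B else 0) = (\<Sum>i\<in>{..<n} \<inter> {n - L..<n}. 2 * B)"
        by (rule sum.inter_restrict[symmetric]) simp
      also have "{..<n} \<inter> {n - L..<n} = {n - L..<n}" by auto
      finally have "(\<Sum>i<n. if i \<in> {n - L..<n} then 2 * B else 0) = (\<Sum>i\<in>{n - L..<n}. 2 * B)" .
      then show ?thesis by (simp only: sum.distrib) simp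
    qed
    also have "\<dots> \<le> \<epsilon> * n + real L * (2 * B)"
      using B(1) by (auto intro!: mult_right_mono)
    finally show ?thesis .
  qed
  then show ?thesis using B(1) by (intro that[of "real L * (2 * B)"]) auto
qed

section \<open>Weights of words\<close>

definition cyl_sup :: "(nat \<Rightarrow> nat) set \<Rightarrow> ((nat \<Rightarrow> nat) \<Rightarrow> real) \<Rightarrow> nat list \<Rightarrow> real" where
  "cyl_sup X F u = (SUP x\<in>cylinder X u. exp (birkhoff_sum F (length u) x))"

lemma cyl_sup_attained:
  assumes X: "subshift X" "continuous_on X F" "u \<in> words X n"
  obtains x where "x \<in> X" "block x 0 n = u" "cyl_sup X F u = exp (birkhoff_sum F n x)"
    "\<forall>y\<in>X. block y 0 n = u \<longrightarrow> birkhoff_sum F n y \<le> birkhoff_sum F n x"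
proof -
  have len: "length u = n" using length_words[OF X(3)] .
  have cyl: "cylinder X u = X \<inter> {x. block x 0 n = u}"
    by (auto simp: cylinder_def len)
  have "compact (cylinder X u)"
    unfolding cyl by (intro compact_Int_closed compact_subshift X closed_block)
  moreover have ne: "cylinder X u \<noteq> {}"
    using wordsE[OF X(1,3)] cyl by blast
  moreover have "continuous_on (cylinder X u) (birkhoff_sum F n)"
    using continuous_on_birkhoff_sum[OF X(1,2)] cyl continuous_on_subset by blast
  ultimately obtain x where x: "x \<in> cylinder X u" "\<And>y. y \<in> cylinder X u \<Longrightarrow> birkhoff_sum F n y \<le> birkhoff_sum F n x"
    using continuous_attains_sup[of "cylinder X u" "birkhoff_sum F n"] by metis
  have "cyl_sup X F u = exp (birkhoff_sum F n x)"
    unfolding cyl_sup_def len using x by (intro cSup_eq_maximum) auto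
  then show ?thesis using x cyl that by auto
qed

lemma cyl_sup_upper:
  assumes "subshift X" "continuous_on X F" "x \<in> X"
  shows "exp (birkhoff_sum F n x) \<le> cyl_sup X F (block x 0 n)"
proof -
  obtain z where "z \<in> X" "block z 0 n = block x 0 n" "cyl_sup X F (block x 0 n) = exp (birkhoff_sum F n z)"
    "\<forall>y\<in>X. block y 0 n = block x 0 n \<longrightarrow> birkhoff_sum F n y \<le> birkhoff_sum F n z"
    by (rule cyl_sup_attained[OF assms(1,2) block_in_words[OF assms(3), of 0 n]])
  then show ?thesis using assms(3) by simp
qed

lemma cyl_sup_pos: "subshift X \<Longrightarrow> continuous_on X F \<Longrightarrow> u \<in> words X n \<Longrightarrow> cyl_sup X F u > 0"
  by (erule (2) cyl_sup_attained) simp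

text \<open>The value at any point of the cylinder may replace the weight of the word; only the
  direction in which the point can fall short of the maximum costs the variation.\<close>

lemma cyl_sup_variation:
  fixes \<epsilon> :: real
  assumes X: "subshift X" "continuous_on X F" and "\<epsilon> > 0"
  obtains K :: real where "K \<ge> 0" "\<And>n x. x \<in> X \<Longrightarrow> 
    ln (cyl_sup X F (block x 0 n)) - (\<epsilon> * n + K) \<le> birkhoff_sum F n x"
    "\<And>n x. x \<in> X \<Longrightarrow> birkhoff_sum F n x \<le> ln (cyl_sup X F (block x 0 n))"
proof -
  obtain K where K: "K \<ge> 0" "\<And>n x y. x \<in> X \<Longrightarrow> y \<in> X \<Longrightarrow> block x 0 n = block y 0 n \<Longrightarrow>
    \<bar>birkhoff_sum F n x - birkhoff_sum F n y\<bar> \<le> \<epsilon> * n + K"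
    using birkhoff_sum_variation[OF assms] by blast
  have "birkhoff_sum F n x \<le> ln (cyl_sup X F (block x 0 n)) \<and>
    ln (cyl_sup X F (block x 0 n)) - (\<epsilon> * n + K) \<le> birkhoff_sum F n x" if xX: "x \<in> X" for n x
  proof -
    obtain z where z: "z \<in> X" "block z 0 n = block x 0 n" "cyl_sup X F (block x 0 n) = exp (birkhoff_sum F n z)"
      "\<forall>y\<in>X. block y 0 n = block x 0 n \<longrightarrow> birkhoff_sum F n y \<le> birkhoff_sum F n z"
      by (rule cyl_sup_attained[OF X block_in_words[OF xX, of 0 n]])
    then show ?thesis using K(2)[of z x n] that by (auto simp: abs_le_iff)
  qed
  then show ?thesis using K(1) that by blast
qed

text \<open>Cut a maximising point of the long word: its beginning competes in the cylinder of u,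
  its shift by \<open>length u\<close> in the cylinder of v.\<close>

lemma cyl_sup_append:
  assumes X: "subshift X" "continuous_on X F" and "u @ v \<in> words X (length u + length v)"
  shows "u \<in> words X (length u)" "v \<in> words X (length v)" "cyl_sup X F (u @ v) \<le> cyl_sup X F u * cyl_sup X F v"
proof -
  obtain x where x: "x \<in> X" "block x 0 (length u + length v) = u @ v"
     "cyl_sup X F (u @ v) = exp (birkhoff_sum F (length u + length v) x)"
    by (rule cyl_sup_attained[OF assms])
  have b: "block x 0 (length u) = u" "block x (length u) (length v) = v"
    using x(2) by (auto simp: block_add)
  then show "u \<in> words X (length u)" "v \<in> words X (length v)"
    using block_in_words[OF x(1)] by metis+
  have "exp (birkhoff_sum F (length u) x) \<le> cyl_sup X F u"
    using cyl_sup_upper[OF X x(1), of "length u"] by (simp add: b)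
  moreover have "exp (birkhoff_sum F (length v) ((shift ^^ length u) x)) \<le> cyl_sup X F v"
    using cyl_sup_upper[OF X subshift_funpow[OF X(1) x(1)], of "length v" "length u"] by (simp add: b)
  ultimately show "cyl_sup X F (u @ v) \<le> cyl_sup X F u * cyl_sup X F v"
    unfolding x(3) birkhoff_sum_add exp_add
    by (intro mult_mono) (auto intro: order_trans[OF less_imp_le[OF exp_gt_zero]])
qed

section \<open>Free concatenation in irreducible shifts of finite type\<close>

lemma closed_block_pred: "closed {x :: nat \<Rightarrow> nat. Q (block x 0 n)}"
proof -
  have "- {x :: nat \<Rightarrow> nat. Q (block x 0 n)} = (\<Union>u\<in>{u. \<not> Q u}. {x. block x 0 n = u})" by auto
  then show ?thesis unfolding closed_def using open_block by auto
qed

text \<open>Closedness is the issue: membership is a conjunction of conditions on initial blocks,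
  and each of these defines a closed set.\<close>

lemma one_step_sft_subshift:
  assumes "one_step_sft X" shows "subshift X"
proof -
  obtain k F where k: "k \<ge> 1"
    and X: "X = {x \<in> full_shift k. \<forall>w\<in>F. \<forall>i. block x i (length w) \<noteq> w}"
    using assms unfolding one_step_sft_def by blast
  \<comment> \<open>\<open>Q n\<close> collects the conditions visible in the first n coordinates;
    every forbidden occurrence shows up for large n.\<close>
  define Q where "Q n u \<longleftrightarrow> (\<forall>i<n. u ! i \<in> {1..k}) \<and>
    (\<forall>w\<in>F. \<forall>i. i + length w \<le> n \<longrightarrow> take (length w) (drop i u) \<noteq> w)" for n u
  have tb: "take l (drop i (block x 0 n)) = block x i l" if "i + l \<le> n" for x :: "nat \<Rightarrow> nat" and l i n
    using that by (simp add: drop_block take_block)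
  have "X = (\<Inter>n. {x. Q n (block x 0 n)})"
  proof (intro set_eqI iffI)
    fix x assume x: "x \<in> X"
    show "x \<in> (\<Inter>n. {x. Q n (block x 0 n)})"
      using x unfolding X Q_def full_shift_def by (auto simp: tb)
  next
    fix x assume x: "x \<in> (\<Inter>n. {x. Q n (block x 0 n)})"
    have "x i \<in> {1..k}" for i
    proof -
      have "Q (Suc i) (block x 0 (Suc i))" using x by blast
      then show ?thesis unfolding Q_def by (metis add_0 lessI nth_block)
    qed
    moreover have "block x i (length w) \<noteq> w" if "w \<in> F" for i w
    proof -
      have "Q (i + length w) (block x 0 (i + length w))" using x by blast
      then show ?thesis unfolding Q_def using that tb by (metis order_refl)
    qed
    ultimately show "x \<in> X" unfolding X full_shift_def by blast
  qed
  moreover have "closed (\<Inter>n. {x. Q n (block x 0 n)})"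
    using closed_block_pred[of "Q n" n for n] by (intro closed_INT) simp
  ultimately have "closed X" by simp
  moreover have "shift ` X \<subseteq> X"
  proof -
    have "block (shift x) i n = block x (Suc i) n" for x i n
      using block_funpow[of 1 x i n] by simp
    then show ?thesis unfolding X full_shift_def by (auto simp: shift_def)
  qed
  moreover have "X \<subseteq> full_shift k" unfolding X by blast
  ultimately show ?thesis unfolding subshift_def using k by blast
qed

text \<open>The windows may come from different points of X. That is enough because a forbidden word
  has length at most 2 and so fits into a window.\<close>

lemma one_step_sft_memI:
  assumes "one_step_sft X" "\<And>i. block z i 2 \<in> words X 2"
  shows "z \<in> X"
proof -
  obtain k F where F: "\<And>w. w \<in> F \<Longrightarrow> length w \<le> 2"
    and X: "X = {x \<in> full_shift k. \<forall>w\<in>F. \<forall>i. block x i (length w) \<noteq> w}"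
    using assms(1) unfolding one_step_sft_def by blast
  have *: "\<exists>x\<in>X. \<exists>j. block z i 2 = block x j 2" for i
    using assms(2)[of i] unfolding words_def by blast
  have "z i \<in> {1..k}" for i
  proof -
    obtain x j where x: "x \<in> X" "block z i 2 = block x j 2" using * by blast
    then have "z i = x j" by (auto simp: block_eq_iff dest: spec[of _ 0])
    then show ?thesis using x(1) unfolding X full_shift_def by simp
  qed
  moreover have "block z i (length w) \<noteq> w" if "w \<in> F" for w i
  proof -
    obtain x j where x: "x \<in> X" "block z i 2 = block x j 2" using * by blast
    then have "block z i (length w) = block x j (length w)"
      using F[OF that] by (auto simp: block_eq_iff)
    then show ?thesis using x(1) that unfolding X by auto
  qed
  ultimately show ?thesis unfolding X full_shift_def by blast
qed

section \<open>Concatenation of words with a fixed connecting word\<close>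

definition concat_blocks :: "nat \<Rightarrow> (nat \<Rightarrow> nat list) \<Rightarrow> nat \<Rightarrow> nat" where
  "concat_blocks N \<omega> i = \<omega> (i div N) ! (i mod N)"

lemma cc_nth: "t < N \<Longrightarrow> concat_blocks N \<omega> (j * N + t) = \<omega> j ! t"
  by (simp add: concat_blocks_def)

lemma block_concat_blocks: "t + m \<le> N \<Longrightarrow> length (\<omega> j) = N \<Longrightarrow> block (concat_blocks N \<omega>) (j * N + t) m = take m (drop t (\<omega> j))"
  by (auto simp: list_eq_iff_nth_eq cc_nth add.assoc)

lemma shift_concat_blocks: "N \<ge> 1 \<Longrightarrow> (shift ^^ (j * N)) (concat_blocks N \<omega>) = concat_blocks N (\<lambda>i. \<omega> (i + j))"
  by (auto simp: shift_funpow concat_blocks_def fun_eq_iff add.commute)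

text \<open>All sequences over S are allowed, not only periodic ones, so that independent random
  words can be concatenated as well.\<close>

definition concat_closed :: "(nat \<Rightarrow> nat) set \<Rightarrow> nat \<Rightarrow> nat list set \<Rightarrow> nat list \<Rightarrow> bool" where
  "concat_closed X n S z \<longleftrightarrow> (\<forall>\<omega>. (\<forall>i. \<omega> i \<in> S) \<longrightarrow> concat_blocks (n + length z) (\<lambda>i. \<omega> i @ z) \<in> X)"

text \<open>The weights are arbitrary so that one property serves for the fibre of a single word,
  for all words of X, and for words of Y with weights pulled back to X. The single constant K bounds
  both the length of the connecting word and the loss of weight.\<close>

definition free_concat :: "(nat \<Rightarrow> nat) set \<Rightarrow> nat \<Rightarrow> bool" where
  "free_concat X K \<longleftrightarrow> (\<forall>n\<ge>1. \<forall>S\<subseteq>words X n. \<forall>wt :: nat list \<Rightarrow> real. (\<forall>u\<in>S. wt u \<ge> 0) \<longrightarrow>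
     (\<exists>S'\<subseteq>S. \<exists>z. length z \<le> K \<and> concat_closed X n S' z \<and> sum wt S \<le> real K * sum wt S'))"

lemma free_concatD:
  assumes "free_concat X K" "n \<ge> 1" "S \<subseteq> words X n" "\<And>u. u \<in> S \<Longrightarrow> (wt u :: real) \<ge> 0"
  obtains S' z where "S' \<subseteq> S" "length z \<le> K" "concat_closed X n S' z" "sum wt S \<le> real K * sum wt S'"
proof -
  have "\<exists>S'\<subseteq>S. \<exists>z. length z \<le> K \<and> concat_closed X n S' z \<and> sum wt S \<le> real K * sum wt S'"
    using assms(1)[unfolded free_concat_def, rule_format, OF assms(2,3)] assms(4) by simp
  then show ?thesis using that by (elim exE conjE)
qed

lemma language_pair:
  assumes "v \<in> language X" "Suc t < length v"
  shows "[v ! t, v ! Suc t] \<in> words X 2"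
proof -
  obtain x i n where "x \<in> X" "v = block x i n" using assms(1) by (auto simp: language_def words_def)
  moreover have "[v ! t, v ! Suc t] = block x (i + t) 2"
    using assms(2) calculation by (auto simp: block_2)
  ultimately show ?thesis using block_in_words by metis
qed

text \<open>Pigeonhole on the pair of first and last symbol: the heaviest of the at most card (A
  \<times> A) classes carries at least the average weight. Within one class all words start with a
  and end with b, so a single word leading from b to a connects any two of them.\<close>

lemma irreducible_sft_free_concat:
  assumes X: "one_step_sft X" "irreducible_shift X" "X \<noteq> {}"
  shows "\<exists>K\<ge>1. free_concat X K"
proof -
  have sub: "subshift X" using one_step_sft_subshift[OF X(1)] .
  define A where "A = {a. [a] \<in> words X 1}"
  have fin: "finite A"
    using finite_vimageI[OF finite_words[OF sub, of 1], of "\<lambda>a. [a]"]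
    by (simp add: A_def vimage_def inj_def)
  have symA: "x i \<in> A" if "x \<in> X" for x i
    using block_in_words[OF that, of i 1] by (simp add: A_def block_def)
  then have Ane: "A \<noteq> {}" using X(3) by blast
  have "\<exists>w. [b] @ w @ [a] \<in> language X" if "a \<in> A" "b \<in> A" for a b
    using X(2) that unfolding irreducible_shift_def A_def language_def by blast
  \<comment> \<open>The connecting word runs from the last symbol b of one word to the first symbol
    a of the next.\<close>
  then obtain c where c: "\<And>a b. a \<in> A \<Longrightarrow> b \<in> A \<Longrightarrow> [b] @ c a b @ [a] \<in> language X"
    by metis
  \<comment> \<open>Large enough both for the number of classes and for every connecting
    word.\<close>
  define K where "K = max (card (A \<times> A)) (Max ((\<lambda>(a, b). length (c a b)) ` (A \<times> A)))"
  have cK: "length (c a b) \<le> K" if "a \<in> A" "b \<in> A" for a b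
  proof -
    have "length (c a b) \<le> Max ((\<lambda>(a, b). length (c a b)) ` (A \<times> A))"
      using that fin by (intro Max_ge) force+
    then show ?thesis by (simp add: K_def)
  qed
  have "card (A \<times> A) \<ge> 1"
    using fin Ane by (simp add: Suc_le_eq card_gt_0_iff)
  then have K1: "K \<ge> 1" "card (A \<times> A) \<le> K" by (auto simp: K_def)
  have "\<exists>S'\<subseteq>S. \<exists>z. length z \<le> K \<and> concat_closed X n S' z \<and> sum wt S \<le> real K * sum wt S'"
    if n: "n \<ge> 1" and S: "S \<subseteq> words X n" and wt: "\<forall>u\<in>S. wt u \<ge> (0::real)" for n S wt
  proof -
    define f where "f q = sum wt {u \<in> S. (hd u, last u) = q}" for q
    have finS: "finite S" using finite_subset[OF S finite_words[OF sub]] .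
    have hl: "hd u \<in> A \<and> last u \<in> A" if uS: "u \<in> S" for u
    proof -
      obtain x where x: "x \<in> X" "u = block x 0 n" using S uS wordsE[OF sub, of u n] by blast
      then have "u \<noteq> []" using n by (metis length_block list.size(3) not_one_le_zero)
      then have "hd u = x 0" "last u = x (n - 1)"
        using x n by (auto simp: hd_conv_nth last_conv_nth)
      then show ?thesis using symA x by simp
    qed
    have "Max (f ` (A \<times> A)) \<in> f ` (A \<times> A)"
      using fin Ane by (intro Max_in) auto
    then obtain q where q: "q \<in> A \<times> A" "f q = Max (f ` (A \<times> A))" by (metis imageE)
    have fq: "f r \<le> f q" if "r \<in> A \<times> A" for r
      unfolding q(2) using fin that by (intro Max_ge) auto
    obtain a b where ab: "q = (a, b)" "a \<in> A" "b \<in> A" using q(1) by auto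
    define S' where "S' = {u \<in> S. (hd u, last u) = (a, b)}"
    have "sum wt S = (\<Sum>r\<in>A \<times> A. f r)"
      unfolding f_def using finS fin hl
      by (intro sum.group[symmetric]) auto
    also have "\<dots> \<le> (\<Sum>r\<in>A \<times> A. f q)" by (intro sum_mono fq)
    also have "\<dots> = real (card (A \<times> A)) * sum wt S'" by (simp add: f_def S'_def ab)
    also have "\<dots> \<le> real K * sum wt S'"
      using K1 wt by (intro mult_right_mono sum_nonneg) (auto simp: S'_def)
    finally have "sum wt S \<le> real K * sum wt S'" .
    moreover have "concat_closed X n S' (c a b)"
      unfolding concat_closed_def
    proof safe
      fix \<omega> :: "nat \<Rightarrow> nat list" assume \<omega>: "\<forall>i. \<omega> i \<in> S'"
      define w where "w = c a b"
      define N where "N = n + length w"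
      define x where "x = concat_blocks N (\<lambda>i. \<omega> i @ w)"
      have len: "length (\<omega> i) = n" for i using \<omega> S length_words[of "\<omega> i" X n] by (auto simp: S'_def)
      have N: "N \<ge> 1" using n by (simp add: N_def)
      have ne: "\<omega> i \<noteq> []" for i using len[of i] n by auto
      have hdl: "\<omega> i ! 0 = a" "\<omega> i ! (n - 1) = b" for i
        using \<omega> hd_conv_nth[OF ne[of i]] last_conv_nth[OF ne[of i]] len[of i] by (auto simp: S'_def)
      \<comment> \<open>The window of N + 1 symbols from j * N on includes the first symbol a of the
        next block, so two-symbol windows across the seam are covered as well.\<close>
      have xV: "x (j * N + t) = (\<omega> j @ w @ [a]) ! t" if "t \<le> N" for j t
      proof (cases "t < N")
        case True
        then show ?thesis using cc_nth[of t N "\<lambda>i. \<omega> i @ w" j] len[of j]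
          by (auto simp: x_def nth_append N_def)
      next
        case False
        then have t: "t = N" using that by simp
        then have "x (j * N + t) = (\<omega> (Suc j) @ w) ! 0"
          using cc_nth[of 0 N "\<lambda>i. \<omega> i @ w" "Suc j"] N by (simp add: x_def add.commute)
        also have "\<dots> = a" using hdl n len[of "Suc j"] by (auto simp: nth_append)
        also have "a = (\<omega> j @ w @ [a]) ! t" using len[of j] by (simp add: t N_def nth_append)
        finally show ?thesis .
      qed
      have "block x i 2 \<in> words X 2" for i
      proof -
        define j t where "j = i div N" and "t = i mod N"
        have i: "i = j * N + t" "t < N" using N by (auto simp: j_def t_def)
        have "block x i 2 = [x (j * N + t), x (j * N + Suc t)]"
          using i by (simp add: block_2)
        also have "\<dots> = [(\<omega> j @ w @ [a]) ! t, (\<omega> j @ w @ [a]) ! Suc t]"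
          using i(2) by (simp only: xV less_imp_le Suc_leI)
        also have "\<dots> \<in> words X 2"
        proof (cases "Suc t < n")
          case True
          have "\<omega> j \<in> language X" using \<omega> S by (auto simp: S'_def language_def)
          from language_pair[OF this] True len[of j] show ?thesis by (simp add: nth_append)
        next
          case False
          \<comment> \<open>From the last symbol of \<open>\<omega> j\<close> on, which has index n
            - 1, the window lies in \<open>[b] @ w @ [a]\<close>, a word of the language by the
            choice of w.\<close>
          define s where "s = t - (n - 1)"
          have s: "t = n - 1 + s" using False by (auto simp: s_def)
          have l: "Suc s < length ([b] @ w @ [a])" using i(2) n by (simp add: s N_def)
          have nn: "(\<omega> j @ w @ [a]) ! (n - 1 + r) = ([b] @ w @ [a]) ! r" for r
            using hdl(2)[of j] len[of j] n by (cases r) (auto simp: nth_append)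
          show ?thesis
            using language_pair[OF c[OF ab(2,3)], of s] l nn[of s] nn[of "Suc s"] by (simp add: s w_def)
        qed
        finally show ?thesis .
      qed
      then show "concat_blocks (n + length (c a b)) (\<lambda>i. \<omega> i @ c a b) \<in> X"
        using one_step_sft_memI[OF X(1)] by (simp add: x_def N_def w_def)
    qed
    moreover have "S' \<subseteq> S" by (auto simp: S'_def)
    ultimately show ?thesis using cK[OF ab(2,3)] by blast
  qed
  then have "free_concat X K" unfolding free_concat_def by simp
  then show ?thesis using K1(1) by blast
qed

section \<open>The factor map and the weights of its fibres\<close>

locale factor =
  fixes X Y :: "(nat \<Rightarrow> nat) set" and p :: "nat \<Rightarrow> nat" and \<pi> :: "(nat \<Rightarrow> nat) \<Rightarrow> nat \<Rightarrow> nat"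
  assumes X: "subshift X" and Y: "subshift Y" and surj: "\<pi> ` X = Y" and ne: "X \<noteq> {}"
    and pi: "\<And>x i. x \<in> X \<Longrightarrow> \<pi> x i = p (x i)"
begin

lemma pi_in: "x \<in> X \<Longrightarrow> \<pi> x \<in> Y" using surj by blast

lemma Yne: "Y \<noteq> {}" using surj ne by blast

lemma block_pi: "x \<in> X \<Longrightarrow> block (\<pi> x) i n = map p (block x i n)"
  by (auto simp: list_eq_iff_nth_eq pi)

lemma pi_shift: "x \<in> X \<Longrightarrow> \<pi> ((shift ^^ i) x) = (shift ^^ i) (\<pi> x)"
  using subshift_funpow[OF X] by (auto simp: fun_eq_iff shift_funpow pi)

lemma pi_shift1: "x \<in> X \<Longrightarrow> \<pi> (shift x) = shift (\<pi> x)"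
  using pi_shift[of x 1] by simp

lemma map_words: "u \<in> words X n \<Longrightarrow> map p u \<in> words Y n"
  by (metis X block_pi block_in_words pi_in wordsE)

lemma words_Y: "words Y n = map p ` words X n"
proof
  show "map p ` words X n \<subseteq> words Y n" using map_words by blast
  show "words Y n \<subseteq> map p ` words X n"
  proof
    fix v assume "v \<in> words Y n"
    then obtain y where "y \<in> Y" "v = block y 0 n" using wordsE[OF Y] by blast
    moreover then obtain x where "x \<in> X" "y = \<pi> x" using surj by blast
    ultimately show "v \<in> map p ` words X n"
      by (metis block_in_words block_pi imageI)
  qed
qed

lemma continuous_pi: "continuous_on X \<pi>"
proof (rule continuous_on_coordinatewise_then_product)
  fix i show "continuous_on X (\<lambda>x. \<pi> x i)"
  proof (rule continuous_on_if_block[of _ "Suc i"])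
    fix x y assume "x \<in> X" "y \<in> X" "block x 0 (Suc i) = block y 0 (Suc i)"
    then show "\<pi> x i = \<pi> y i" using block_eqD[of x "Suc i" y i] by (simp add: pi)
  qed
qed

lemma continuous_comp: "continuous_on Y h \<Longrightarrow> continuous_on X (\<lambda>x. h (\<pi> x))"
  by (erule continuous_on_compose2[of Y h X \<pi>]) (auto simp: continuous_pi pi_in)

lemma birkhoff_sum_comp: "x \<in> X \<Longrightarrow> birkhoff_sum (\<lambda>x. h (\<pi> x)) n x = birkhoff_sum h n (\<pi> x)"
  by (simp add: birkhoff_sum_def pi_shift)

text \<open>Choose one preimage word for each word of S, pull the weights back and apply the
  property of X to the lifts. The image of a free family is free, with the image of z as connecting
  word; distinct words have distinct lifts, so the weights are preserved.\<close>

lemma free_concat_factor: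
  assumes "free_concat X K" shows "free_concat Y K"
proof -
  have "\<exists>S'\<subseteq>S. \<exists>z. length z \<le> K \<and> concat_closed Y n S' z \<and> sum wt S \<le> real K * sum wt S'"
    if n: "n \<ge> 1" and S: "S \<subseteq> words Y n" and wt: "\<forall>u\<in>S. wt u \<ge> (0::real)" for n S wt
  proof -
    have "\<forall>v\<in>S. \<exists>u. u \<in> words X n \<and> map p u = v" using S words_Y by auto
    then obtain s where s: "\<And>v. v \<in> S \<Longrightarrow> s v \<in> words X n \<and> map p (s v) = v" by metis
    have "s ` S \<subseteq> words X n" "\<And>u. u \<in> s ` S \<Longrightarrow> 0 \<le> wt (map p u)" using s wt by auto
    then obtain S' z where S': "S' \<subseteq> s ` S" "length z \<le> K" "concat_closed X n S' z"
      "sum (\<lambda>u. wt (map p u)) (s ` S) \<le> real K * sum (\<lambda>u. wt (map p u)) S'"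
      by (rule free_concatD[OF assms n])
    have inj: "inj_on s S" using s by (metis inj_onI)
    have inj': "inj_on (map p) (s ` S)" using s by (auto intro!: inj_onI)
    have "sum (\<lambda>u. wt (map p u)) (s ` S) = sum wt S"
      using inj s by (simp add: sum.reindex)
    moreover have "sum (\<lambda>u. wt (map p u)) S' = sum wt (map p ` S')"
      using inj_on_subset[OF inj' S'(1)] by (simp add: sum.reindex)
    moreover have "map p ` S' \<subseteq> S" using S'(1) s by auto
    moreover have "concat_closed Y n (map p ` S') (map p z)"
      unfolding concat_closed_def
    proof safe
      fix \<omega> :: "nat \<Rightarrow> nat list" assume \<omega>: "\<forall>i. \<omega> i \<in> map p ` S'"
      have "\<exists>u. u \<in> S' \<and> map p u = \<omega> i" for i using \<omega>[rule_format, of i] by auto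
      then obtain \<omega>' where \<omega>': "\<And>i. \<omega>' i \<in> S'" "\<And>i. map p (\<omega>' i) = \<omega> i"
        by metis
      have in_X: "concat_blocks (n + length z) (\<lambda>i. \<omega>' i @ z) \<in> X"
        using S'(3) \<omega>'(1) unfolding concat_closed_def by blast
      have len: "length (\<omega>' i) = n" for i using \<omega>'(1)[of i] S'(1) s length_words[of "\<omega>' i" X n] by auto
      have "concat_blocks (n + length (map p z)) (\<lambda>i. \<omega> i @ map p z) = \<pi> (concat_blocks (n + length z) (\<lambda>i. \<omega>' i @ z))"
      proof
        fix i
        have "i mod (n + length z) < length (\<omega>' (i div (n + length z)) @ z)"
          using n len by simp
        then show "concat_blocks (n + length (map p z)) (\<lambda>i. \<omega> i @ map p z) i = \<pi> (concat_blocks (n + length z) (\<lambda>i. \<omega>' i @ z)) i"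
          unfolding pi[OF in_X] by (simp add: concat_blocks_def \<omega>'(2)[symmetric] map_append[symmetric] del: map_append)
      qed
      then show "concat_blocks (n + length (map p z)) (\<lambda>i. \<omega> i @ map p z) \<in> Y"
        using pi_in[OF in_X] by simp
    qed
    ultimately show ?thesis using S'(2,4) by (metis length_map)
  qed
  then show ?thesis unfolding free_concat_def by simp
qed

definition fibre_words :: "nat \<Rightarrow> nat list \<Rightarrow> nat list set" where
  "fibre_words n v = {u \<in> words X n. map p u = v}"

text \<open>This is g_n(v) of the overview as a finite sum over words;
  \<open>fiber_sum_eq_fibre_weight\<close> identifies it with the supremum over choices of
  points.\<close>

definition fibre_weight :: "((nat \<Rightarrow> nat) \<Rightarrow> real) \<Rightarrow> nat \<Rightarrow> nat list \<Rightarrow> real" where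
  "fibre_weight F n v = (\<Sum>u\<in>fibre_words n v. cyl_sup X F u)"

lemma finite_fib [simp]: "finite (fibre_words n v)"
  using finite_words[OF X] by (simp add: fibre_words_def)

lemma fib_nonempty: "v \<in> words Y n \<Longrightarrow> fibre_words n v \<noteq> {}"
  by (auto simp: fibre_words_def words_Y)

lemma fibre_weight_pos: "continuous_on X F \<Longrightarrow> v \<in> words Y n \<Longrightarrow> fibre_weight F n v > 0"
  unfolding fibre_weight_def using fib_nonempty[of v n] cyl_sup_pos[OF X, of F _ n]
  by (intro sum_pos finite_fib) (auto simp: fibre_words_def)

text \<open>Cutting at n embeds the fibre of \<open>v @ w\<close> injectively into the product of
  the two fibres, and weights of words are submultiplicative. This is the subadditivity of log
  g_n.\<close>

lemma fibre_weight_append: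
  assumes F: "continuous_on X F" and "length v = n" "length w = m"
  shows "fibre_weight F (n + m) (v @ w) \<le> fibre_weight F n v * fibre_weight F m w"
proof -
  have tu: "take n u \<in> fibre_words n v \<and> drop n u \<in> fibre_words m w \<and> cyl_sup X F u \<le> cyl_sup X F (take n u) * cyl_sup X F (drop n u)"
    if u: "u \<in> fibre_words (n + m) (v @ w)" for u
  proof -
    have len: "length u = n + m" using u length_words by (auto simp: fibre_words_def)
    have u': "take n u @ drop n u \<in> words X (length (take n u) + length (drop n u))"
      using u len by (simp add: fibre_words_def)
    have "map p (take n u) = v" "map p (drop n u) = w"
      using u assms(2) by (simp_all add: fibre_words_def take_map[symmetric] drop_map[symmetric])
    then show ?thesis using cyl_sup_append[OF X F u'] len by (simp add: fibre_words_def)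
  qed
  have "fibre_weight F (n + m) (v @ w) \<le> (\<Sum>u\<in>fibre_words (n + m) (v @ w). cyl_sup X F (take n u) * cyl_sup X F (drop n u))"
    unfolding fibre_weight_def using tu by (intro sum_mono) blast
  also have "\<dots> = (\<Sum>(a, b)\<in>(\<lambda>u. (take n u, drop n u)) ` fibre_words (n + m) (v @ w). cyl_sup X F a * cyl_sup X F b)"
  proof -
    have "inj_on (\<lambda>u. (take n u, drop n u)) (fibre_words (n + m) (v @ w))"
      by (intro inj_onI) (metis append_take_drop_id prod.inject)
    then show ?thesis by (simp add: sum.reindex)
  qed
  also have "\<dots> \<le> (\<Sum>(a, b)\<in>fibre_words n v \<times> fibre_words m w. cyl_sup X F a * cyl_sup X F b)"
  proof (rule sum_mono2)
    show "(\<lambda>u. (take n u, drop n u)) ` fibre_words (n + m) (v @ w) \<subseteq> fibre_words n v \<times> fibre_words m w"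
      using tu by blast
    fix c assume "c \<in> fibre_words n v \<times> fibre_words m w - (\<lambda>u. (take n u, drop n u)) ` fibre_words (n + m) (v @ w)"
    then show "0 \<le> (case c of (a, b) \<Rightarrow> cyl_sup X F a * cyl_sup X F b)"
      using cyl_sup_pos[OF X F, of "fst c" n] cyl_sup_pos[OF X F, of "snd c" m]
      by (auto simp: fibre_words_def)
  qed simp
  also have "\<dots> = fibre_weight F n v * fibre_weight F m w"
    by (simp add: fibre_weight_def sum_product sum.cartesian_product)
  finally show ?thesis .
qed

end

section \<open>Subadditive sequences and entropy\<close>

text \<open>Early terms, where the ratio is not yet small, are finitely many and go into K;
  conversely K is swallowed by half of \<epsilon> * n for large n.\<close>

lemma tendsto_zero_iff_sublinear:
  fixes a :: "nat \<Rightarrow> real"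
  shows "(\<lambda>n. a n / real n) \<longlonglongrightarrow> 0 \<longleftrightarrow> (\<forall>\<epsilon>>0. \<exists>K. \<forall>n. \<bar>a n\<bar> \<le> \<epsilon> * real n + K)"
proof
  assume lim: "(\<lambda>n. a n / real n) \<longlonglongrightarrow> 0"
  show "\<forall>\<epsilon>>0. \<exists>K. \<forall>n. \<bar>a n\<bar> \<le> \<epsilon> * real n + K"
  proof (intro allI impI)
    fix \<epsilon> :: real assume "\<epsilon> > 0"
    then obtain N where N: "\<And>n. n \<ge> N \<Longrightarrow> \<bar>a n / real n\<bar> < \<epsilon>"
      using LIMSEQ_D[OF lim, of \<epsilon>] by auto
    have "\<bar>a n\<bar> \<le> \<epsilon> * real n + (\<Sum>i\<le>N. \<bar>a i\<bar>)" for n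
    proof (cases "n \<le> N")
      case True
      then have "\<bar>a n\<bar> \<le> (\<Sum>i\<le>N. \<bar>a i\<bar>)" by (intro member_le_sum) auto
      then show ?thesis using \<open>\<epsilon> > 0\<close> by (simp add: add_increasing)
    next
      case False
      then have "\<bar>a n\<bar> < \<epsilon> * real n" using N[of n] by (simp add: abs_divide divide_less_eq)
      moreover have "0 \<le> (\<Sum>i\<le>N. \<bar>a i\<bar>)" by (intro sum_nonneg) auto
      ultimately show ?thesis by linarith
    qed
    then show "\<exists>K. \<forall>n. \<bar>a n\<bar> \<le> \<epsilon> * real n + K" by blast
  qed
next
  assume *: "\<forall>\<epsilon>>0. \<exists>K. \<forall>n. \<bar>a n\<bar> \<le> \<epsilon> * real n + K"
  show "(\<lambda>n. a n / real n) \<longlonglongrightarrow> 0"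
  proof (rule LIMSEQ_I)
    fix r :: real assume "r > 0"
    then obtain K where K: "\<And>n. \<bar>a n\<bar> \<le> r / 2 * real n + K"
      using *[rule_format, of "r / 2"] by auto
    obtain N where N: "real N > 2 * \<bar>K\<bar> / r" using reals_Archimedean2 by blast
    have "norm (a n / real n - 0) < r" if "n \<ge> Suc N" for n
    proof -
      have "2 * \<bar>K\<bar> / r < real n" using N that by linarith
      then have "2 * \<bar>K\<bar> < r * real n" using \<open>r > 0\<close> by (simp add: divide_less_eq mult.commute)
      then have "\<bar>a n\<bar> < r * real n" using K[of n] by linarith
      then show ?thesis using that by (simp add: abs_divide divide_less_eq)
    qed
    then show "\<exists>no. \<forall>n\<ge>no. norm (a n / real n - 0) < r" by blast
  qed
qed

lemma tendsto_zero_if_sublinear: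
  fixes a :: "nat \<Rightarrow> real"
  assumes "\<And>\<epsilon>. \<epsilon> > 0 \<Longrightarrow> \<exists>K. \<forall>n\<ge>1. \<bar>a n\<bar> \<le> \<epsilon> * real n + K"
  shows "(\<lambda>n. a n / real n) \<longlonglongrightarrow> 0"
proof -
  have "\<exists>K. \<forall>n. \<bar>a n\<bar> \<le> \<epsilon> * real n + K" if e: "\<epsilon> > 0" for \<epsilon>
  proof -
    obtain K where K: "\<forall>n\<ge>1. \<bar>a n\<bar> \<le> \<epsilon> * real n + K" using assms[OF e] by blast
    have "\<bar>a n\<bar> \<le> \<epsilon> * real n + max K \<bar>a 0\<bar>" for n
    proof (cases "n = 0")
      case False
      then have "\<bar>a n\<bar> \<le> \<epsilon> * real n + K" using K by simp
      then show ?thesis by linarith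
    qed simp
    then show ?thesis by blast
  qed
  then show ?thesis using tendsto_zero_iff_sublinear by blast
qed

lemma tendsto_if_sublinear:
  fixes a :: "nat \<Rightarrow> real"
  assumes "\<And>\<epsilon>. \<epsilon> > 0 \<Longrightarrow> \<exists>K. \<forall>n\<ge>1. \<bar>a n - c * real n\<bar> \<le> \<epsilon> * real n + K"
  shows "(\<lambda>n. a n / real n) \<longlonglongrightarrow> c"
proof -
  have "(\<lambda>n. (a n - c * real n) / real n) \<longlonglongrightarrow> 0"
    by (rule tendsto_zero_if_sublinear) (rule assms)
  then have "(\<lambda>n. (a n - c * real n) / real n + c) \<longlonglongrightarrow> 0 + c"
    by (intro tendsto_intros)
  moreover have "\<forall>\<^sub>F n in sequentially. (a n - c * real n) / real n + c = a n / real n"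
    by (rule eventually_sequentiallyI[of 1]) (simp add: diff_divide_distrib)
  ultimately show ?thesis using Lim_transform_eventually by fastforce
qed

lemma sublinear_if_tendsto:
  fixes a :: "nat \<Rightarrow> real"
  assumes "(\<lambda>n. a n / real n) \<longlonglongrightarrow> c" "\<epsilon> > 0"
  shows "\<exists>K. \<forall>n. \<bar>a n - c * real n\<bar> \<le> \<epsilon> * real n + K"
proof -
  have "(\<lambda>n. a n / real n - c) \<longlonglongrightarrow> 0" using assms(1) by (simp add: LIM_zero)
  moreover have "\<forall>\<^sub>F n in sequentially. a n / real n - c = (a n - c * real n) / real n"
    by (rule eventually_sequentiallyI[of 1]) (simp add: diff_divide_distrib)
  ultimately have "(\<lambda>n. (a n - c * real n) / real n) \<longlonglongrightarrow> 0" by (rule Lim_transform_eventually)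
  then show ?thesis using tendsto_zero_iff_sublinear[of "\<lambda>n. a n - c * real n"] assms(2) by blast
qed

text \<open>Subadditivity is asked for only when the first length is a multiple of l: along a point
  of period l the shift by such a length returns to the point. The linear bounds bridge the
  remainders, and the limit is the infimum over multiples of l.\<close>

lemma Fekete:
  fixes a :: "nat \<Rightarrow> real"
  assumes l: "l \<ge> 1" and C0: "C \<ge> 0"
    and sub: "\<And>n m. a (n * l + m) \<le> a (n * l) + a m"
    and upper: "\<And>n m. a (n + m) \<le> a n + C * real m"
    and lower: "\<And>n. a n \<ge> - C * real n"
  obtains c where "(\<lambda>n. a n / real n) \<longlonglongrightarrow> c" "\<And>n. n \<ge> 1 \<Longrightarrow> c \<le> a (n * l) / real (n * l)"
proof -
  define c where "c = (INF n\<in>{1..}. a (n * l) / real (n * l))"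
  have bdd: "bdd_below ((\<lambda>n. a (n * l) / real (n * l)) ` {1..})"
  proof (rule bdd_belowI2)
    fix n :: nat assume "n \<in> {1..}"
    then show "- C \<le> a (n * l) / real (n * l)"
      using lower[of "n * l"] l by (simp add: le_divide_eq)
  qed
  have c_le: "c \<le> a (n * l) / real (n * l)" if "n \<ge> 1" for n
    unfolding c_def using bdd that by (intro cINF_lower) auto
  have iter: "a (q * (n * l) + r) \<le> real q * a (n * l) + a r" for q n r
  proof (induction q)
    case (Suc q)
    have "a (Suc q * (n * l) + r) = a (n * l + (q * (n * l) + r))" by (simp add: algebra_simps)
    also have "\<dots> \<le> a (n * l) + a (q * (n * l) + r)" by (rule sub)
    finally show ?case using Suc by (simp add: algebra_simps)
  qed simp
  have "(\<lambda>n. a n / real n) \<longlonglongrightarrow> c"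
  proof (rule tendsto_if_sublinear)
    fix \<epsilon> :: real assume e: "\<epsilon> > 0"
    \<comment> \<open>A nearly optimal multiple M of l; long lengths are divided by M, with a
      remainder that costs a constant.\<close>
    obtain n where n: "n \<ge> 1" "a (n * l) / real (n * l) < c + \<epsilon>"
      using cINF_less_iff[OF _ bdd, of "c + \<epsilon>"] e by (auto simp: c_def)
    define M where "M = n * l"
    have M: "M \<ge> 1" "a M < (c + \<epsilon>) * real M"
      using n l by (auto simp: M_def divide_less_eq Suc_le_eq)
    define D where "D = (\<Sum>r<M. \<bar>a r\<bar>) + \<bar>c + \<epsilon>\<bar> * real M"
    define K where "K = max D ((\<bar>c\<bar> + C) * real l)"
    have "\<bar>a N - c * real N\<bar> \<le> \<epsilon> * real N + K" if "N \<ge> 1" for N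
    proof (rule abs_leI)
      define q r where "q = N div M" and "r = N mod M"
      have N: "N = q * M + r" "r < M" using M by (auto simp: q_def r_def)
      have "a N \<le> real q * a M + a r" using iter[of q n r] N by (simp add: M_def)
      moreover have "real q * a M \<le> real q * ((c + \<epsilon>) * real M)"
        using M by (intro mult_left_mono) auto
      moreover have "real q * ((c + \<epsilon>) * real M) = (c + \<epsilon>) * real N - (c + \<epsilon>) * real r"
      proof -
        have "real N = real q * real M + real r" using N(1) by (metis of_nat_add of_nat_mult)
        then show ?thesis by (simp add: algebra_simps)
      qed
      moreover have "(- (c + \<epsilon>)) * real r \<le> \<bar>c + \<epsilon>\<bar> * real M"
        using N(2) by (intro mult_mono) auto
      then have "- ((c + \<epsilon>) * real r) \<le> \<bar>c + \<epsilon>\<bar> * real M"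
        by (simp only: mult_minus_left)
      moreover have "a r \<le> (\<Sum>r<M. \<bar>a r\<bar>)"
        using member_le_sum[of r "{..<M}" "\<lambda>r. \<bar>a r\<bar>"] N(2) by simp
      ultimately have "a N \<le> (c + \<epsilon>) * real N + D" unfolding D_def by linarith
      then show "a N - c * real N \<le> \<epsilon> * real N + K" by (simp add: K_def algebra_simps)
    next
      \<comment> \<open>For the lower bound N is rounded up to a multiple of l, since the infimum is
        taken over multiples only.\<close>
      define n' where "n' = Suc (N div l)"
      have "N div l * l + N mod l = N" "N mod l < l" using l by (simp_all only: div_mult_mod_eq) simp
      moreover have "n' * l = N div l * l + l" by (simp add: n'_def)
      ultimately have n': "N \<le> n' * l" "n' * l \<le> N + l" by linarith+
      have n'1: "n' \<ge> 1" by (simp add: n'_def)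
      have "a (n' * l) \<le> a N + C * real (n' * l - N)"
        using upper[of N "n' * l - N"] n' by simp
      also have "C * real (n' * l - N) \<le> C * real l"
      proof -
        have "n' * l - N \<le> l" using n' by linarith
        then show ?thesis using C0 by (intro mult_left_mono) (simp_all only: of_nat_le_iff)
      qed
      finally have 1: "a (n' * l) \<le> a N + C * real l" by simp
      have "c * real (n' * l) \<le> a (n' * l)"
        using c_le[OF n'1] n'1 l by (simp add: le_divide_eq)
      moreover have "\<bar>c * real (n' * l) - c * real N\<bar> \<le> \<bar>c\<bar> * real l"
      proof -
        have "\<bar>c * real (n' * l) - c * real N\<bar> = \<bar>c\<bar> * \<bar>real (n' * l) - real N\<bar>"
          by (simp add: abs_mult[symmetric] algebra_simps)
        also have "\<dots> \<le> \<bar>c\<bar> * real l" using n' by (intro mult_left_mono) linarith+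
        finally show ?thesis .
      qed
      ultimately have "c * real N \<le> a N + (\<bar>c\<bar> + C) * real l" using 1 by (simp add: algebra_simps)
      then show "- (a N - c * real N) \<le> \<epsilon> * real N + K"
      proof -
        have "0 \<le> \<epsilon> * real N" using e by simp
        moreover have "(\<bar>c\<bar> + C) * real l \<le> K" by (simp add: K_def)
        ultimately show ?thesis using \<open>c * real N \<le> a N + (\<bar>c\<bar> + C) * real l\<close> by linarith
      qed
    qed
    then show "\<exists>K. \<forall>n\<ge>1. \<bar>a n - c * real n\<bar> \<le> \<epsilon> * real n + K" by blast
  qed
  then show ?thesis using c_le that by blast
qed

text \<open>The entropy of the partition into level sets of Z, as minus the integral of the
  logarithm of the measure of the level set through x. In this form it can be compared with
  integrals of Birkhoff sums pointwise.\<close>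

definition label_entropy :: "'a measure \<Rightarrow> ('a \<Rightarrow> 'b) \<Rightarrow> real" where
  "label_entropy M Z = - (\<integral>x. ln (measure M (Z -` {Z x} \<inter> space M)) \<partial>M)"

lemma label_entropy_cong:
  assumes "\<And>x y. x \<in> space M \<Longrightarrow> y \<in> space M \<Longrightarrow> Z x = Z y \<longleftrightarrow> Z' x = Z' y"
  shows "label_entropy M Z = label_entropy M Z'"
proof -
  have "Z -` {Z x} \<inter> space M = Z' -` {Z' x} \<inter> space M" if "x \<in> space M" for x
    using assms that by auto
  then show ?thesis unfolding label_entropy_def by (simp cong: Bochner_Integration.integral_cong)
qed

section \<open>Finite-valued labels and Gibbs' inequality\<close>

context prob_space
begin

lemma fibre_sets: "simple_function M Z \<Longrightarrow> Z -` {c} \<inter> space M \<in> sets M"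
  by (rule simple_functionD(2))

lemma integral_simple_function:
  assumes "simple_function M Z"
  shows "integrable M (\<lambda>x. \<phi> (Z x) :: real)"
    "(\<integral>x. \<phi> (Z x) \<partial>M) = (\<Sum>c\<in>Z ` space M. \<phi> c * prob (Z -` {c} \<inter> space M))"
proof -
  let ?g = "\<lambda>x. \<Sum>c\<in>Z ` space M. \<phi> c * indicat_real (Z -` {c} \<inter> space M) x"
  have fin: "finite (Z ` space M)" using assms simple_functionD(1) by blast
  have eq: "\<phi> (Z x) = ?g x" if "x \<in> space M" for x
  proof -
    have "?g x = (\<Sum>c\<in>Z ` space M. if c = Z x then \<phi> c else 0)"
      using that by (intro sum.cong) (auto simp: indicator_def)
    then show ?thesis using fin that by simp
  qed
  have int: "integrable M (\<lambda>x. \<phi> c * indicat_real (Z -` {c} \<inter> space M) x)" for c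
    using fibre_sets[OF assms] by (intro integrable_mult_right) (simp add: emeasure_eq_measure)
  have "integrable M ?g" by (intro Bochner_Integration.integrable_sum int)
  then show "integrable M (\<lambda>x. \<phi> (Z x))"
    using eq by (subst Bochner_Integration.integrable_cong[OF refl, of _ _ ?g]) auto
  have "(\<integral>x. \<phi> (Z x) \<partial>M) = (\<integral>x. ?g x \<partial>M)"
    using eq by (intro Bochner_Integration.integral_cong) auto
  also have "\<dots> = (\<Sum>c\<in>Z ` space M. \<phi> c * prob (Z -` {c} \<inter> space M))"
    using int fibre_sets[OF assms] by (subst Bochner_Integration.integral_sum) (auto)
  finally show "(\<integral>x. \<phi> (Z x) \<partial>M) = (\<Sum>c\<in>Z ` space M. \<phi> c * prob (Z -` {c} \<inter> space M))" .
qed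

lemma sum_prob_fibres:
  assumes "simple_function M Z"
  shows "(\<Sum>c\<in>Z ` space M. prob (Z -` {c} \<inter> space M)) = 1"
  using integral_simple_function(2)[OF assms, of "\<lambda>_. 1"] prob_space by simp

text \<open>Since \<open>ln 0 = 0\<close>, level sets of measure zero would spoil pointwise
  inequalities between logarithms; they are finitely many and can be discarded.\<close>

lemma AE_prob_fibre_pos:
  assumes "simple_function M Z"
  shows "AE x in M. prob (Z -` {Z x} \<inter> space M) > 0"
proof -
  have "AE x in M. \<forall>c\<in>Z ` space M. prob (Z -` {c} \<inter> space M) = 0 \<longrightarrow> Z x \<noteq> c"
  proof (rule AE_finite_allI)
    show "finite (Z ` space M)" using assms simple_functionD(1) by blast
    fix c
    show "AE x in M. prob (Z -` {c} \<inter> space M) = 0 \<longrightarrow> Z x \<noteq> c"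
    proof (cases "prob (Z -` {c} \<inter> space M) = 0")
      case True
      then have "Z -` {c} \<inter> space M \<in> null_sets M"
        using fibre_sets[OF assms] by (simp add: null_sets_def emeasure_eq_measure)
      from AE_not_in[OF this] AE_space show ?thesis by eventually_elim auto
    qed simp
  qed
  then show ?thesis using AE_space
    by eventually_elim (metis imageI measure_nonneg order_le_less)
qed

text \<open>Apply ln s \<le> s - 1 to the ratio of W to the true probability and average. Positivity
  of W on classes of positive measure keeps the convention \<open>ln 0 = 0\<close> out of the
  relevant terms.\<close>

lemma Gibbs_inequality:
  assumes Z: "simple_function M Z" and W: "\<And>c. c \<in> Z ` space M \<Longrightarrow> W c \<ge> (0::real)"
    "(\<Sum>c\<in>Z ` space M. W c) \<le> 1"
    "\<And>c. c \<in> Z ` space M \<Longrightarrow> prob (Z -` {c} \<inter> space M) > 0 \<Longrightarrow> W c > 0"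
  shows "label_entropy M Z \<le> - (\<integral>x. ln (W (Z x)) \<partial>M)"
proof -
  let ?q = "\<lambda>c. prob (Z -` {c} \<inter> space M)"
  have "(\<integral>x. ln (W (Z x)) \<partial>M) - (\<integral>x. ln (?q (Z x)) \<partial>M) =
      (\<Sum>c\<in>Z ` space M. ln (W c) * ?q c - ln (?q c) * ?q c)"
    by (subst (1 2) integral_simple_function(2)[OF Z]) (simp add: sum_subtractf)
  also have "\<dots> \<le> (\<Sum>c\<in>Z ` space M. W c - ?q c)"
  proof (rule sum_mono)
    fix c assume c: "c \<in> Z ` space M"
    show "ln (W c) * ?q c - ln (?q c) * ?q c \<le> W c - ?q c"
    proof (cases "?q c > 0")
      case True
      then have W0: "W c > 0" using W(3) c by blast
      have "ln (W c) * ?q c - ln (?q c) * ?q c = ln (W c / ?q c) * ?q c"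
        using True W0 by (simp add: ln_div algebra_simps)
      also have "\<dots> \<le> (W c / ?q c - 1) * ?q c"
        using True W0 by (intro mult_right_mono ln_le_minus_one) auto
      also have "\<dots> = W c - ?q c" using True by (simp add: field_simps)
      finally show ?thesis .
    next
      case False
      then have "?q c = 0" by (metis measure_nonneg order_le_less)
      then show ?thesis using W(1)[OF c] by simp
    qed
  qed
  also have "\<dots> \<le> 0" using W(2) sum_prob_fibres[OF Z] by (simp add: sum_subtractf)
  finally show ?thesis unfolding label_entropy_def by simp
qed

lemma label_entropy_nonneg:
  assumes Z: "simple_function M Z"
  shows "label_entropy M Z \<ge> 0"
proof -
  have "(\<Sum>c\<in>Z ` space M. ln (prob (Z -` {c} \<inter> space M)) * prob (Z -` {c} \<inter> space M)) \<le> 0"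
  proof (rule sum_nonpos)
    fix c
    have "ln (prob (Z -` {c} \<inter> space M)) \<le> 0"
      using prob_le_1[of "Z -` {c} \<inter> space M"] measure_nonneg[of M "Z -` {c} \<inter> space M"]
      by (cases "prob (Z -` {c} \<inter> space M) = 0") (auto simp: less_le)
    then show "ln (prob (Z -` {c} \<inter> space M)) * prob (Z -` {c} \<inter> space M) \<le> 0"
      by (simp add: mult_nonpos_nonneg)
  qed
  then show ?thesis unfolding label_entropy_def
    by (subst integral_simple_function(2)[OF Z, of "\<lambda>c. ln (prob (Z -` {c} \<inter> space M))"]) simp
qed

text \<open>A class of Z' lies in the class of Z through the same point, so its measure is not
  larger; compare the logarithms almost everywhere and integrate.\<close>

lemma label_entropy_mono:
  assumes Z: "simple_function M Z" and Z': "simple_function M Z'"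
    and r: "\<And>x. x \<in> space M \<Longrightarrow> Z x = r (Z' x)"
  shows "label_entropy M Z \<le> label_entropy M Z'"
proof -
  have "(\<integral>x. ln (prob (Z' -` {Z' x} \<inter> space M)) \<partial>M) \<le> (\<integral>x. ln (prob (Z -` {Z x} \<inter> space M)) \<partial>M)"
  proof (rule integral_mono_AE)
    show "integrable M (\<lambda>x. ln (prob (Z' -` {Z' x} \<inter> space M)))"
      by (rule integral_simple_function(1)[OF Z', of "\<lambda>c. ln (prob (Z' -` {c} \<inter> space M))"])
    show "integrable M (\<lambda>x. ln (prob (Z -` {Z x} \<inter> space M)))"
      by (rule integral_simple_function(1)[OF Z, of "\<lambda>c. ln (prob (Z -` {c} \<inter> space M))"])
    show "AE x in M. ln (prob (Z' -` {Z' x} \<inter> space M)) \<le> ln (prob (Z -` {Z x} \<inter> space M))"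
      using AE_prob_fibre_pos[OF Z'] AE_space
    proof eventually_elim
      case (elim x)
      have "prob (Z' -` {Z' x} \<inter> space M) \<le> prob (Z -` {Z x} \<inter> space M)"
        using r elim by (intro finite_measure_mono fibre_sets Z) auto
      then show ?case using elim by simp
    qed
  qed
  then show ?thesis unfolding label_entropy_def by simp
qed

text \<open>A join may contain the empty set, whose term vanishes; the remaining pieces correspond
  one to one to the values of Z.\<close>

lemma partition_entropy_eq_label_entropy:
  assumes Z: "simple_function M Z" and Q: "finite Q" "Q - {{}} = (\<lambda>c. Z -` {c} \<inter> space M) ` (Z ` space M)"
  shows "partition_entropy M Q = label_entropy M Z"
proof -
  have "(\<Sum>A\<in>Q. prob A * ln (prob A)) = (\<Sum>A\<in>Q - {{}}. prob A * ln (prob A))"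
    using Q(1) by (intro sum.mono_neutral_right) auto
  also have "\<dots> = (\<Sum>c\<in>Z ` space M. prob (Z -` {c} \<inter> space M) * ln (prob (Z -` {c} \<inter> space M)))"
  proof -
    have "inj_on (\<lambda>c. Z -` {c} \<inter> space M) (Z ` space M)"
      by (intro inj_onI) auto
    then show ?thesis unfolding Q(2) by (simp add: sum.reindex)
  qed
  also have "\<dots> = (\<integral>x. ln (prob (Z -` {Z x} \<inter> space M)) \<partial>M)"
    by (subst integral_simple_function(2)[OF Z, of "\<lambda>c. ln (prob (Z -` {c} \<inter> space M))"]) (simp add: mult.commute)
  finally show ?thesis unfolding partition_entropy_def label_entropy_def by simp
qed

end

section \<open>Itineraries and the entropy of a measure-preserving map\<close>

definition part_label :: "'a set set \<Rightarrow> 'a \<Rightarrow> 'a set" where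
  "part_label P x = (THE A. A \<in> P \<and> x \<in> A)"

lemma part_label_eq:
  assumes "partition_on S P" "A \<in> P" "x \<in> A"
  shows "part_label P x = A"
  unfolding part_label_def
proof (rule the_equality)
  fix B assume B: "B \<in> P \<and> x \<in> B"
  show "B = A"
    using partition_onD2[OF assms(1)] assms(2,3) B unfolding disjoint_def by blast
qed (use assms in auto)

lemma part_label:
  assumes "partition_on S P" "x \<in> S"
  shows "part_label P x \<in> P" "x \<in> part_label P x"
proof -
  have "x \<in> \<Union>P" using assms partition_onD1 by blast
  then obtain A where "A \<in> P" "x \<in> A" by blast
  then show "part_label P x \<in> P" "x \<in> part_label P x"
    using part_label_eq[OF assms(1)] by auto
qed

locale measure_preserving = prob_space M for M :: "'a measure" +
  fixes T :: "'a \<Rightarrow> 'a"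
  assumes T: "T \<in> measurable M M" and inv: "distr M M T = M"
begin

lemma T_funpow: "T ^^ i \<in> measurable M M"
proof (induction i)
  case 0 show ?case by (simp add: id_def)
next
  case (Suc i) show ?case using measurable_comp[OF Suc T] by (simp add: comp_def)
qed

lemma T_space: "x \<in> space M \<Longrightarrow> (T ^^ i) x \<in> space M"
  using measurable_space[OF T_funpow] .

lemma distr_funpow: "distr M M (T ^^ i) = M"
proof (induction i)
  case 0 show ?case by (simp add: id_def)
next
  case (Suc i)
  have "distr M M (T ^^ Suc i) = distr (distr M M (T ^^ i)) M T"
    unfolding funpow.simps by (rule distr_distr[OF T T_funpow, symmetric])
  then show ?case by (simp only: Suc inv)
qed

lemma integral_funpow:
  fixes g :: "'a \<Rightarrow> real"
  assumes "g \<in> borel_measurable M"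
  shows "(\<integral>x. g ((T ^^ i) x) \<partial>M) = (\<integral>x. g x \<partial>M)"
  using integral_distr[OF T_funpow assms, of i] by (simp add: distr_funpow)

lemma integrable_funpow:
  fixes g :: "'a \<Rightarrow> real"
  assumes "integrable M g"
  shows "integrable M (\<lambda>x. g ((T ^^ i) x))"
  using integrable_distr[OF T_funpow, of i g] assms by (simp add: distr_funpow)

lemma prob_funpow:
  assumes "A \<in> sets M"
  shows "prob ((T ^^ i) -` A \<inter> space M) = prob A"
  using measure_distr[OF T_funpow assms, of i] by (simp add: distr_funpow)

text \<open>Restriction to \<open>{..<n}\<close> puts itineraries into
  \<open>{..<n} \<rightarrow>\<^sub>E P\<close>, the index set of \<open>iterated_join\<close>, so
  that level sets of the itinerary are the nonempty pieces of the join.\<close>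

definition itinerary :: "'a set set \<Rightarrow> nat \<Rightarrow> 'a \<Rightarrow> nat \<Rightarrow> 'a set" where
  "itinerary P n x = restrict (\<lambda>i. part_label P ((T ^^ i) x)) {..<n}"

lemma itinerary_add: "restrict (itinerary P (n + m) x) {..<n} = itinerary P n x"
  "restrict (\<lambda>i. itinerary P (n + m) x (n + i)) {..<m} = itinerary P m ((T ^^ n) x)"
  by (auto simp: itinerary_def fun_eq_iff funpow_add add.commute)

context
  fixes P :: "'a set set"
  assumes P: "finite P" "P \<subseteq> sets M" "partition_on (space M) P"
begin

lemma itinerary_PiE: "x \<in> space M \<Longrightarrow> itinerary P n x \<in> {..<n} \<rightarrow>\<^sub>E P"
  using part_label(1)[OF P(3)] T_space by (auto simp: itinerary_def)

lemma itinerary_eq_iff: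
  assumes "c \<in> {..<n} \<rightarrow>\<^sub>E P" "x \<in> space M"
  shows "itinerary P n x = c \<longleftrightarrow> (\<forall>i<n. (T ^^ i) x \<in> c i)"
proof
  assume *: "itinerary P n x = c"
  show "\<forall>i<n. (T ^^ i) x \<in> c i"
    using part_label(2)[OF P(3) T_space[OF assms(2)]] by (auto simp: itinerary_def *[symmetric])
next
  assume "\<forall>i<n. (T ^^ i) x \<in> c i"
  then have "part_label P ((T ^^ i) x) = c i" if "i < n" for i
    using assms(1) that by (intro part_label_eq[OF P(3)]) auto
  then show "itinerary P n x = c"
    using assms(1) by (auto simp: itinerary_def fun_eq_iff PiE_iff extensional_def)
qed

lemma simple_function_itinerary: "simple_function M (itinerary P n)"
  unfolding simple_function_def
proof safe
  have "itinerary P n ` space M \<subseteq> {..<n} \<rightarrow>\<^sub>E P" using itinerary_PiE by blast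
  then show "finite (itinerary P n ` space M)"
    by (rule finite_subset) (simp add: finite_PiE P)
  fix y assume y: "y \<in> space M"
  define c where "c = itinerary P n y"
  have c: "c \<in> {..<n} \<rightarrow>\<^sub>E P" using itinerary_PiE[OF y] by (simp add: c_def)
  have "itinerary P n -` {c} \<inter> space M = {x \<in> space M. \<forall>i\<in>{..<n}. (T ^^ i) x \<in> c i}"
    using itinerary_eq_iff[OF c] by auto
  also have "\<dots> \<in> sets M"
  proof (rule sets.sets_Collect_finite_All)
    show "\<And>i. i \<in> {..<n} \<Longrightarrow> {x \<in> space M. (T ^^ i) x \<in> c i} \<in> sets M"
    proof -
      fix i assume "i \<in> {..<n}"
      then have "c i \<in> sets M" using c P(2) by auto
      then have "(T ^^ i) -` c i \<inter> space M \<in> sets M" using measurable_sets[OF T_funpow] by blast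
      moreover have "(T ^^ i) -` c i \<inter> space M = {x \<in> space M. (T ^^ i) x \<in> c i}" by auto
      ultimately show "{x \<in> space M. (T ^^ i) x \<in> c i} \<in> sets M" by simp
    qed
  qed simp
  finally show "itinerary P n -` {itinerary P n y} \<inter> space M \<in> sets M" by (simp add: c_def)
qed

lemma partition_entropy_iterated_join:
  "partition_entropy M (iterated_join M T P n) = label_entropy M (itinerary P n)"
proof (rule partition_entropy_eq_label_entropy[OF simple_function_itinerary])
  show "finite (iterated_join M T P n)"
    unfolding iterated_join_def using P by (intro finite_imageI finite_PiE) auto
  have eq: "{x \<in> space M. \<forall>i<n. (T ^^ i) x \<in> c i} = itinerary P n -` {c} \<inter> space M"
    if "c \<in> {..<n} \<rightarrow>\<^sub>E P" for c
    using itinerary_eq_iff[OF that] by auto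
  have "iterated_join M T P n = (\<lambda>c. itinerary P n -` {c} \<inter> space M) ` ({..<n} \<rightarrow>\<^sub>E P)"
    unfolding iterated_join_def using eq by (intro image_cong) auto
  then show "iterated_join M T P n - {{}} = (\<lambda>c. itinerary P n -` {c} \<inter> space M) ` itinerary P n ` space M"
    using itinerary_PiE[of _ n] by auto
qed

text \<open>Gibbs' inequality with W the product of the two marginal probabilities; invariance of
  the measure makes the second marginal that of an itinerary of length m started at time 0.\<close>

lemma label_entropy_itinerary_add: "label_entropy M (itinerary P (n + m)) \<le> label_entropy M (itinerary P n) + label_entropy M (itinerary P m)"
proof -
  let ?q = "\<lambda>n c. prob (itinerary P n -` {c} \<inter> space M)"
  let ?r = "\<lambda>c. restrict c {..<n}" and ?s = "\<lambda>c. restrict (\<lambda>i. c (n + i)) {..<m}"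
  let ?W = "\<lambda>c. ?q n (?r c) * ?q m (?s c)"
  let ?I = "itinerary P (n + m) ` space M"
  note sf = simple_function_itinerary
  have fin: "finite (itinerary P k ` space M)" for k using simple_functionD(1)[OF sf] .
  \<comment> \<open>An itinerary of length n + m is determined by its two parts, so the total of W
    is at most a product of two sums equal to 1.\<close>
  have inj: "inj_on (\<lambda>c. (?r c, ?s c)) ?I"
  proof (rule inj_onI)
    fix c d assume c: "c \<in> ?I" and d: "d \<in> ?I" and eq: "(?r c, ?s c) = (?r d, ?s d)"
    have ext: "c \<in> extensional {..<n + m}" "d \<in> extensional {..<n + m}"
      using c d by (auto simp: itinerary_def)
    show "c = d"
    proof (rule extensionalityI[OF ext])
      fix i assume i: "i \<in> {..<n + m}"
      show "c i = d i"
      proof (cases "i < n")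
        case True
        then show ?thesis using eq by (auto dest: fun_cong[of _ _ i])
      next
        case False
        then show ?thesis using eq i by (auto dest!: fun_cong[of _ _ "i - n"] split: if_splits)
      qed
    qed
  qed
  have sub: "(\<lambda>c. (?r c, ?s c)) ` ?I \<subseteq> itinerary P n ` space M \<times> itinerary P m ` space M"
    using T_space by (auto simp: itinerary_add)
  have "(\<Sum>c\<in>?I. ?W c) = (\<Sum>(a, b)\<in>(\<lambda>c. (?r c, ?s c)) ` ?I. ?q n a * ?q m b)"
    using inj by (simp add: sum.reindex)
  also have "\<dots> \<le> (\<Sum>(a, b)\<in>itinerary P n ` space M \<times> itinerary P m ` space M. ?q n a * ?q m b)"
    using fin sub by (intro sum_mono2) auto
  also have "\<dots> = (\<Sum>a\<in>itinerary P n ` space M. ?q n a) * (\<Sum>b\<in>itinerary P m ` space M. ?q m b)"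
    by (simp add: sum_product sum.cartesian_product)
  also have "\<dots> = 1" by (simp add: sum_prob_fibres[OF sf])
  finally have W1: "(\<Sum>c\<in>?I. ?W c) \<le> 1" .
  have fs: "itinerary P m -` {b} \<inter> space M \<in> sets M" for m b using fibre_sets[OF sf] .
  have pos: "?W c > 0" if "?q (n + m) c > 0" for c
  proof -
    have "itinerary P (n + m) -` {c} \<inter> space M \<subseteq> itinerary P n -` {?r c} \<inter> space M"
      by (auto simp: itinerary_add)
    then have "?q (n + m) c \<le> ?q n (?r c)" using fs by (intro finite_measure_mono) auto
    moreover have "itinerary P (n + m) -` {c} \<inter> space M \<subseteq> (T ^^ n) -` (itinerary P m -` {?s c} \<inter> space M) \<inter> space M"
      using T_space by (auto simp: itinerary_add)
    then have "?q (n + m) c \<le> prob ((T ^^ n) -` (itinerary P m -` {?s c} \<inter> space M) \<inter> space M)"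
      using measurable_sets[OF T_funpow fs] by (intro finite_measure_mono) auto
    then have "?q (n + m) c \<le> ?q m (?s c)" using prob_funpow[OF fs] by simp
    ultimately show ?thesis using that by simp
  qed
  have "label_entropy M (itinerary P (n + m)) \<le> - (\<integral>x. ln (?W (itinerary P (n + m) x)) \<partial>M)"
  proof (rule Gibbs_inequality[OF sf])
    show "\<And>c. 0 \<le> ?W c" by simp
    show "(\<Sum>c\<in>?I. ?W c) \<le> 1" by (rule W1)
    show "\<And>c. 0 < ?q (n + m) c \<Longrightarrow> 0 < ?W c" by (rule pos)
  qed
  \<comment> \<open>The logarithm of the product is split where both factors are positive, which is
    almost everywhere.\<close>
  also have "(\<integral>x. ln (?W (itinerary P (n + m) x)) \<partial>M) =
      (\<integral>x. ln (?q n (itinerary P n x)) + ln (?q m (itinerary P m ((T ^^ n) x))) \<partial>M)"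
  proof (rule integral_cong_AE)
    show "(\<lambda>x. ln (?W (itinerary P (n + m) x))) \<in> borel_measurable M"
      by (rule borel_measurable_integrable[OF integral_simple_function(1)[OF sf, of "\<lambda>c. ln (?W c)"]])
    show "(\<lambda>x. ln (?q n (itinerary P n x)) + ln (?q m (itinerary P m ((T ^^ n) x)))) \<in> borel_measurable M"
      by (intro borel_measurable_integrable Bochner_Integration.integrable_add
        integral_simple_function(1)[OF sf, of "\<lambda>c. ln (?q n c)"]
        integrable_funpow[OF integral_simple_function(1)[OF sf, of "\<lambda>c. ln (?q m c)"]])
    show "AE x in M. ln (?W (itinerary P (n + m) x)) = ln (?q n (itinerary P n x)) + ln (?q m (itinerary P m ((T ^^ n) x)))"
      using AE_prob_fibre_pos[OF sf, of "n + m"]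
    proof eventually_elim
      case (elim x)
      from pos[OF elim] have "?q n (itinerary P n x) > 0" "?q m (itinerary P m ((T ^^ n) x)) > 0"
        unfolding itinerary_add by (auto simp: zero_less_mult_iff)
      then show ?case by (simp only: itinerary_add) (simp add: ln_mult_pos)
    qed
  qed
  also have "\<dots> = (\<integral>x. ln (?q n (itinerary P n x)) \<partial>M) + (\<integral>x. ln (?q m (itinerary P m ((T ^^ n) x))) \<partial>M)"
    by (intro Bochner_Integration.integral_add integral_simple_function(1)[OF sf, of "\<lambda>c. ln (?q n c)"]
        integrable_funpow[OF integral_simple_function(1)[OF sf, of "\<lambda>c. ln (?q m c)"]])
  also have "(\<integral>x. ln (?q m (itinerary P m ((T ^^ n) x))) \<partial>M) = (\<integral>x. ln (?q m (itinerary P m x)) \<partial>M)"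
    by (rule integral_funpow[OF borel_measurable_integrable[OF integral_simple_function(1)[OF sf, of "\<lambda>c. ln (?q m c)"]]])
  finally show ?thesis unfolding label_entropy_def by simp
qed

text \<open>The definition of entropy uses \<open>lim\<close>, which says nothing without
  convergence. Fekete's lemma with l = 1 provides it.\<close>

lemma label_entropy_itinerary_tendsto:
  "(\<lambda>n. label_entropy M (itinerary P n) / real n) \<longlonglongrightarrow>
    lim (\<lambda>n. partition_entropy M (iterated_join M T P n) / real n)"
proof -
  let ?a = "\<lambda>n. label_entropy M (itinerary P n)"
  define C where "C = ?a 1"
  have pos: "?a n \<ge> 0" for n by (rule label_entropy_nonneg[OF simple_function_itinerary])
  have up: "?a (n + m) \<le> ?a n + C * real m" for n m
  proof (induction m)
    case (Suc m)
    have "?a (n + Suc m) \<le> ?a (n + m) + ?a 1" using label_entropy_itinerary_add[of "n + m" 1] by simp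
    then show ?case using Suc by (simp add: C_def algebra_simps)
  qed simp
  have C0: "C \<ge> 0" using pos[of 1] by (simp add: C_def)
  obtain c where "(\<lambda>n. ?a n / real n) \<longlonglongrightarrow> c"
  proof (rule Fekete[of 1 C ?a])
    show "\<And>n. - C * real n \<le> label_entropy M (itinerary P n)"
      using pos C0 by (meson mult_nonpos_nonneg neg_le_0_iff_le of_nat_0_le_iff order_trans)
  qed (use up C0 label_entropy_itinerary_add in auto)
  then show ?thesis unfolding partition_entropy_iterated_join using limI by metis
qed

end

text \<open>The limit exists for each partition, so a bound along arbitrarily large n is
  enough.\<close>

lemma measure_entropy_leI:
  assumes "\<And>P \<eta>. finite P \<Longrightarrow> P \<subseteq> sets M \<Longrightarrow> partition_on (space M) P \<Longrightarrow> \<eta> > 0 \<Longrightarrow>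
    \<exists>K. \<forall>N. \<exists>n\<ge>N. label_entropy M (itinerary P n) \<le> (h + \<eta>) * real n + K"
  shows "measure_entropy M T \<le> ereal h"
  unfolding measure_entropy_def
proof (rule SUP_least)
  fix P assume "P \<in> {P. finite P \<and> P \<subseteq> sets M \<and> partition_on (space M) P}"
  then have P: "finite P" "P \<subseteq> sets M" "partition_on (space M) P" by auto
  define c where "c = lim (\<lambda>n. partition_entropy M (iterated_join M T P n) / real n)"
  have lim: "(\<lambda>n. label_entropy M (itinerary P n) / real n) \<longlonglongrightarrow> c"
    unfolding c_def by (rule label_entropy_itinerary_tendsto[OF P])
  have le: "c \<le> h + 2 * \<eta>" if eta: "\<eta> > 0" for \<eta>
  proof (rule ccontr)
    assume "\<not> c \<le> h + 2 * \<eta>"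
    then have "\<forall>\<^sub>F n in sequentially. label_entropy M (itinerary P n) / real n > h + 2 * \<eta>"
      using order_tendstoD(1)[OF lim, of "h + 2 * \<eta>"] by simp
    then obtain N0 where N0: "\<And>n. n \<ge> N0 \<Longrightarrow> label_entropy M (itinerary P n) / real n > h + 2 * \<eta>"
      unfolding eventually_sequentially by blast
    obtain K where K: "\<forall>N. \<exists>n\<ge>N. label_entropy M (itinerary P n) \<le> (h + \<eta>) * real n + K"
      using assms[OF P eta] by blast
    obtain m where m: "K / \<eta> < real m" using reals_Archimedean2 by blast
    obtain n where n: "n \<ge> max (max N0 m) 1" "label_entropy M (itinerary P n) \<le> (h + \<eta>) * real n + K" using K by blast
    have "K / \<eta> < real n" using m n(1) by linarith
    then have "K < \<eta> * real n" using eta by (simp add: divide_less_eq mult.commute)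
    moreover have "(h + 2 * \<eta>) * real n < label_entropy M (itinerary P n)"
      using N0[of n] n(1) by (simp add: less_divide_eq)
    ultimately show False using n(2) by (simp add: algebra_simps)
  qed
  have "c \<le> h + e" if "e > 0" for e using le[of "e / 2"] that by simp
  then have "c \<le> h" by (rule field_le_epsilon)
  then show "ereal (lim (\<lambda>n. partition_entropy M (iterated_join M T P n) / real n)) \<le> ereal h"
    by (simp add: c_def)
qed

text \<open>One partition is enough for a lower bound, again along arbitrarily large n.\<close>

lemma measure_entropy_geI:
  assumes P: "finite P" "P \<subseteq> sets M" "partition_on (space M) P"
    and *: "\<exists>K. \<forall>N. \<exists>n\<ge>N. label_entropy M (itinerary P n) \<ge> h * real n - K"
  shows "ereal h \<le> measure_entropy M T"
proof -
  define c where "c = lim (\<lambda>n. partition_entropy M (iterated_join M T P n) / real n)"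
  have lim: "(\<lambda>n. label_entropy M (itinerary P n) / real n) \<longlonglongrightarrow> c"
    unfolding c_def by (rule label_entropy_itinerary_tendsto[OF P])
  obtain K where K: "\<forall>N. \<exists>n\<ge>N. label_entropy M (itinerary P n) \<ge> h * real n - K" using * by blast
  have "h \<le> c"
  proof (rule ccontr)
    assume "\<not> h \<le> c"
    define \<eta> where "\<eta> = (h - c) / 2"
    have eta: "\<eta> > 0" using \<open>\<not> h \<le> c\<close> by (simp add: \<eta>_def)
    have "c < h - \<eta>" using \<open>\<not> h \<le> c\<close> by (simp add: \<eta>_def field_simps)
    then obtain N0 where N0: "\<And>n. n \<ge> N0 \<Longrightarrow> label_entropy M (itinerary P n) / real n < h - \<eta>"
      using order_tendstoD(2)[OF lim, of "h - \<eta>"] unfolding eventually_sequentially by blast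
    obtain m where m: "K / \<eta> < real m" using reals_Archimedean2 by blast
    obtain n where n: "n \<ge> max (max N0 m) 1" "label_entropy M (itinerary P n) \<ge> h * real n - K" using K by blast
    have "K / \<eta> < real n" using m n(1) by linarith
    then have "K < \<eta> * real n" using eta by (simp add: divide_less_eq mult.commute)
    moreover have "label_entropy M (itinerary P n) < (h - \<eta>) * real n"
      using N0[of n] n(1) by (simp add: divide_less_eq)
    ultimately show False using n(2) by (simp add: algebra_simps)
  qed
  then have "ereal h \<le> ereal c" by simp
  also have "\<dots> \<le> measure_entropy M T"
    unfolding measure_entropy_def c_def using P by (intro SUP_upper) auto
  finally show ?thesis .
qed

end

section \<open>The variational principle for shifts with free concatenation\<close>

text \<open>The finite distributive law, by splitting off the value of f at the last index.\<close>

lemma sum_prod_PiE: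
  fixes g :: "nat \<Rightarrow> 'a \<Rightarrow> real"
  assumes "finite P"
  shows "(\<Sum>f\<in>{..<n} \<rightarrow>\<^sub>E P. \<Prod>i<n. g i (f i)) = (\<Prod>i<n. \<Sum>a\<in>P. g i a)"
proof (induction n)
  case (Suc n)
  have inj: "inj_on (\<lambda>(y, f). f(n := y)) (P \<times> ({..<n} \<rightarrow>\<^sub>E P))"
    using inj_combinator[of n "{..<n}" "\<lambda>_. P"] by simp
  have "(\<Sum>f\<in>{..<Suc n} \<rightarrow>\<^sub>E P. \<Prod>i<Suc n. g i (f i)) =
      (\<Sum>(y, f)\<in>P \<times> ({..<n} \<rightarrow>\<^sub>E P). \<Prod>i<Suc n. g i ((f(n := y)) i))"
  proof -
    have "{..<Suc n} \<rightarrow>\<^sub>E P = (\<lambda>(y, f). f(n := y)) ` (P \<times> ({..<n} \<rightarrow>\<^sub>E P))"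
      by (simp only: lessThan_Suc PiE_insert_eq)
    then show ?thesis using sum.reindex[OF inj, of "\<lambda>f. \<Prod>i<Suc n. g i (f i)"]
      by (simp only: comp_def case_prod_beta')
  qed
  also have "\<dots> = (\<Sum>(y, f)\<in>P \<times> ({..<n} \<rightarrow>\<^sub>E P). g n y * (\<Prod>i<n. g i (f i)))"
  proof (intro sum.cong refl, clarify)
    fix y f
    have "(\<Prod>i<n. g i ((f(n := y)) i)) = (\<Prod>i<n. g i (f i))" by (intro prod.cong) auto
    then show "(\<Prod>i<Suc n. g i ((f(n := y)) i)) = g n y * (\<Prod>i<n. g i (f i))" by simp
  qed
  also have "\<dots> = (\<Sum>y\<in>P. g n y) * (\<Sum>f\<in>{..<n} \<rightarrow>\<^sub>E P. \<Prod>i<n. g i (f i))"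
    by (simp add: sum_product sum.cartesian_product)
  finally show ?case by (simp add: Suc mult.commute)
qed simp

text \<open>The partition function of statistical mechanics; its growth rate is the topological
  pressure.\<close>

definition cyl_sum :: "(nat \<Rightarrow> nat) set \<Rightarrow> ((nat \<Rightarrow> nat) \<Rightarrow> real) \<Rightarrow> nat \<Rightarrow> real" where
  "cyl_sum X F n = (\<Sum>u\<in>words X n. cyl_sup X F u)"

lemma cyl_sum_pos:
  assumes "subshift X" "continuous_on X F" "X \<noteq> {}"
  shows "cyl_sum X F n > 0"
  unfolding cyl_sum_def using assms cyl_sup_pos[OF assms(1,2), of _ n] finite_words[OF assms(1), of n]
  by (intro sum_pos) (auto simp: words_eq)

section \<open>Invariant measures on a subshift and the upper bound for entropy\<close>

locale invariant_measure =
  fixes X :: "(nat \<Rightarrow> nat) set" and \<mu> :: "(nat \<Rightarrow> nat) measure"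
  assumes X: "subshift X" and \<mu>: "\<mu> \<in> invariant_measures X"
begin

lemma sets_eq: "sets \<mu> = sets (restrict_space borel X)"
  using \<mu> by (simp add: invariant_measures_def)

lemma space_eq: "space \<mu> = X"
  using sets_eq_imp_space_eq[OF sets_eq] by (simp add: space_restrict_space)

sublocale prob_space \<mu>
  using \<mu> by (simp add: invariant_measures_def)

lemma ne: "X \<noteq> {}" using not_empty space_eq by simp

lemma measurable_shift: "shift \<in> measurable \<mu> \<mu>"
  using measurable_shift_restrict[OF X] measurable_cong_sets[OF sets_eq sets_eq] by blast

sublocale measure_preserving \<mu> shift
proof
  show "shift \<in> measurable \<mu> \<mu>" by (rule measurable_shift)
  show "distr \<mu> \<mu> shift = \<mu>"
  proof (rule measure_eqI)
    fix A assume "A \<in> sets (distr \<mu> \<mu> shift)"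
    then show "emeasure (distr \<mu> \<mu> shift) A = emeasure \<mu> A"
      using \<mu> by (simp add: emeasure_distr[OF measurable_shift] space_eq invariant_measures_def)
  qed simp
qed

lemma continuous_measurable:
  fixes F :: "(nat \<Rightarrow> nat) \<Rightarrow> real"
  assumes "continuous_on X F"
  shows "F \<in> borel_measurable \<mu>"
  using borel_measurable_continuous_on_restrict[OF assms] measurable_cong_sets[OF sets_eq refl] by blast

lemma continuous_integrable:
  fixes F :: "(nat \<Rightarrow> nat) \<Rightarrow> real"
  assumes "continuous_on X F"
  shows "integrable \<mu> F"
proof -
  obtain B where B: "\<And>x. x \<in> X \<Longrightarrow> \<bar>F x\<bar> \<le> B" by (rule continuous_on_subshift_bounded[OF X assms]) blast
  show ?thesis
    by (rule integrable_const_bound[of _ B]) (use B space_eq continuous_measurable[OF assms] in auto)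
qed

lemma integral_birkhoff_sum:
  assumes "continuous_on X F"
  shows "(\<integral>x. birkhoff_sum F n x \<partial>\<mu>) = real n * (\<integral>x. F x \<partial>\<mu>)"
  unfolding birkhoff_sum_def
  by (subst Bochner_Integration.integral_sum)
     (simp_all add: integrable_funpow[OF continuous_integrable[OF assms]]
        integral_funpow[OF continuous_measurable[OF assms]])

lemma block_sets: "{x \<in> X. block x 0 n = u} \<in> sets \<mu>"
proof -
  have "X \<inter> {x. block x 0 n = u} \<in> sets (restrict_space borel X)"
    using borel_open[OF open_block[of n u]] by (auto simp: sets_restrict_space)
  then show ?thesis unfolding sets_eq Int_def by simp
qed

lemma simple_function_block: "simple_function \<mu> (\<lambda>x. block x 0 n)"
  unfolding simple_function_def space_eq
proof safe
  show "finite ((\<lambda>x. block x 0 n) ` X)" using finite_words[OF X, of n] by (simp add: words_eq[OF X])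
  fix y
  have "(\<lambda>x. block x 0 n) -` {block y 0 n} \<inter> X = {x \<in> X. block x 0 n = block y 0 n}" by auto
  then show "(\<lambda>x. block x 0 n) -` {block y 0 n} \<inter> X \<in> sets \<mu>" using block_sets by simp
qed

lemma block_pred_sets: "{x \<in> X. Q (block x 0 n)} \<in> sets \<mu>"
proof -
  have "{x \<in> X. Q (block x 0 n)} = (\<Union>u\<in>{u\<in>words X n. Q u}. {x \<in> X. block x 0 n = u})"
    by (auto simp: words_eq[OF X])
  also have "\<dots> \<in> sets \<mu>"
    using finite_words[OF X, of n] block_sets by (intro sets.finite_UN) auto
  finally show ?thesis .
qed

text \<open>The symmetric difference, inside X, of A and the union of the cylinders given by
  S.\<close>

definition mismatch :: "(nat \<Rightarrow> nat) set \<Rightarrow> nat \<Rightarrow> nat list set \<Rightarrow> (nat \<Rightarrow> nat) set" where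
  "mismatch A L S = {x \<in> X. (x \<in> A) \<noteq> (block x 0 L \<in> S)}"

lemma mismatch_sets:
  assumes "A \<inter> X \<in> sets \<mu>" shows "mismatch A L S \<in> sets \<mu>"
proof -
  have "mismatch A L S = ((A \<inter> X) - {x \<in> X. block x 0 L \<in> S}) \<union> ({x \<in> X. block x 0 L \<in> S} - (A \<inter> X))"
    by (auto simp: mismatch_def)
  then show ?thesis using assms block_pred_sets[of "\<lambda>u. u \<in> S" L] by simp
qed

lemma mismatch_extend: "L \<le> L' \<Longrightarrow> mismatch A L S = mismatch A L' {u. take L u \<in> S}"
  by (auto simp: mismatch_def take_block)

definition approximable :: "(nat \<Rightarrow> nat) set \<Rightarrow> bool" where
  "approximable A \<longleftrightarrow> (\<forall>\<epsilon>>0. \<exists>L S. prob (mismatch A L S) < \<epsilon>)"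

text \<open>Passing to the longer of two lengths expresses both approximations by words of one
  length, and the errors add.\<close>

lemma approximable_UN_finite:
  fixes N :: nat
  assumes "\<And>i. i < N \<Longrightarrow> A i \<inter> X \<in> sets \<mu>" "\<And>i. i < N \<Longrightarrow> approximable (A i)"
  shows "approximable (\<Union>i<N. A i)"
  using assms
proof (induction N)
  case 0
  have "mismatch {} 0 {} = {}" by (auto simp: mismatch_def)
  then show ?case by (auto simp: approximable_def intro!: exI[of _ 0] exI[of _ "{}"])
next
  case (Suc N)
  define B where "B = (\<Union>i<N. A i)"
  have B: "approximable B" "approximable (A N)" using Suc by (simp_all add: B_def)
  have "B \<inter> X = (\<Union>i<N. A i \<inter> X)" by (auto simp: B_def)
  also have "\<dots> \<in> sets \<mu>" using Suc.prems(1) by (intro sets.finite_UN) auto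
  finally have BX: "B \<inter> X \<in> sets \<mu>" "A N \<inter> X \<in> sets \<mu>" using Suc.prems(1) by auto
  have "(\<Union>i<Suc N. A i) = A N \<union> B" by (auto simp: B_def less_Suc_eq)
  moreover have "approximable (A N \<union> B)"
    unfolding approximable_def
  proof (intro allI impI)
    fix \<epsilon> :: real assume "\<epsilon> > 0"
    then have e: "\<epsilon> / 2 > 0" by simp
    obtain L1 S1 where 1: "prob (mismatch B L1 S1) < \<epsilon> / 2" using B(1) e unfolding approximable_def by blast
    obtain L2 S2 where 2: "prob (mismatch (A N) L2 S2) < \<epsilon> / 2" using B(2) e unfolding approximable_def by blast
    define L where "L = max L1 L2"
    define S1' S2' where "S1' = {u. take L1 u \<in> S1}" and "S2' = {u. take L2 u \<in> S2}"
    have m: "mismatch B L1 S1 = mismatch B L S1'" "mismatch (A N) L2 S2 = mismatch (A N) L S2'"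
      unfolding S1'_def S2'_def by (rule mismatch_extend, simp add: L_def)+
    have "prob (mismatch (A N \<union> B) L (S2' \<union> S1')) \<le> prob (mismatch (A N) L S2' \<union> mismatch B L S1')"
      using mismatch_sets[OF BX(1)] mismatch_sets[OF BX(2)]
      by (intro finite_measure_mono) (auto simp: mismatch_def)
    also have "\<dots> \<le> prob (mismatch (A N) L S2') + prob (mismatch B L S1')"
      using mismatch_sets[OF BX(1)] mismatch_sets[OF BX(2)] by (intro measure_Un_le)
    also have "\<dots> < \<epsilon>" using 1 2 unfolding m by linarith
    finally show "\<exists>L S. prob (mismatch (A N \<union> B) L S) < \<epsilon>" by blast
  qed
  ultimately show ?case by simp
qed

text \<open>Induction over the \<sigma>-algebra generated by the coordinates. A condition on one
  coordinate is exactly a union of cylinders, a complement replaces S by its complement, and a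
  countable union is first cut down to a finite one by continuity of the measure from below.\<close>

lemma approximable_borel:
  assumes "A \<in> sets borel"
  shows "approximable A"
proof -
  let ?G = "{{f \<in> \<Pi>\<^sub>E i\<in>UNIV. space borel. f i \<in> B} | i B. i \<in> (UNIV :: nat set) \<and> B \<in> sets (borel :: nat measure)}"
  have eq: "sets (borel :: (nat \<Rightarrow> nat) measure) = sigma_sets (\<Pi>\<^sub>E i\<in>UNIV. space borel) ?G"
    unfolding sets_PiM_equal_borel[symmetric] by (rule sets_PiM_single)
  have "A \<in> sigma_sets (\<Pi>\<^sub>E i\<in>UNIV. space borel) ?G" using assms eq by simp
  then show ?thesis
  proof (induction rule: sigma_sets.induct)
    case (Basic a)
    then obtain i :: nat and B :: "nat set" where a: "a = {f. f i \<in> B}" by auto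
    have "mismatch a (Suc i) {u. u ! i \<in> B} = {}" by (auto simp: mismatch_def a)
    then have "prob (mismatch a (Suc i) {u. u ! i \<in> B}) = 0" by simp
    then show ?case unfolding approximable_def by metis
  next
    case Empty
    have "prob (mismatch {} 0 {}) = 0" by (simp add: mismatch_def)
    then show ?case unfolding approximable_def by metis
  next
    case (Compl a)
    have "mismatch ((\<Pi>\<^sub>E i\<in>UNIV. space borel) - a) L (- S) = mismatch a L S" for L S
      by (auto simp: mismatch_def)
    then show ?case using Compl.IH unfolding approximable_def by metis
  next
    case (Union a)
    have aX: "a i \<inter> X \<in> sets \<mu>" for i
    proof -
      have "a i \<in> sets borel" using Union(1) eq by simp
      then show ?thesis unfolding sets_eq sets_restrict_space by blast
    qed
    show ?case
      unfolding approximable_def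
    proof (intro allI impI)
      fix \<epsilon> :: real assume "\<epsilon> > 0"
      then have e: "\<epsilon> / 2 > 0" by simp
      define C where "C N = (\<Union>i<N. a i \<inter> X)" for N
      have C: "C N \<in> sets \<mu>" for N unfolding C_def by (intro sets.finite_UN aX) simp
      have "incseq C" unfolding C_def incseq_def by fastforce
      then have "(\<lambda>N. prob (C N)) \<longlonglongrightarrow> prob (\<Union>N. C N)"
        using C by (intro finite_Lim_measure_incseq) auto
      then obtain N where N: "\<bar>prob (C N) - prob (\<Union>N. C N)\<bar> < \<epsilon> / 2"
        using LIMSEQ_D[OF _ e] by fastforce
      have Csub: "C N \<subseteq> (\<Union>N. C N)" "(\<Union>N. C N) \<in> sets \<mu>" using C by auto
      have "prob ((\<Union>N. C N) - C N) = prob (\<Union>N. C N) - prob (C N)"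
        using Csub C by (intro finite_measure_Diff) auto
      then have d: "prob ((\<Union>N. C N) - C N) < \<epsilon> / 2" using N by linarith
      have "approximable (\<Union>i<N. a i)" using aX Union.IH by (intro approximable_UN_finite) auto
      then obtain L S where LS: "prob (mismatch (\<Union>i<N. a i) L S) < \<epsilon> / 2"
        using e unfolding approximable_def by blast
      have "(\<Union>i<N. a i) \<inter> X = C N" by (auto simp: C_def)
      then have ms: "mismatch (\<Union>i<N. a i) L S \<in> sets \<mu>" using C by (intro mismatch_sets) simp
      have "mismatch (\<Union>i. a i) L S \<subseteq> mismatch (\<Union>i<N. a i) L S \<union> ((\<Union>N. C N) - C N)"
        by (auto simp: mismatch_def C_def)
      then have "prob (mismatch (\<Union>i. a i) L S) \<le> prob (mismatch (\<Union>i<N. a i) L S \<union> ((\<Union>N. C N) - C N))"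
        using ms C Csub by (intro finite_measure_mono) auto
      also have "\<dots> \<le> prob (mismatch (\<Union>i<N. a i) L S) + prob ((\<Union>N. C N) - C N)"
        using ms C Csub by (intro measure_Un_le) auto
      also have "\<dots> < \<epsilon>" using LS d by linarith
      finally show "\<exists>L S. prob (mismatch (\<Union>i. a i) L S) < \<epsilon>" by blast
    qed
  qed
qed

text \<open>Approximate each of the finitely many atoms with error below \<epsilon> / k. Off the
  union of the mismatches a point lies exactly in those atoms whose word set contains its block, so
  the block predicts the atom.\<close>

lemma approximable_partition:
  assumes P: "finite P" "P \<subseteq> sets \<mu>" "partition_on X P" and "\<epsilon> > 0"
  obtains L \<phi> where "\<forall>u. \<phi> u \<in> P" "{x \<in> X. part_label P x \<noteq> \<phi> (block x 0 L)} \<in> sets \<mu>"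
    "prob {x \<in> X. part_label P x \<noteq> \<phi> (block x 0 L)} < \<epsilon>"
proof -
  have Pne: "P \<noteq> {}" using ne P(3) partition_onD1 by fastforce
  define k where "k = real (card P)"
  have k: "k > 0" using Pne P(1) by (simp add: k_def card_gt_0_iff)
  have PX: "A \<inter> X \<in> sets \<mu>" if "A \<in> P" for A
  proof -
    have "A \<subseteq> X" using that P(3) partition_onD1 by blast
    then show ?thesis using that P(2) by (simp add: inf.absorb1 subset_iff)
  qed
  have "\<exists>L S. prob (mismatch A L S) < \<epsilon> / k" if A: "A \<in> P" for A
  proof -
    obtain B where B: "B \<in> sets borel" "A = X \<inter> B"
      using A P(2) unfolding sets_eq sets_restrict_space by blast
    have "mismatch A L S = mismatch B L S" for L S by (auto simp: mismatch_def B)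
    then show ?thesis using approximable_borel[OF B(1)] k \<open>\<epsilon> > 0\<close> unfolding approximable_def
      by (metis divide_pos_pos)
  qed
  then obtain L S where LS: "\<And>A. A \<in> P \<Longrightarrow> prob (mismatch A (L A) (S A)) < \<epsilon> / k" by metis
  define L' where "L' = Max (L ` P)"
  define S' where "S' A = {u. take (L A) u \<in> S A}" for A
  have LS': "prob (mismatch A L' (S' A)) < \<epsilon> / k" if "A \<in> P" for A
    using LS[OF that] mismatch_extend[of "L A" L' A "S A"] that P(1) by (simp add: L'_def S'_def)
  \<comment> \<open>The default keeps every prediction inside P, also for blocks that no atom
    claims.\<close>
  define \<phi> where "\<phi> u = (if \<exists>A\<in>P. u \<in> S' A then SOME A. A \<in> P \<and> u \<in> S' A else SOME A. A \<in> P)" for u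
  have phi: "\<phi> u \<in> P" for u
  proof (cases "\<exists>A\<in>P. u \<in> S' A")
    case True
    then have "\<exists>A. A \<in> P \<and> u \<in> S' A" by blast
    from someI_ex[OF this] show ?thesis using True by (simp add: \<phi>_def)
  next
    case False
    then show ?thesis using Pne some_in_eq[of P] by (simp add: \<phi>_def)
  qed
  let ?D = "{x \<in> X. part_label P x \<noteq> \<phi> (block x 0 L')}"
  have D: "?D = (\<Union>A\<in>P. A \<inter> {x \<in> X. \<phi> (block x 0 L') \<noteq> A})"
    using part_label[OF P(3)] part_label_eq[OF P(3)] partition_onD1[OF P(3)] by auto
  have Dsets: "?D \<in> sets \<mu>"
    unfolding D using P block_pred_sets[of "\<lambda>u. \<phi> u \<noteq> _" L']
    by (intro sets.finite_UN sets.Int) auto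
  have "?D \<subseteq> (\<Union>A\<in>P. mismatch A L' (S' A))"
  proof
    fix x assume x: "x \<in> ?D"
    show "x \<in> (\<Union>A\<in>P. mismatch A L' (S' A))"
    proof (rule ccontr)
      assume "x \<notin> (\<Union>A\<in>P. mismatch A L' (S' A))"
      then have iff: "\<And>A. A \<in> P \<Longrightarrow> x \<in> A \<longleftrightarrow> block x 0 L' \<in> S' A"
        using x by (auto simp: mismatch_def)
      have "part_label P x \<in> P \<and> block x 0 L' \<in> S' (part_label P x)"
        using part_label[OF P(3), of x] iff x by auto
      then have ex: "\<exists>A. A \<in> P \<and> block x 0 L' \<in> S' A" by blast
      then have "\<phi> (block x 0 L') \<in> P \<and> block x 0 L' \<in> S' (\<phi> (block x 0 L'))"
        using someI_ex[OF ex] by (auto simp: \<phi>_def)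
      then have "x \<in> \<phi> (block x 0 L')" using iff by blast
      then show False using part_label_eq[OF P(3) phi] x by blast
    qed
  qed
  then have "prob ?D \<le> prob (\<Union>A\<in>P. mismatch A L' (S' A))"
    using P(1) mismatch_sets[OF PX] by (intro finite_measure_mono sets.finite_UN) auto
  also have "\<dots> \<le> (\<Sum>A\<in>P. prob (mismatch A L' (S' A)))"
    using P(1) mismatch_sets[OF PX] by (intro finite_measure_subadditive_finite) auto
  also have "\<dots> < (\<Sum>A\<in>P. \<epsilon> / k)" using P(1) Pne LS' by (intro sum_strict_mono) auto
  also have "\<dots> = \<epsilon>" using k by (simp add: k_def)
  finally show ?thesis using that[of \<phi> L'] phi Dsets by blast
qed

text \<open>Gibbs' inequality is applied to the itinerary jointly with the block of length n + L.
  The comparison weight gives the block its normalised weight and then predicts each label from a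
  window of length L. Cylinders approximate P, so wrong predictions are rare, and all predictions
  together cost at most \<eta> / 2 per step.\<close>

theorem measure_entropy_le_cyl_sum:
  assumes F: "continuous_on X F"
    and c: "\<And>\<eta>. \<eta> > 0 \<Longrightarrow> \<exists>K. \<forall>n. ln (cyl_sum X F n) \<le> (c + \<eta>) * real n + K"
  shows "measure_entropy \<mu> shift \<le> ereal (c - (\<integral>x. F x \<partial>\<mu>))"
proof (rule measure_entropy_leI)
  fix P and \<eta> :: real
  assume P: "finite P" "P \<subseteq> sets \<mu>" "partition_on (space \<mu>) P" and eta: "\<eta> > 0"
  have PX: "partition_on X P" using P(3) by (simp add: space_eq)
  have Pne: "P \<noteq> {}" using ne PX partition_onD1 by fastforce
  define k where "k = real (card P)"
  have k: "k \<ge> 1" using Pne P(1) by (simp add: k_def Suc_le_eq card_gt_0_iff)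
  \<comment> \<open>A correct prediction costs - ln (1 - \<theta>) = \<eta> / 4.\<close>
  define \<theta> where "\<theta> = 1 - exp (- \<eta> / 4)"
  have th: "\<theta> > 0" "\<theta> < 1" using eta by (simp_all add: \<theta>_def)
  have ln1: "ln (1 - \<theta>) = - \<eta> / 4" by (simp add: \<theta>_def)
  define T where "T = - ln (\<theta> / k)"
  have "\<theta> / k \<le> 1" "\<theta> / k > 0" using th k by (simp_all add: divide_le_eq)
  then have T: "T \<ge> 0" by (simp add: T_def)
  \<comment> \<open>A wrong prediction costs T, so its probability is kept below some e with e * T
    \<le> \<eta> / 4; the summand 1 avoids a division by zero.\<close>
  define e where "e = \<eta> / (4 * (T + 1))"
  have e: "e > 0" "e * T \<le> \<eta> / 4" using T eta by (auto simp: e_def field_simps)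
  obtain L \<phi> where phi0: "\<forall>u. \<phi> u \<in> P" and Ds: "{x \<in> X. part_label P x \<noteq> \<phi> (block x 0 L)} \<in> sets \<mu>"
    and De: "prob {x \<in> X. part_label P x \<noteq> \<phi> (block x 0 L)} < e"
    by (rule approximable_partition[OF P(1,2) PX e(1)])
  note phi = phi0[rule_format]
  define D where "D = {x \<in> X. part_label P x \<noteq> \<phi> (block x 0 L)}"
  \<comment> \<open>A sub-probability for the label \<open>a\<close> given the prediction \<open>b\<close> that is made from a cylinder approximation of \<open>P\<close>.\<close>
  define q where "q a b = (if a = b then 1 - \<theta> else \<theta> / k)" for a b :: "(nat \<Rightarrow> nat) set"
  have qpos: "q a b > 0" for a b using th k by (simp add: q_def)
  have qsum: "(\<Sum>a\<in>P. q a b) \<le> 1" if "b \<in> P" for b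
  proof -
    have "(\<Sum>a\<in>P. q a b) \<le> (\<Sum>a\<in>P. (if a = b then 1 - \<theta> else 0) + \<theta> / k)"
      using th k by (intro sum_mono) (auto simp: q_def)
    also have "\<dots> = 1 - \<theta> + k * (\<theta> / k)"
      using that P(1) by (simp add: sum.distrib k_def)
    also have "\<dots> = 1" using k by simp
    finally show ?thesis .
  qed
  \<comment> \<open>An explicit lower bound for the logarithm of q: on D the extra term ln (1 -
    \<theta>) is negative and therefore harmless.\<close>
  define g where "g x = ln (1 - \<theta>) - T * indicat_real D x" for x
  have g_le: "g x \<le> ln (q (part_label P x) (\<phi> (block x 0 L)))" if "x \<in> X" for x
  proof (cases "x \<in> D")
    case True
    then have "q (part_label P x) (\<phi> (block x 0 L)) = \<theta> / k" by (simp add: D_def q_def)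
    then show ?thesis using True ln1 eta by (simp add: g_def T_def)
  next
    case False
    then have "q (part_label P x) (\<phi> (block x 0 L)) = 1 - \<theta>" using that by (simp add: D_def q_def)
    then show ?thesis using False by (simp add: g_def)
  qed
  have gint: "integrable \<mu> g" unfolding g_def
    using Ds by (intro Bochner_Integration.integrable_diff integrable_mult_right) (auto simp: D_def emeasure_eq_measure)
  have "(\<integral>x. g x \<partial>\<mu>) = ln (1 - \<theta>) - T * prob D"
    using Ds unfolding g_def
    by (subst Bochner_Integration.integral_diff) (auto simp: D_def emeasure_eq_measure prob_space)
  moreover have "T * prob D \<le> T * e" using De T by (intro mult_left_mono) (auto simp: D_def)
  ultimately have gI: "(\<integral>x. g x \<partial>\<mu>) \<ge> - \<eta> / 2" using ln1 e(2) by (simp add: mult.commute)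
  have main: "label_entropy \<mu> (itinerary P n) \<le> ln (cyl_sum X F (n + L)) - real (n + L) * (\<integral>x. F x \<partial>\<mu>) + real n * (\<eta> / 2)" for n
  proof -
    \<comment> \<open>The last of the n predictions reads coordinates n - 1 to n + L - 2, so a block
      of length n + L contains all the windows.\<close>
    define Z where "Z x = (itinerary P n x, block x 0 (n + L))" for x
    define Q where "Q cu = (\<Prod>i<n. q (fst cu i) (\<phi> (take L (drop i (snd cu)))))" for cu
    \<comment> \<open>Summing over the labels first, \<open>sum_prod_PiE\<close> turns the sum of
      products into a product of factors at most 1, and the normalised weights of the words add up
      to 1.\<close>
    define W where "W cu = cyl_sup X F (snd cu) / cyl_sum X F (n + L) * Q cu" for cu
    have i1: "integrable \<mu> (birkhoff_sum F (n + L))"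
      by (rule continuous_integrable[OF continuous_on_birkhoff_sum[OF X F]])
    have Zn: "cyl_sum X F (n + L) > 0" by (rule cyl_sum_pos[OF X F ne])
    have Qpos: "Q cu > 0" for cu unfolding Q_def using qpos by (intro prod_pos) auto
    have sfZ: "simple_function \<mu> Z"
      unfolding Z_def by (intro simple_function_Pair simple_function_itinerary[OF P] simple_function_block)
    have Zim: "Z ` space \<mu> \<subseteq> ({..<n} \<rightarrow>\<^sub>E P) \<times> words X (n + L)"
      using itinerary_PiE[OF P] block_in_words by (auto simp: Z_def space_eq)
    have Wpos: "W cu > 0" if "cu \<in> ({..<n} \<rightarrow>\<^sub>E P) \<times> words X (n + L)" for cu
      using that Zn Qpos cyl_sup_pos[OF X F, of "snd cu" "n + L"] by (auto simp: W_def)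
    have finPE: "finite ({..<n} \<rightarrow>\<^sub>E P)" using P(1) by (intro finite_PiE) auto
    have "(\<Sum>cu\<in>Z ` space \<mu>. W cu) \<le> (\<Sum>cu\<in>({..<n} \<rightarrow>\<^sub>E P) \<times> words X (n + L). W cu)"
      using Zim Wpos finPE finite_words[OF X] by (intro sum_mono2) (auto intro: less_imp_le)
    also have "\<dots> = (\<Sum>u\<in>words X (n + L). \<Sum>c\<in>{..<n} \<rightarrow>\<^sub>E P. W (c, u))"
      by (subst sum.swap) (simp add: sum.cartesian_product)
    also have "\<dots> \<le> (\<Sum>u\<in>words X (n + L). cyl_sup X F u / cyl_sum X F (n + L))"
    proof (rule sum_mono)
      fix u assume u: "u \<in> words X (n + L)"
      have Ws: "(\<Sum>c\<in>{..<n} \<rightarrow>\<^sub>E P. W (c, u)) = cyl_sup X F u / cyl_sum X F (n + L) * (\<Sum>c\<in>{..<n} \<rightarrow>\<^sub>E P. Q (c, u))"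
        by (simp add: W_def sum_distrib_left)
      have Qs: "(\<Sum>c\<in>{..<n} \<rightarrow>\<^sub>E P. Q (c, u)) = (\<Prod>i<n. \<Sum>a\<in>P. q a (\<phi> (take L (drop i u))))"
        unfolding Q_def fst_conv snd_conv by (rule sum_prod_PiE[OF P(1)])
      have "(\<Prod>i<n. \<Sum>a\<in>P. q a (\<phi> (take L (drop i u)))) \<le> 1"
        using qsum phi qpos by (intro prod_le_1 conjI sum_nonneg) (auto intro: less_imp_le)
      then show "(\<Sum>c\<in>{..<n} \<rightarrow>\<^sub>E P. W (c, u)) \<le> cyl_sup X F u / cyl_sum X F (n + L)"
        unfolding Ws Qs using Zn cyl_sup_pos[OF X F u] by (intro mult_left_le) auto
    qed
    also have "\<dots> = 1" using Zn by (simp add: sum_divide_distrib[symmetric] cyl_sum_def)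
    finally have W1: "(\<Sum>cu\<in>Z ` space \<mu>. W cu) \<le> 1" .
    have "label_entropy \<mu> (itinerary P n) \<le> label_entropy \<mu> Z"
      by (rule label_entropy_mono[OF simple_function_itinerary[OF P] sfZ, of _ fst]) (simp add: Z_def)
    also have "\<dots> \<le> - (\<integral>x. ln (W (Z x)) \<partial>\<mu>)"
    proof (rule Gibbs_inequality[OF sfZ _ W1])
      fix cu assume "cu \<in> Z ` space \<mu>"
      then have "W cu > 0" using Zim Wpos by blast
      then show "0 \<le> W cu" "0 < W cu" by simp_all
    qed
    also have "\<dots> \<le> - (\<integral>x. (- ln (cyl_sum X F (n + L)) + birkhoff_sum F (n + L) x) + (\<Sum>i<n. g ((shift ^^ i) x)) \<partial>\<mu>)"
    proof (rule le_imp_neg_le, rule integral_mono)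
      show "integrable \<mu> (\<lambda>x. (- ln (cyl_sum X F (n + L)) + birkhoff_sum F (n + L) x) + (\<Sum>i<n. g ((shift ^^ i) x)))"
        using i1 integrable_funpow[OF gint]
        by (intro Bochner_Integration.integrable_add Bochner_Integration.integrable_sum) simp_all
      show "integrable \<mu> (\<lambda>x. ln (W (Z x)))"
        by (rule integral_simple_function(1)[OF sfZ, of "\<lambda>c. ln (W c)"])
      fix x assume "x \<in> space \<mu>"
      then have x: "x \<in> X" by (simp add: space_eq)
      have u: "block x 0 (n + L) \<in> words X (n + L)" by (rule block_in_words[OF x])
      have "ln (W (Z x)) = ln (cyl_sup X F (block x 0 (n + L))) - ln (cyl_sum X F (n + L)) + ln (Q (Z x))"
        using Zn Qpos[of "Z x"] cyl_sup_pos[OF X F u] by (simp add: W_def Z_def ln_mult_pos ln_div)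
      moreover have "birkhoff_sum F (n + L) x \<le> ln (cyl_sup X F (block x 0 (n + L)))"
        using cyl_sup_upper[OF X F x, of "n + L"] by (simp add: ln_ge_iff cyl_sup_pos[OF X F u])
      moreover have "ln (Q (Z x)) = (\<Sum>i<n. ln (q (part_label P ((shift ^^ i) x)) (\<phi> (block ((shift ^^ i) x) 0 L))))"
      proof -
        have "Q (Z x) = (\<Prod>i<n. q (part_label P ((shift ^^ i) x)) (\<phi> (block ((shift ^^ i) x) 0 L)))"
          unfolding Q_def Z_def by (intro prod.cong) (auto simp: itinerary_def drop_block take_block)
        then show ?thesis by (simp only:) (rule ln_prod, simp_all add: qpos[THEN less_imp_neq, THEN not_sym])
      qed
      moreover have "(\<Sum>i<n. g ((shift ^^ i) x)) \<le>
          (\<Sum>i<n. ln (q (part_label P ((shift ^^ i) x)) (\<phi> (block ((shift ^^ i) x) 0 L))))"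
        by (intro sum_mono g_le subshift_funpow[OF X x])
      ultimately show "(- ln (cyl_sum X F (n + L)) + birkhoff_sum F (n + L) x) + (\<Sum>i<n. g ((shift ^^ i) x)) \<le> ln (W (Z x))"
        by linarith
    qed
    also have "(\<integral>x. (- ln (cyl_sum X F (n + L)) + birkhoff_sum F (n + L) x) + (\<Sum>i<n. g ((shift ^^ i) x)) \<partial>\<mu>) =
        - ln (cyl_sum X F (n + L)) + real (n + L) * (\<integral>x. F x \<partial>\<mu>) + real n * (\<integral>x. g x \<partial>\<mu>)"
    proof -
      have "(\<integral>x. (\<Sum>i<n. g ((shift ^^ i) x)) \<partial>\<mu>) = real n * (\<integral>x. g x \<partial>\<mu>)"
        by (subst Bochner_Integration.integral_sum)
           (simp_all add: integrable_funpow[OF gint] integral_funpow[OF borel_measurable_integrable[OF gint]])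
      moreover have "(\<integral>x. - ln (cyl_sum X F (n + L)) + birkhoff_sum F (n + L) x \<partial>\<mu>) =
          - ln (cyl_sum X F (n + L)) + real (n + L) * (\<integral>x. F x \<partial>\<mu>)"
        using i1 by (subst Bochner_Integration.integral_add) (simp_all add: integral_birkhoff_sum[OF F] prob_space)
      ultimately show ?thesis
        using i1 integrable_funpow[OF gint] by (subst Bochner_Integration.integral_add) simp_all
    qed
    also have "- (- ln (cyl_sum X F (n + L)) + real (n + L) * (\<integral>x. F x \<partial>\<mu>) + real n * (\<integral>x. g x \<partial>\<mu>)) \<le>
      ln (cyl_sum X F (n + L)) - real (n + L) * (\<integral>x. F x \<partial>\<mu>) + real n * (\<eta> / 2)"
    proof -
      have "real n * (- \<eta> / 2) \<le> real n * (\<integral>x. g x \<partial>\<mu>)" using gI by (intro mult_left_mono) auto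
      then show ?thesis by simp
    qed
    finally show ?thesis .
  qed
  obtain K where K: "\<forall>n. ln (cyl_sum X F n) \<le> (c + \<eta> / 2) * real n + K"
    using c[of "\<eta> / 2"] eta by auto
  let ?K = "K + real L * (c + \<eta> / 2 - (\<integral>x. F x \<partial>\<mu>))"
  have "label_entropy \<mu> (itinerary P n) \<le> (c - (\<integral>x. F x \<partial>\<mu>) + \<eta>) * real n + ?K" for n
    using main[of n] K[rule_format, of "n + L"] by (simp add: algebra_simps add_divide_distrib)
  then show "\<exists>K. \<forall>N. \<exists>n\<ge>N. label_entropy \<mu> (itinerary P n) \<le> (c - (\<integral>x. F x \<partial>\<mu>) + \<eta>) * real n + K"
    by (intro exI[of _ ?K] allI) (rule exI, rule conjI, rule order_refl)
qed

end

section \<open>Invariant measures obtained by averaging over shifts\<close>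

lemma average_measure:
  fixes X :: "(nat \<Rightarrow> nat) set" and \<tau> :: "nat \<Rightarrow> 'a \<Rightarrow> nat \<Rightarrow> nat"
  assumes X: "subshift X" and M: "prob_space M" and N: "N \<ge> 1"
    and \<tau>: "\<And>i. \<tau> i \<in> measurable M (restrict_space borel X)"
    and Suc: "\<And>i x. x \<in> space M \<Longrightarrow> \<tau> (Suc i) x = shift (\<tau> i x)"
    and per: "distr M (restrict_space borel X) (\<tau> N) = distr M (restrict_space borel X) (\<tau> 0)"
  obtains \<nu> where "\<nu> \<in> invariant_measures X"
    "\<And>A. A \<in> sets (restrict_space borel X) \<Longrightarrow>
      emeasure \<nu> A = (\<Sum>i<N. emeasure M (\<tau> i -` A \<inter> space M)) / of_nat N"
proof -
  interpret M: prob_space M by fact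
  define R where "R = (restrict_space borel X :: (nat \<Rightarrow> nat) measure)"
  define U where "U = measure_pmf (pmf_of_set {..<N})"
  \<comment> \<open>The law of \<open>\<tau> i x\<close> for a uniformly random phase i independent
    of x. Shifting advances the phase by one; the wrap-around from N to 0 is repaired by
    \<open>per\<close>.\<close>
  define \<nu> where "\<nu> = distr (U \<Otimes>\<^sub>M M) R (\<lambda>(i, x). \<tau> i x)"
  have N0: "{..<N} \<noteq> {}" using N by (auto simp: lessThan_empty_iff)
  have "(\<lambda>(i, x). \<tau> i x) \<in> measurable (count_space UNIV \<Otimes>\<^sub>M M) R"
    using \<tau> by (intro measurable_pair_measure_countable1) (simp_all add: R_def)
  then have meas: "(\<lambda>(i, x). \<tau> i x) \<in> measurable (U \<Otimes>\<^sub>M M) R"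
    by (subst measurable_cong_sets[OF sets_pair_measure_cong[of U "count_space UNIV" M M] refl])
       (simp_all add: U_def)
  have em: "emeasure \<nu> A = (\<Sum>i<N. emeasure M (\<tau> i -` A \<inter> space M)) / of_nat N" if A: "A \<in> sets R" for A
  proof -
    have pre: "(\<lambda>(i, x). \<tau> i x) -` A \<inter> space (U \<Otimes>\<^sub>M M) \<in> sets (U \<Otimes>\<^sub>M M)"
      using measurable_sets[OF meas A] .
    have sec: "Pair i -` ((\<lambda>(i, x). \<tau> i x) -` A \<inter> space (U \<Otimes>\<^sub>M M)) = \<tau> i -` A \<inter> space M" for i
      by (auto simp: space_pair_measure U_def)
    have "emeasure \<nu> A = emeasure (U \<Otimes>\<^sub>M M) ((\<lambda>(i, x). \<tau> i x) -` A \<inter> space (U \<Otimes>\<^sub>M M))"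
      unfolding \<nu>_def by (rule emeasure_distr[OF meas A])
    also have "\<dots> = (\<integral>\<^sup>+i. emeasure M (\<tau> i -` A \<inter> space M) \<partial>U)"
      using M.emeasure_pair_measure_alt[OF pre] by (simp only: sec)
    also have "\<dots> = (\<Sum>i<N. emeasure M (\<tau> i -` A \<inter> space M)) / of_nat N"
      unfolding U_def using N0 by (subst nn_integral_pmf_of_set) auto
    finally show ?thesis .
  qed
  have "prob_space (U \<Otimes>\<^sub>M M)"
  proof -
    interpret U: prob_space U unfolding U_def by (rule prob_space_measure_pmf)
    interpret pair_prob_space U M ..
    show ?thesis by unfold_locales
  qed
  then have "prob_space \<nu>" unfolding \<nu>_def using meas by (rule prob_space.prob_space_distr)
  moreover have sets: "sets \<nu> = sets R" by (simp add: \<nu>_def)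
  moreover have "emeasure \<nu> (shift -` A \<inter> X) = emeasure \<nu> A" if A: "A \<in> sets R" for A
  proof -
    have sA: "shift -` A \<inter> X \<in> sets R" using vimage_shift_sets[OF X] A by (simp add: R_def)
    let ?a = "\<lambda>i. emeasure M (\<tau> i -` A \<inter> space M)"
    have "\<tau> i -` (shift -` A \<inter> X) \<inter> space M = \<tau> (Suc i) -` A \<inter> space M" for i
      using Suc measurable_space[OF \<tau>, of _ i] by (auto simp: space_restrict_space)
    then have "emeasure \<nu> (shift -` A \<inter> X) = (\<Sum>i<N. ?a (Suc i)) / of_nat N"
      using em[OF sA] by simp
    also have "(\<Sum>i<N. ?a (Suc i)) = (\<Sum>i<N. ?a i)"
    proof -
      obtain m where m: "N = Suc m" using N by (cases N) auto
      have "?a N = ?a 0"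
        using arg_cong[OF per, of "\<lambda>D. emeasure D A"] A
        by (simp add: emeasure_distr[OF \<tau>] R_def)
      then have "(\<Sum>i<N. ?a (Suc i)) = (\<Sum>i<m. ?a (Suc i)) + ?a 0" by (simp add: m)
      also have "\<dots> = (\<Sum>i<N. ?a i)" unfolding m sum.lessThan_Suc_shift by (simp add: add.commute)
      finally show ?thesis .
    qed
    also have "(\<Sum>i<N. ?a i) / of_nat N = emeasure \<nu> A" using em[OF A] by simp
    finally show ?thesis .
  qed
  ultimately have "\<nu> \<in> invariant_measures X"
    unfolding invariant_measures_def by (simp add: R_def)
  then show ?thesis using em that unfolding R_def by blast
qed

text \<open>The uniform distribution on the times 0 to l - 1, transported to the orbit. If l is a
  multiple of the least period, every point of the orbit is merely hit several times.\<close>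

lemma orbit_measure:
  fixes y :: "nat \<Rightarrow> nat"
  assumes X: "subshift X" and y: "y \<in> X" and l: "l \<ge> 1" "(shift ^^ l) y = y"
  obtains \<nu> where "\<nu> \<in> invariant_measures X"
    "\<And>\<phi>. continuous_on X \<phi> \<Longrightarrow> (\<integral>x. \<phi> x \<partial>\<nu>) = birkhoff_sum \<phi> l y / real l"
proof -
  define R where "R = (restrict_space borel X :: (nat \<Rightarrow> nat) measure)"
  define U where "U = measure_pmf (pmf_of_set {..<l})"
  define \<nu> where "\<nu> = distr U R (\<lambda>i. (shift ^^ i) y)"
  have l0: "{..<l} \<noteq> {}" using l by (auto simp: lessThan_empty_iff)
  have spR: "space R = X" by (simp add: R_def space_restrict_space)
  have meas: "(\<lambda>i. (shift ^^ i) y) \<in> measurable U R"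
    unfolding U_def using subshift_funpow[OF X y] spR by simp
  have em: "emeasure \<nu> A = (\<Sum>i<l. indicator A ((shift ^^ i) y)) / of_nat l" if A: "A \<in> sets R" for A
  proof -
    have "emeasure \<nu> A = (\<integral>\<^sup>+x. indicator A x \<partial>\<nu>)" using A by (simp add: \<nu>_def)
    also have "\<dots> = (\<integral>\<^sup>+i. indicator A ((shift ^^ i) y) \<partial>U)"
      unfolding \<nu>_def using meas A by (intro nn_integral_distr) auto
    also have "\<dots> = (\<Sum>i<l. indicator A ((shift ^^ i) y)) / of_nat l"
      unfolding U_def using l0 by (subst nn_integral_pmf_of_set) auto
    finally show ?thesis .
  qed
  have "prob_space U" unfolding U_def by (rule prob_space_measure_pmf)
  then have "prob_space \<nu>" unfolding \<nu>_def using meas by (rule prob_space.prob_space_distr)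
  moreover have "emeasure \<nu> (shift -` A \<inter> X) = emeasure \<nu> A" if A: "A \<in> sets R" for A
  proof -
    have sA: "shift -` A \<inter> X \<in> sets R" using vimage_shift_sets[OF X] A by (simp add: R_def)
    let ?a = "\<lambda>i. indicator A ((shift ^^ i) y) :: ennreal"
    have "indicator (shift -` A \<inter> X) ((shift ^^ i) y) = ?a (Suc i)" for i
      using subshift_funpow[OF X y] by (auto simp: indicator_def)
    then have "emeasure \<nu> (shift -` A \<inter> X) = (\<Sum>i<l. ?a (Suc i)) / of_nat l"
      using em[OF sA] by simp
    also have "(\<Sum>i<l. ?a (Suc i)) = (\<Sum>i<l. ?a i)"
    proof -
      obtain m where m: "l = Suc m" using l by (cases l) auto
      have "?a l = ?a 0" using l(2) by simp
      then have "(\<Sum>i<l. ?a (Suc i)) = (\<Sum>i<m. ?a (Suc i)) + ?a 0" by (simp only: m sum.lessThan_Suc)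
      also have "\<dots> = (\<Sum>i<l. ?a i)" unfolding m sum.lessThan_Suc_shift by (simp add: add.commute)
      finally show ?thesis .
    qed
    also have "(\<Sum>i<l. ?a i) / of_nat l = emeasure \<nu> A" using em[OF A] by simp
    finally show ?thesis .
  qed
  ultimately have "\<nu> \<in> invariant_measures X"
    unfolding invariant_measures_def by (simp add: R_def \<nu>_def)
  moreover have "(\<integral>x. \<phi> x \<partial>\<nu>) = birkhoff_sum \<phi> l y / real l" if "continuous_on X \<phi>" for \<phi>
  proof -
    have "\<phi> \<in> borel_measurable R"
      unfolding R_def by (rule borel_measurable_continuous_on_restrict[OF that])
    then have "(\<integral>x. \<phi> x \<partial>\<nu>) = (\<integral>i. \<phi> ((shift ^^ i) y) \<partial>U)"
      unfolding \<nu>_def by (rule integral_distr[OF meas])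
    also have "\<dots> = birkhoff_sum \<phi> l y / real l"
      unfolding U_def birkhoff_sum_def using l0 by (subst integral_pmf_of_set) auto
    finally show ?thesis .
  qed
  ultimately show ?thesis using that by blast
qed

lemma finite_weights_pmf:
  fixes w :: "'a \<Rightarrow> real"
  assumes "finite S" "\<And>u. u \<in> S \<Longrightarrow> w u > 0" "S \<noteq> {}"
  obtains q where "set_pmf q = S" "\<And>u. u \<in> S \<Longrightarrow> pmf q u = w u / sum w S"
proof -
  define f where "f u = (if u \<in> S then w u / sum w S else 0)" for u
  have s: "sum w S > 0" using assms by (intro sum_pos) auto
  have f0: "f u \<ge> 0" for u using s assms(2)[of u] by (cases "u \<in> S") (simp_all add: f_def less_imp_le)
  have "(\<integral>\<^sup>+x. ennreal (f x) \<partial>count_space UNIV) = (\<Sum>x\<in>S. ennreal (f x))"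
    using assms(1) by (intro nn_integral_count_space') (auto simp: f_def)
  also have "\<dots> = ennreal (\<Sum>x\<in>S. f x)" using f0 by (rule sum_ennreal)
  also have "(\<Sum>x\<in>S. f x) = 1" using s by (simp add: f_def sum_divide_distrib[symmetric])
  finally have "(\<integral>\<^sup>+x. ennreal (f x) \<partial>count_space UNIV) = 1" by simp
  then have pf: "pmf (embed_pmf f) u = f u" for u using pmf_embed_pmf[of f] f0 by blast
  have "set_pmf (embed_pmf f) = S"
    using pf assms(2) s by (force simp: set_pmf_eq f_def)
  then show ?thesis using pf by (intro that[of "embed_pmf f"]) (auto simp: f_def)
qed

text \<open>The law of an i.i.d. concatenation of the words \<open>u @ z\<close>, averaged over the shifts by less than one word length.\<close>

lemma loop_measure:
  assumes X: "subshift X" and F: "continuous_on X F" and n: "n \<ge> 1"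
    and S: "S \<subseteq> words X n" "S \<noteq> {}" and lp: "concat_closed X n S z"
    and B: "\<And>x. x \<in> X \<Longrightarrow> \<bar>F x\<bar> \<le> B"
    and V: "\<And>x. x \<in> X \<Longrightarrow> ln (cyl_sup X F (block x 0 n)) - V \<le> birkhoff_sum F n x"
  obtains \<nu> where "\<nu> \<in> invariant_measures X"
    "\<forall>y\<in>X. \<forall>q\<ge>1. measure \<nu> {x \<in> X. block x 0 (q * (n + length z)) = block y 0 (q * (n + length z))} \<le>
      exp (birkhoff_sum F (q * (n + length z)) y + real (n + length z) * B +
        real (q - 1) * (V + real (length z) * B - ln (sum (cyl_sup X F) S)))"
proof -
  define N where "N = n + length z"
  define R where "R = (restrict_space borel X :: (nat \<Rightarrow> nat) measure)"
  have spR: "space R = X" by (simp add: R_def space_restrict_space)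
  have N: "N \<ge> 1" using n by (simp add: N_def)
  have finS: "finite S" using finite_subset[OF S(1) finite_words[OF X]] .
  have wpos: "cyl_sup X F u > 0" if "u \<in> words X n" for u using cyl_sup_pos[OF X F that] .
  have wS: "cyl_sup X F u > 0" if "u \<in> S" for u using wpos S(1) that by blast
  define r where "r = sum (cyl_sup X F) S"
  have r: "r > 0" unfolding r_def using finS S(2) wS by (intro sum_pos) auto
  obtain q0 where q0: "set_pmf q0 = S" "\<And>u. u \<in> S \<Longrightarrow> pmf q0 u = cyl_sup X F u / r"
    by (rule finite_weights_pmf[OF finS wS S(2)]) (auto simp: r_def)
  obtain u0 where u0: "u0 \<in> S" using S(2) by blast
  \<comment> \<open>The product space also contains sequences with entries outside S. They form a
    null set; replacing these entries by u0 makes \<open>\<tau>0\<close> map everything into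
    X.\<close>
  define cl where "cl u = (if u \<in> S then u else u0)" for u
  have clS: "cl u \<in> S" for u using u0 by (simp add: cl_def)
  have len: "length (cl u) = n" for u using clS[of u] S(1) length_words[of "cl u" X n] by auto
  define M where "M = PiM (UNIV :: nat set) (\<lambda>_. measure_pmf q0)"
  interpret P: product_prob_space "\<lambda>_::nat. measure_pmf q0" UNIV
    by unfold_locales
  have spM: "space M = UNIV" by (simp add: M_def space_PiM)
  have psM: "prob_space M" unfolding M_def by (rule prob_space_PiM) (rule prob_space_measure_pmf)
  define \<tau>0 where "\<tau>0 \<omega> = concat_blocks N (\<lambda>j. cl (\<omega> j) @ z)" for \<omega> :: "nat \<Rightarrow> nat list"
  define \<tau> where "\<tau> i \<omega> = (shift ^^ i) (\<tau>0 \<omega>)" for i \<omega>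
  have t0X: "\<tau>0 \<omega> \<in> X" for \<omega>
    using lp[unfolded concat_closed_def, rule_format, of "\<lambda>j. cl (\<omega> j)"] clS by (simp add: \<tau>0_def N_def)
  have tX: "\<tau> i \<omega> \<in> X" for i \<omega> unfolding \<tau>_def by (rule subshift_funpow[OF X t0X])
  have meas: "\<tau> i \<in> measurable M R" for i
    unfolding R_def
  proof (rule measurable_restrict_space2)
    show "\<tau> i \<in> space M \<rightarrow> X" using tX by blast
    show "\<tau> i \<in> borel_measurable M"
    proof (rule measurable_coordinatewise_then_product)
      fix j
      have "(\<lambda>\<omega>. \<omega> ((i + j) div N)) \<in> measurable M (measure_pmf q0)"
        unfolding M_def by (rule measurable_component_singleton) simp
      moreover have "(\<lambda>u. (cl u @ z) ! ((i + j) mod N)) \<in> measurable (measure_pmf q0) borel"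
        by simp
      ultimately have "(\<lambda>\<omega>. (cl (\<omega> ((i + j) div N)) @ z) ! ((i + j) mod N)) \<in> borel_measurable M"
        by (rule measurable_compose)
      then show "(\<lambda>\<omega>. \<tau> i \<omega> j) \<in> borel_measurable M"
        by (simp add: \<tau>_def \<tau>0_def shift_funpow concat_blocks_def)
    qed
  qed
  have shf: "(\<lambda>\<omega> j. \<omega> (Suc j)) \<in> measurable M M"
    unfolding M_def by (rule measurable_PiM_single') (auto simp: space_PiM intro!: measurable_component_singleton)
  \<comment> \<open>Dropping the first word preserves the i.i.d. law, being a reindexing along the
    injection \<open>Suc\<close>; it corresponds to a shift by N.\<close>
  have dsh: "distr M M (\<lambda>\<omega> j. \<omega> (Suc j)) = M"
    using distr_PiM_reindex[of UNIV "\<lambda>_. measure_pmf q0" Suc UNIV]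
    by (simp add: M_def prob_space_measure_pmf restrict_def)
  have per: "distr M R (\<tau> N) = distr M R (\<tau> 0)"
  proof -
    have "\<tau> N \<omega> = \<tau> 0 (\<lambda>j. \<omega> (Suc j))" for \<omega>
      unfolding \<tau>_def \<tau>0_def using shift_concat_blocks[OF N, of 1] by simp
    then have "\<tau> N = \<tau> 0 \<circ> (\<lambda>\<omega> j. \<omega> (Suc j))" by auto
    then have "distr M R (\<tau> N) = distr (distr M M (\<lambda>\<omega> j. \<omega> (Suc j))) R (\<tau> 0)"
      using distr_distr[OF meas shf] by simp
    then show ?thesis by (simp only: dsh)
  qed
  obtain \<nu> where nu: "\<nu> \<in> invariant_measures X"
    and em: "\<And>A. A \<in> sets R \<Longrightarrow> emeasure \<nu> A = (\<Sum>i<N. emeasure M (\<tau> i -` A \<inter> space M)) / of_nat N"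
    using average_measure[OF X psM N, of \<tau>, folded R_def, OF meas _ per] by (auto simp: \<tau>_def)
  interpret nu: invariant_measure X \<nu> using X nu by unfold_locales
  show ?thesis
  proof (rule that[OF nu], intro ballI allI impI, goal_cases)
    case (1 y q)
    define A where "A = {x \<in> X. block x 0 (q * N) = block y 0 (q * N)}"
    define E where "E = birkhoff_sum F (q * N) y + real N * B + real (q - 1) * (V + real (length z) * B - ln r)"
    have A: "A \<in> sets R" using nu.block_sets nu.sets_eq by (simp add: A_def R_def)
    have bound: "emeasure M (\<tau> i -` A \<inter> space M) \<le> ennreal (exp E)" if i: "i < N" for i
    proof -
      \<comment> \<open>If the shift by i of the concatenation starts like y, its word number t has
        to be the block of y at t * N - i. Word 0 may be cut off at the front, so only the q - 1
        words with 1 \<le> t < q are used.\<close>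
      define u where "u t = block y (t * N - i) n" for t
      have uW: "u t \<in> words X n" for t unfolding u_def by (rule block_in_words[OF 1(1)])
      have sub: "\<tau> i -` A \<inter> space M \<subseteq> {\<omega> \<in> space M. \<forall>t\<in>{1..<q}. \<omega> t \<in> {w. cl w = u t}}"
      proof safe
        fix \<omega> t assume \<omega>: "\<tau> i \<omega> \<in> A" and t: "t \<in> {1..<q}"
        have tN: "N \<le> t * N" using t by simp
        have "Suc t * N \<le> q * N" using t by (intro mult_le_mono1) auto
        then have qN: "t * N + N \<le> q * N" by simp
        have "block (\<tau>0 \<omega>) (t * N) n = cl (\<omega> t)"
          unfolding \<tau>0_def using block_concat_blocks[of 0 n N "\<lambda>j. cl (\<omega> j) @ z" t] len by (simp add: N_def)
        moreover have "block (\<tau>0 \<omega>) (t * N) n = u t"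
        proof -
          have eq: "\<tau>0 \<omega> (i + s) = y s" if "s < q * N" for s
            using \<omega> block_eqD[of "\<tau> i \<omega>" "q * N" y s] that by (simp add: A_def \<tau>_def shift_funpow)
          have "\<tau>0 \<omega> (t * N + s) = y (t * N - i + s)" if "s < n" for s
          proof -
            have "t * N + s = i + (t * N - i + s)" using i tN by linarith
            moreover have "t * N - i + s < q * N" using qN i that by (simp add: N_def)
            ultimately show ?thesis using eq by metis
          qed
          then show ?thesis by (simp add: u_def block_eq_iff)
        qed
        ultimately show "cl (\<omega> t) = u t" by simp
      qed
      have meq: "{\<omega> \<in> space M. \<forall>t\<in>{1..<q}. \<omega> t \<in> {w. cl w = u t}} \<in> sets M"
        unfolding M_def by measurable
      have "emeasure M (\<tau> i -` A \<inter> space M) \<le> emeasure M {\<omega> \<in> space M. \<forall>t\<in>{1..<q}. \<omega> t \<in> {w. cl w = u t}}"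
        by (rule emeasure_mono[OF sub meq])
      also have "\<dots> = (\<Prod>t\<in>{1..<q}. emeasure q0 {w. cl w = u t})"
        unfolding M_def by (rule P.emeasure_PiM_Collect) auto
      also have "\<dots> = ennreal (\<Prod>t\<in>{1..<q}. measure q0 {w. cl w = u t})"
        by (simp add: measure_pmf.emeasure_eq_measure prod_ennreal)
      \<comment> \<open>Each factor is the normalised weight of \<open>u t\<close> if that word lies
        in S, and 0 otherwise.\<close>
      also have "\<dots> \<le> ennreal (\<Prod>t\<in>{1..<q}. cyl_sup X F (u t) / r)"
      proof (rule ennreal_leI, rule prod_mono, rule conjI)
        fix t
        have eqi: "{w. cl w = u t} \<inter> set_pmf q0 = S \<inter> {u t}" unfolding q0(1) by (auto simp: cl_def)
        have "measure q0 {w. cl w = u t} = measure q0 ({w. cl w = u t} \<inter> set_pmf q0)"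
          by (simp add: measure_Int_set_pmf)
        also have "\<dots> \<le> cyl_sup X F (u t) / r"
        proof (cases "u t \<in> S")
          case True
          then have "S \<inter> {u t} = {u t}" by blast
          then show ?thesis unfolding eqi using q0(2)[OF True] by (simp add: measure_pmf_single)
        next
          case False
          then have "S \<inter> {u t} = {}" by blast
          then show ?thesis unfolding eqi using wpos[OF uW[of t]] r by simp
        qed
        finally show "measure q0 {w. cl w = u t} \<le> cyl_sup X F (u t) / r" .
      qed simp
      also have "\<dots> \<le> ennreal (exp E)"
      proof (rule ennreal_leI)
        have pos: "cyl_sup X F (u t) / r > 0" for t using wpos[OF uW] r by simp
        have "(\<Prod>t\<in>{1..<q}. cyl_sup X F (u t) / r) = exp (\<Sum>t\<in>{1..<q}. ln (cyl_sup X F (u t) / r))"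
          using pos by (simp add: exp_sum)
        also have "(\<Sum>t\<in>{1..<q}. ln (cyl_sup X F (u t) / r)) \<le> E"
        proof -
          have yX: "(shift ^^ k) y \<in> X" for k by (rule subshift_funpow[OF X 1(1)])
          \<comment> \<open>V pays for replacing the weight by the Birkhoff sum along y, and
            \<open>real (length z) * B\<close> for including the connecting word in a full period
            N.\<close>
          have "(\<Sum>t\<in>{1..<q}. ln (cyl_sup X F (u t) / r)) \<le>
              (\<Sum>t\<in>{1..<q}. birkhoff_sum F N ((shift ^^ (t * N - i)) y) + (V + real (length z) * B - ln r))"
          proof (rule sum_mono)
            fix t
            have "ln (cyl_sup X F (u t) / r) = ln (cyl_sup X F (u t)) - ln r"
              using wpos[OF uW[of t]] r by (simp add: ln_div)
            moreover have "ln (cyl_sup X F (u t)) - V \<le> birkhoff_sum F n ((shift ^^ (t * N - i)) y)"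
              using V[OF yX, of "t * N - i"] by (simp add: u_def)
            moreover have "\<bar>birkhoff_sum F (length z) ((shift ^^ n) ((shift ^^ (t * N - i)) y))\<bar> \<le> real (length z) * B"
              by (rule birkhoff_sum_bound[OF X B subshift_funpow[OF X yX]])
            ultimately show "ln (cyl_sup X F (u t) / r) \<le>
                birkhoff_sum F N ((shift ^^ (t * N - i)) y) + (V + real (length z) * B - ln r)"
              unfolding N_def birkhoff_sum_add by linarith
          qed
          also have "\<dots> = (\<Sum>t\<in>{1..<q}. birkhoff_sum F N ((shift ^^ (t * N - i)) y)) + real (q - 1) * (V + real (length z) * B - ln r)"
            by (simp add: sum.distrib)
          also have "(\<Sum>t\<in>{1..<q}. birkhoff_sum F N ((shift ^^ (t * N - i)) y)) =
              (\<Sum>t<q - 1. birkhoff_sum F N ((shift ^^ (t * N)) ((shift ^^ (N - i)) y)))"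
          proof (rule sum.reindex_bij_witness[of _ Suc "\<lambda>t. t - 1"])
            fix t assume t: "t \<in> {1..<q}"
            then have "t * N - i = (t - 1) * N + (N - i)" using i by (cases t) auto
            then show "birkhoff_sum F N ((shift ^^ ((t - 1) * N)) ((shift ^^ (N - i)) y)) = birkhoff_sum F N ((shift ^^ (t * N - i)) y)"
              by (simp add: funpow_add)
          qed auto
          also have "\<dots> = birkhoff_sum F ((q - 1) * N) ((shift ^^ (N - i)) y)"
            by (rule birkhoff_sum_mult_blocks[symmetric])
          \<comment> \<open>The q - 1 periods miss N - i coordinates in front and i at the end,
            together N terms of absolute value at most B.\<close>
          also have "\<dots> \<le> birkhoff_sum F (q * N) y + real N * B"
          proof -
            have "q * N = (N - i) + ((q - 1) * N + i)" using i 1(2) by (cases q) auto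
            then have "birkhoff_sum F (q * N) y = birkhoff_sum F (N - i) y +
                (birkhoff_sum F ((q - 1) * N) ((shift ^^ (N - i)) y) +
                 birkhoff_sum F i ((shift ^^ ((q - 1) * N)) ((shift ^^ (N - i)) y)))"
              by (simp only: birkhoff_sum_add)
            moreover have "\<bar>birkhoff_sum F (N - i) y\<bar> \<le> real (N - i) * B"
              by (rule birkhoff_sum_bound[OF X B 1(1)])
            moreover have "\<bar>birkhoff_sum F i ((shift ^^ ((q - 1) * N)) ((shift ^^ (N - i)) y))\<bar> \<le> real i * B"
              by (rule birkhoff_sum_bound[OF X B subshift_funpow[OF X yX]])
            moreover have "real (N - i) * B + real i * B = real N * B"
              using i by (simp add: of_nat_diff algebra_simps)
            ultimately show ?thesis by linarith
          qed
          finally show ?thesis by (simp add: E_def)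
        qed
        finally show "(\<Prod>t\<in>{1..<q}. cyl_sup X F (u t) / r) \<le> exp E" by simp
      qed
      finally show ?thesis .
    qed
    have "emeasure \<nu> A \<le> (\<Sum>i<N. ennreal (exp E)) / of_nat N"
      unfolding em[OF A] using bound by (intro divide_right_mono_ennreal sum_mono) auto
    also have "\<dots> = ennreal (exp E)"
    proof -
      have "(\<Sum>i<N. ennreal (exp E)) = ennreal (real N * exp E)"
        by (simp add: ennreal_mult ennreal_of_nat_eq_real_of_nat)
      then show ?thesis using N by (simp add: ennreal_of_nat_eq_real_of_nat divide_ennreal)
    qed
    finally have "measure \<nu> A \<le> exp E" by (simp add: nu.emeasure_eq_measure)
    then show ?case by (simp add: A_def E_def N_def r_def)
  qed
qed

text \<open>Collapse all symbols to one: over the one-point factor there is a single word of each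
  length, its fibre weight is the full sum, and submultiplicativity of fibre weights
  applies.\<close>

lemma cyl_sum_add:
  assumes X: "subshift X" "X \<noteq> {}" and F: "continuous_on X F"
  shows "cyl_sum X F (n + m) \<le> cyl_sum X F n * cyl_sum X F m"
proof -
  interpret factor X "{\<lambda>_. 2}" "\<lambda>_. 2" "\<lambda>_ _. 2"
  proof
    show "subshift {\<lambda>_. 2}"
    proof -
      have "{\<lambda>_. 2} = (\<Inter>n. {x :: nat \<Rightarrow> nat. block x 0 n = replicate n 2})"
        by (auto simp: list_eq_iff_nth_eq fun_eq_iff)
      moreover have "closed (\<Inter>n. {x :: nat \<Rightarrow> nat. block x 0 n = replicate n 2})"
        by (intro closed_INT ballI closed_block)
      ultimately have "closed {\<lambda>_ :: nat. 2 :: nat}" by simp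
      then show ?thesis
        unfolding subshift_def full_shift_def by (auto simp: shift_def intro!: exI[of _ 2])
    qed
  qed (use X in auto)
  have "fibre_words k (replicate k 2) = words X k" for k
    using length_words by (auto simp: fibre_words_def map_replicate_const)
  then have "fibre_weight F k (replicate k 2) = cyl_sum X F k" for k
    by (simp add: fibre_weight_def cyl_sum_def)
  then show ?thesis
    using fibre_weight_append[OF F, of "replicate n 2" n "replicate m 2" m] by (simp add: replicate_add[symmetric])
qed

section \<open>Topological pressure and the lower bound for entropy\<close>

definition top_pressure :: "(nat \<Rightarrow> nat) set \<Rightarrow> ((nat \<Rightarrow> nat) \<Rightarrow> real) \<Rightarrow> real" where
  "top_pressure X F = lim (\<lambda>n. ln (cyl_sum X F n) / real n)"

text \<open>Fekete's lemma with l = 1. The second claim carries no error term because the limit is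
  an infimum; the lower bound for entropy and the penalty argument use it in this exact
  form.\<close>

lemma top_pressure:
  assumes X: "subshift X" "X \<noteq> {}" and F: "continuous_on X F"
  shows "(\<lambda>n. ln (cyl_sum X F n) / real n) \<longlonglongrightarrow> top_pressure X F" (is ?lim)
    and "top_pressure X F * real n \<le> ln (cyl_sum X F n)" (is ?le)
proof -
  have pos: "cyl_sum X F n > 0" for n by (rule cyl_sum_pos[OF X(1) F X(2)])
  have sub: "ln (cyl_sum X F (n + m)) \<le> ln (cyl_sum X F n) + ln (cyl_sum X F m)" for n m
  proof -
    have "ln (cyl_sum X F (n + m)) \<le> ln (cyl_sum X F n * cyl_sum X F m)"
      using cyl_sum_add[OF X F, of n m] pos by (simp add: ln_le_cancel_iff)
    then show ?thesis using pos[of n] pos[of m] by (simp add: ln_mult_pos)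
  qed
  obtain B where B: "B \<ge> 0" "\<And>x. x \<in> X \<Longrightarrow> \<bar>F x\<bar> \<le> B"
    by (rule continuous_on_subshift_bounded[OF X(1) F]) blast
  have low: "ln (cyl_sum X F n) \<ge> - (real n * B)" for n
  proof -
    obtain x where x: "x \<in> X" using X(2) by blast
    have "cyl_sup X F (block x 0 n) \<le> cyl_sum X F n"
      unfolding cyl_sum_def using block_in_words[OF x] finite_words[OF X(1)] cyl_sup_pos[OF X(1) F]
      by (intro member_le_sum) (auto intro: less_imp_le)
    moreover have "exp (birkhoff_sum F n x) \<le> cyl_sup X F (block x 0 n)" by (rule cyl_sup_upper[OF X(1) F x])
    ultimately have "birkhoff_sum F n x \<le> ln (cyl_sum X F n)" using pos[of n] by (simp add: ln_ge_iff)
    moreover have "\<bar>birkhoff_sum F n x\<bar> \<le> real n * B" by (rule birkhoff_sum_bound[OF X(1) B(2) x])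
    ultimately show ?thesis by linarith
  qed
  define C where "C = \<bar>ln (cyl_sum X F 1)\<bar> + B"
  have up: "ln (cyl_sum X F (n + m)) \<le> ln (cyl_sum X F n) + C * real m" for n m
  proof (induction m)
    case (Suc m)
    have "ln (cyl_sum X F (n + Suc m)) \<le> ln (cyl_sum X F (n + m)) + ln (cyl_sum X F 1)"
      using sub[of "n + m" 1] by simp
    also have "ln (cyl_sum X F 1) \<le> C" using B(1) by (simp add: C_def)
    finally show ?case using Suc by (simp add: algebra_simps)
  qed simp
  have C0: "C \<ge> 0" using B by (simp add: C_def)
  have low': "- C * real n \<le> ln (cyl_sum X F n)" for n
  proof -
    have "real n * B \<le> real n * C" by (intro mult_left_mono) (auto simp: C_def)
    then show ?thesis using low[of n] by (simp add: mult.commute)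
  qed
  obtain c where c: "(\<lambda>n. ln (cyl_sum X F n) / real n) \<longlonglongrightarrow> c"
      "\<forall>n\<ge>1. c \<le> ln (cyl_sum X F (n * 1)) / real (n * 1)"
    by (rule Fekete[of 1 C "\<lambda>n. ln (cyl_sum X F n)"]) (use C0 sub up low' in auto)
  have "top_pressure X F = c" unfolding top_pressure_def by (rule limI[OF c(1)])
  then show ?lim using c(1) by simp
  show ?le
  proof (cases "n = 0")
    case True
    then show ?thesis using low[of 0] by simp
  next
    case False
    then show ?thesis using c(2)[rule_format, of n] \<open>top_pressure X F = c\<close> by (simp add: le_divide_eq)
  qed
qed

lemma cyl_sum_le_top_pressure:
  assumes X: "subshift X" "X \<noteq> {}" and F: "continuous_on X F" and "\<epsilon> > 0"
  shows "\<exists>K. \<forall>n. ln (cyl_sum X F n) \<le> (top_pressure X F + \<epsilon>) * real n + K"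
proof -
  obtain K where "\<forall>n. \<bar>ln (cyl_sum X F n) - top_pressure X F * real n\<bar> \<le> \<epsilon> * real n + K"
    using sublinear_if_tendsto[OF top_pressure(1)[OF X F] \<open>\<epsilon> > 0\<close>] by blast
  then have "ln (cyl_sum X F n) \<le> (top_pressure X F + \<epsilon>) * real n + K" for n
    by (simp add: algebra_simps abs_le_iff)
  then show ?thesis by blast
qed

text \<open>For the partition by the first symbol, itineraries and initial blocks carry the same
  information, so bounds on cylinder measures bound an entropy.\<close>

lemma (in invariant_measure) label_entropy_itinerary_cylinders:
  defines "\<alpha> \<equiv> (\<lambda>u. {z \<in> X. block z 0 1 = u}) ` words X 1"
  shows "finite \<alpha>" "\<alpha> \<subseteq> sets \<mu>" "partition_on (space \<mu>) \<alpha>"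
    "label_entropy \<mu> (itinerary \<alpha> n) = label_entropy \<mu> (\<lambda>x. block x 0 n)"
proof -
  show "finite \<alpha>" unfolding \<alpha>_def using finite_words[OF X] by blast
  show "\<alpha> \<subseteq> sets \<mu>" unfolding \<alpha>_def using block_sets by blast
  show part: "partition_on (space \<mu>) \<alpha>"
    unfolding partition_on_def \<alpha>_def space_eq disjoint_def
    by (auto simp: words_eq[OF X])
  have pl: "part_label \<alpha> x = {z \<in> X. block z 0 1 = block x 0 1}" if "x \<in> X" for x
    using that block_in_words[OF that, of 0 1] by (intro part_label_eq[OF part]) (auto simp: \<alpha>_def)
  have it: "itinerary \<alpha> n x = restrict (\<lambda>i. {z \<in> X. block z 0 1 = block x i 1}) {..<n}" if "x \<in> X" for x
    unfolding itinerary_def using pl subshift_funpow[OF X that] by auto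
  show "label_entropy \<mu> (itinerary \<alpha> n) = label_entropy \<mu> (\<lambda>x. block x 0 n)"
  proof (rule label_entropy_cong)
    fix x y assume "x \<in> space \<mu>" "y \<in> space \<mu>"
    then have xy: "x \<in> X" "y \<in> X" by (simp_all add: space_eq)
    show "itinerary \<alpha> n x = itinerary \<alpha> n y \<longleftrightarrow> block x 0 n = block y 0 n"
    proof
      assume eq: "itinerary \<alpha> n x = itinerary \<alpha> n y"
      have "x i = y i" if "i < n" for i
      proof -
        have "{z \<in> X. block z 0 1 = block x i 1} = {z \<in> X. block z 0 1 = block y i 1}"
          using fun_cong[OF eq, of i] that it[OF xy(1)] it[OF xy(2)] by simp
        moreover have "(shift ^^ i) x \<in> {z \<in> X. block z 0 1 = block x i 1}"
          using subshift_funpow[OF X xy(1)] by simp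
        ultimately have "block x i 1 = block y i 1" by auto
        then show ?thesis by (simp add: block_eq_iff)
      qed
      then show "block x 0 n = block y 0 n" by (simp add: block_eq_iff)
    next
      assume "block x 0 n = block y 0 n"
      then have "block x i 1 = block y i 1" if "i < n" for i
        using block_eqD[of x n y i] that by (simp add: block_eq_iff)
      then show "itinerary \<alpha> n x = itinerary \<alpha> n y"
        unfolding it[OF xy(1)] it[OF xy(2)] by (auto simp: restrict_def fun_eq_iff)
    qed
  qed
qed

text \<open>A free family carries at least 1 / K of the partition function at length n. The measure
  built from it gives a cylinder of length q * N at most the exponential of the Birkhoff sum minus
  (c - e) * q * N, up to a constant, where c is the pressure; taking logarithms and integrating
  bounds the entropy from below.\<close>

theorem top_pressure_le_entropy:
  assumes X: "subshift X" "X \<noteq> {}" and F: "continuous_on X F"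
    and K: "K \<ge> 1" "free_concat X K" and e: "e > 0"
  shows "\<exists>\<nu>\<in>invariant_measures X. ereal (top_pressure X F - e) \<le> measure_entropy \<nu> shift + ereal (\<integral>x. F x \<partial>\<nu>)"
proof -
  let ?c = "top_pressure X F"
  obtain B where B: "B \<ge> 0" "\<And>x. x \<in> X \<Longrightarrow> \<bar>F x\<bar> \<le> B"
    by (rule continuous_on_subshift_bounded[OF X(1) F]) blast
  have "e / 4 > 0" using e by simp
  then obtain K0 where K0: "K0 \<ge> 0" "\<And>n x. x \<in> X \<Longrightarrow> 
      ln (cyl_sup X F (block x 0 n)) - (e / 4 * real n + K0) \<le> birkhoff_sum F n x"
    by (rule cyl_sup_variation[OF X(1) F]) auto
  \<comment> \<open>All costs that do not grow with n: lost weight, distortion constant, connecting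
    word, and the change of length from n to N. For large n they fit into 3 / 4 * e * n; the
    remaining quarter pays for the linear part of the distortion.\<close>
  define C where "C = ln (real K) + K0 + real K * B + \<bar>?c - e\<bar> * real K"
  obtain n0 :: nat where n0: "C / (3 / 4 * e) < real n0" using reals_Archimedean2 by blast
  define n where "n = max n0 1"
  have n: "n \<ge> 1" by (simp add: n_def)
  have "C / (3 / 4 * e) < real n" using n0 by (simp add: n_def)
  then have Cn: "C < 3 / 4 * e * real n" using e by (simp add: divide_less_eq mult.commute)
  have wpos: "cyl_sup X F u > 0" if "u \<in> words X n" for u using cyl_sup_pos[OF X(1) F that] .
  obtain S z where S: "S \<subseteq> words X n" "length z \<le> K" "concat_closed X n S z"
      "sum (cyl_sup X F) (words X n) \<le> real K * sum (cyl_sup X F) S"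
    by (rule free_concatD[OF K(2) n, of "words X n" "cyl_sup X F"]) (use wpos in \<open>auto intro: less_imp_le\<close>)
  define r where "r = sum (cyl_sup X F) S"
  have rK: "cyl_sum X F n \<le> real K * r" using S(4) by (simp add: r_def cyl_sum_def)
  have "cyl_sum X F n > 0" by (rule cyl_sum_pos[OF X(1) F X(2)])
  then have r: "r > 0" using rK K(1) by (metis not_less mult_nonneg_nonpos of_nat_0_le_iff order_less_le_trans)
  then have Sne: "S \<noteq> {}" by (auto simp: r_def)
  have "ln (cyl_sum X F n) \<le> ln (real K * r)"
    using rK \<open>cyl_sum X F n > 0\<close> r K(1) by (simp add: ln_le_cancel_iff)
  also have "\<dots> = ln (real K) + ln r" using r K(1) by (simp add: ln_mult_pos)
  finally have lnr: "?c * real n - ln (real K) \<le> ln r" using top_pressure(2)[OF X F, of n] by linarith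
  define V where "V = e / 4 * real n + K0"
  define N where "N = n + length z"
  \<comment> \<open>The increment of the exponent per period in the cylinder bound; it will be at
    most - (c - e) * N, where c is the pressure.\<close>
  define D where "D = V + real (length z) * B - ln r"
  have zK: "real (length z) \<le> real K" using S(2) by simp
  have D: "(?c - e) * real N \<le> - D"
  proof -
    have "real (length z) * B \<le> real K * B" using zK B(1) by (intro mult_right_mono)
    moreover have "(?c - e) * real (length z) \<le> \<bar>?c - e\<bar> * real K" using zK by (intro mult_mono) auto
    moreover have "(?c - e) * real N = ?c * real n - e * real n + (?c - e) * real (length z)"
      by (simp add: N_def algebra_simps)
    ultimately show ?thesis using lnr Cn unfolding D_def V_def C_def by linarith
  qed
  have VF: "ln (cyl_sup X F (block x 0 n)) - V \<le> birkhoff_sum F n x" if "x \<in> X" for x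
    using K0(2)[OF that, of n] by (simp add: V_def)
  obtain \<nu> where nu: "\<nu> \<in> invariant_measures X"
    and bd: "\<forall>y\<in>X. \<forall>q\<ge>1. measure \<nu> {x \<in> X. block x 0 (q * N) = block y 0 (q * N)} \<le>
      exp (birkhoff_sum F (q * N) y + real N * B + real (q - 1) * D)"
    by (rule loop_measure[OF X(1) F n S(1) Sne S(3) B(2) VF, folded N_def r_def, folded D_def])
  interpret nu: invariant_measure X \<nu> using X nu by unfold_locales
  define \<alpha> where "\<alpha> = (\<lambda>u. {z \<in> X. block z 0 1 = u}) ` words X 1"
  note al = nu.label_entropy_itinerary_cylinders[folded \<alpha>_def]
  let ?I = "\<integral>x. F x \<partial>\<nu>"
  have low: "label_entropy \<nu> (nu.itinerary \<alpha> (q * N)) \<ge> (?c - e - ?I) * real (q * N) - (real N * B + (?c - e) * real N)" if q: "q \<ge> 1" for q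
  proof -
    let ?Z = "\<lambda>x. block x 0 (q * N)"
    let ?E = "\<lambda>x. birkhoff_sum F (q * N) x + (real N * B + real (q - 1) * D)"
    have sf: "simple_function \<nu> ?Z" by (rule nu.simple_function_block)
    have fibre_words: "?Z -` {?Z y} \<inter> space \<nu> = {x \<in> X. block x 0 (q * N) = block y 0 (q * N)}" for y
      by (auto simp: nu.space_eq)
    have iS: "integrable \<nu> (birkhoff_sum F (q * N))"
      by (rule nu.continuous_integrable[OF continuous_on_birkhoff_sum[OF X(1) F]])
    have "(\<integral>x. ln (measure \<nu> (?Z -` {?Z x} \<inter> space \<nu>)) \<partial>\<nu>) \<le> (\<integral>x. ?E x \<partial>\<nu>)"
    proof (rule integral_mono_AE)
      show "integrable \<nu> (\<lambda>x. ln (measure \<nu> (?Z -` {?Z x} \<inter> space \<nu>)))"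
        by (rule nu.integral_simple_function(1)[OF sf, of "\<lambda>c. ln (measure \<nu> (?Z -` {c} \<inter> space \<nu>))"])
      show "integrable \<nu> ?E" using iS by simp
      show "AE x in \<nu>. ln (measure \<nu> (?Z -` {?Z x} \<inter> space \<nu>)) \<le> ?E x"
        using nu.AE_prob_fibre_pos[OF sf] AE_space
      proof eventually_elim
        case (elim x)
        then have "x \<in> X" by (simp add: nu.space_eq)
        from bd[rule_format, OF this q] have "measure \<nu> (?Z -` {?Z x} \<inter> space \<nu>) \<le> exp (?E x)"
          unfolding fibre_words by (simp add: add.assoc)
        then have "ln (measure \<nu> (?Z -` {?Z x} \<inter> space \<nu>)) \<le> ln (exp (?E x))"
          using elim(1) by (subst ln_le_cancel_iff) auto
        then show ?case by simp
      qed
    qed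
    also have "\<dots> = real (q * N) * ?I + (real N * B + real (q - 1) * D)"
      using iS by (subst Bochner_Integration.integral_add) (simp_all add: nu.integral_birkhoff_sum[OF F] nu.prob_space)
    finally have "label_entropy \<nu> ?Z \<ge> - (real (q * N) * ?I + (real N * B + real (q - 1) * D))"
      unfolding label_entropy_def by linarith
    moreover have "real (q - 1) * ((?c - e) * real N) \<le> real (q - 1) * (- D)"
      using D by (intro mult_left_mono) auto
    moreover have "real (q - 1) * ((?c - e) * real N) = (?c - e) * real (q * N) - (?c - e) * real N"
      using q by (simp add: of_nat_diff algebra_simps)
    ultimately show ?thesis unfolding al(4) by (simp add: algebra_simps)
  qed
  have "ereal (?c - e - ?I) \<le> measure_entropy \<nu> shift"
  proof (rule nu.measure_entropy_geI[OF al(1,2,3)], intro exI allI conjI)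
    fix m :: nat
    have N1: "N \<ge> 1" using n by (simp add: N_def)
    then have "Suc m * 1 \<le> Suc m * N" by (intro mult_le_mono2)
    then show "m \<le> Suc m * N" by simp
    show "(?c - e - ?I) * real (Suc m * N) - (real N * B + (?c - e) * real N) \<le> label_entropy \<nu> (nu.itinerary \<alpha> (Suc m * N))"
      by (rule low) simp
  qed
  then have "ereal (?c - e - ?I) + ereal ?I \<le> measure_entropy \<nu> shift + ereal ?I"
    by (rule add_right_mono)
  then show ?thesis using nu by (intro bexI[of _ \<nu>]) simp_all
qed

theorem variational_principle:
  assumes X0: "subshift X" "X \<noteq> {}" and F: "continuous_on X F"
    and K: "K \<ge> 1" "free_concat X K"
  shows "(SUP \<mu>\<in>invariant_measures X. measure_entropy \<mu> shift + ereal (\<integral>x. F x \<partial>\<mu>)) = ereal (top_pressure X F)"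
proof (rule antisym)
  show "(SUP \<mu>\<in>invariant_measures X. measure_entropy \<mu> shift + ereal (\<integral>x. F x \<partial>\<mu>)) \<le> ereal (top_pressure X F)"
  proof (rule SUP_least)
    fix \<mu> assume "\<mu> \<in> invariant_measures X"
    then interpret invariant_measure X \<mu> using X0 by unfold_locales
    have "measure_entropy \<mu> shift \<le> ereal (top_pressure X F - (\<integral>x. F x \<partial>\<mu>))"
      by (rule measure_entropy_le_cyl_sum[OF F cyl_sum_le_top_pressure[OF X0 F]])
    then have "measure_entropy \<mu> shift + ereal (\<integral>x. F x \<partial>\<mu>) \<le> ereal (top_pressure X F - (\<integral>x. F x \<partial>\<mu>)) + ereal (\<integral>x. F x \<partial>\<mu>)"
      by (rule add_right_mono)
    then show "measure_entropy \<mu> shift + ereal (\<integral>x. F x \<partial>\<mu>) \<le> ereal (top_pressure X F)" by simp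
  qed
  show "ereal (top_pressure X F) \<le> (SUP \<mu>\<in>invariant_measures X. measure_entropy \<mu> shift + ereal (\<integral>x. F x \<partial>\<mu>))"
  proof (rule ereal_le_epsilon2)
    fix e :: real assume e: "0 < e"
    obtain \<nu> where nu: "\<nu> \<in> invariant_measures X"
        "ereal (top_pressure X F - e) \<le> measure_entropy \<nu> shift + ereal (\<integral>x. F x \<partial>\<nu>)"
      using top_pressure_le_entropy[OF X0 F K e] by blast
    note nu(2)
    also have "measure_entropy \<nu> shift + ereal (\<integral>x. F x \<partial>\<nu>) \<le>
        (SUP \<mu>\<in>invariant_measures X. measure_entropy \<mu> shift + ereal (\<integral>x. F x \<partial>\<mu>))"
      using nu(1) by (rule SUP_upper)
    finally have "ereal (top_pressure X F - e) + ereal e \<le> (SUP \<mu>\<in>invariant_measures X. measure_entropy \<mu> shift + ereal (\<integral>x. F x \<partial>\<mu>)) + ereal e"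
      by (rule add_right_mono)
    then show "ereal (top_pressure X F) \<le> (SUP \<mu>\<in>invariant_measures X. measure_entropy \<mu> shift + ereal (\<integral>x. F x \<partial>\<mu>)) + ereal e"
      by simp
  qed
qed

section \<open>Fibre weights and penalised pressures\<close>

lemma ln_sum_diff_le:
  fixes a b :: "'a \<Rightarrow> real"
  assumes "finite I" "I \<noteq> {}" "\<And>i. i \<in> I \<Longrightarrow> a i > 0" "\<And>i. i \<in> I \<Longrightarrow> b i > 0"
    "\<And>i. i \<in> I \<Longrightarrow> ln (a i) \<le> ln (b i) + D"
  shows "ln (sum a I) \<le> ln (sum b I) + D"
proof -
  have sa: "sum a I > 0" and sb: "sum b I > 0" using assms by (auto intro: sum_pos)
  have "sum a I \<le> (\<Sum>i\<in>I. b i * exp D)"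
  proof (rule sum_mono)
    fix i assume i: "i \<in> I"
    have "exp (ln (a i)) \<le> exp (ln (b i) + D)" using assms(5)[OF i] by simp
    then show "a i \<le> b i * exp D" using assms(3,4)[OF i] by (simp add: exp_add)
  qed
  then have "ln (sum a I) \<le> ln (sum b I * exp D)"
    using sa sb by (subst ln_le_cancel_iff) (auto simp: sum_distrib_right)
  also have "\<dots> = ln (sum b I) + D" using sb by (simp add: ln_mult_pos)
  finally show ?thesis .
qed

text \<open>Full periods contribute exactly l times the mean; only a remainder shorter than l
  deviates.\<close>

lemma birkhoff_sum_periodic:
  assumes X: "subshift X" "continuous_on X h" and y: "y \<in> X" "(shift ^^ l) y = y" "l \<ge> 1"
  obtains C where "\<forall>n. \<bar>birkhoff_sum h n y - real n * (birkhoff_sum h l y / real l)\<bar> \<le> C"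
proof -
  obtain B where B: "B \<ge> 0" "\<And>x. x \<in> X \<Longrightarrow> \<bar>h x\<bar> \<le> B"
    by (rule continuous_on_subshift_bounded[OF X]) blast
  define c where "c = birkhoff_sum h l y / real l"
  note per = shift_funpow_mult[OF y(2)]
  have "\<bar>birkhoff_sum h n y - real n * c\<bar> \<le> real l * B + real l * \<bar>c\<bar>" for n
  proof -
    define q r where "q = n div l" and "r = n mod l"
    have n: "n = q * l + r" "r < l" using y(3) by (auto simp: q_def r_def)
    have "birkhoff_sum h n y = birkhoff_sum h (q * l) y + birkhoff_sum h r y"
      unfolding n(1) birkhoff_sum_add per ..
    also have "birkhoff_sum h (q * l) y = real q * birkhoff_sum h l y"
      by (simp add: birkhoff_sum_mult_blocks per)
    also have "\<dots> = real (q * l) * c" using y(3) by (simp add: c_def)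
    finally have "birkhoff_sum h n y - real n * c = birkhoff_sum h r y - real r * c"
      using n(1) by (simp add: algebra_simps)
    moreover have "\<bar>birkhoff_sum h r y\<bar> \<le> real r * B" by (rule birkhoff_sum_bound[OF X(1) B(2) y(1)])
    moreover have "real r * B \<le> real l * B" "\<bar>real r * c\<bar> \<le> real l * \<bar>c\<bar>"
      using n(2) B(1) by (auto simp: abs_mult intro!: mult_right_mono)
    ultimately show ?thesis by linarith
  qed
  then show ?thesis using that unfolding c_def by blast
qed

section \<open>Potentials that isolate a periodic orbit\<close>

definition orbit_blocks :: "(nat \<Rightarrow> nat) \<Rightarrow> nat \<Rightarrow> nat \<Rightarrow> nat list set" where
  "orbit_blocks y l M = (\<lambda>j. block y j M) ` {..<l}"

text \<open>Leaving the orbit is detected on a window of M symbols only, so the function stays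
  continuous however large t is.\<close>

definition penalty :: "(nat \<Rightarrow> nat) \<Rightarrow> nat \<Rightarrow> nat \<Rightarrow> real \<Rightarrow> (nat \<Rightarrow> nat) \<Rightarrow> real" where
  "penalty y l M t y' = (if block y' 0 M \<in> orbit_blocks y l M then 0 else - t)"

lemma continuous_on_penalty: "continuous_on Y (penalty y l M t)"
  by (rule continuous_on_if_block[of _ M]) (simp add: penalty_def)

lemma orbit_blocksI:
  assumes "(shift ^^ l) y = y" "l \<ge> 1"
  shows "block y i M \<in> orbit_blocks y l M"
proof -
  note per = shift_funpow_mult[OF assms(1)]
  have "block y i M = block ((shift ^^ (i div l * l)) y) (i mod l) M" by simp
  then have "block y i M = block y (i mod l) M" unfolding per .
  then show ?thesis using assms(2) by (auto simp: orbit_blocks_def)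
qed

context factor
begin

lemma cyl_sum_eq_fibre_weight: "cyl_sum X F n = (\<Sum>v\<in>words Y n. fibre_weight F n v)"
proof -
  have "cyl_sum X F n = (\<Sum>v\<in>words Y n. \<Sum>u\<in>{u \<in> words X n. map p u = v}. cyl_sup X F u)"
    unfolding cyl_sum_def using finite_words[OF X, of n] finite_words[OF Y, of n] map_words
    by (intro sum.group[symmetric]) auto
  then show ?thesis by (simp add: fibre_weight_def fibre_words_def)
qed

text \<open>Points of the cylinder of a fibre word map into the cylinder of v, so adding h \<circ>
  \<pi> changes each Birkhoff sum by an amount between a and b.\<close>

lemma fibre_weight_perturb:
  assumes f: "continuous_on X f" and h: "continuous_on Y h"
    and ab: "\<And>y. y \<in> Y \<Longrightarrow> block y 0 n = v \<Longrightarrow> a \<le> birkhoff_sum h n y"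
      "\<And>y. y \<in> Y \<Longrightarrow> block y 0 n = v \<Longrightarrow> birkhoff_sum h n y \<le> b"
  shows "exp a * fibre_weight f n v \<le> fibre_weight (\<lambda>x. f x + h (\<pi> x)) n v"
    "fibre_weight (\<lambda>x. f x + h (\<pi> x)) n v \<le> exp b * fibre_weight f n v"
proof -
  let ?F = "\<lambda>x. f x + h (\<pi> x)"
  have F: "continuous_on X ?F" using f continuous_comp[OF h] by (intro continuous_intros)
  have bs: "birkhoff_sum ?F n x = birkhoff_sum f n x + birkhoff_sum h n (\<pi> x)" if "x \<in> X" for x
    using birkhoff_sum_comp[OF that, of h n] by (simp add: birkhoff_sum_plus)
  have one: "exp a * cyl_sup X f u \<le> cyl_sup X ?F u \<and> cyl_sup X ?F u \<le> exp b * cyl_sup X f u" if u: "u \<in> fibre_words n v" for u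
  proof
    have u': "u \<in> words X n" "map p u = v" using u by (auto simp: fibre_words_def)
    have bl: "block (\<pi> x) 0 n = v" if "x \<in> X" "block x 0 n = u" for x
      using that u'(2) by (simp add: block_pi)
    obtain x where x: "x \<in> X" "block x 0 n = u" "cyl_sup X f u = exp (birkhoff_sum f n x)"
        "\<forall>y\<in>X. block y 0 n = u \<longrightarrow> birkhoff_sum f n y \<le> birkhoff_sum f n x"
      by (rule cyl_sup_attained[OF X f u'(1)])
    have "a \<le> birkhoff_sum h n (\<pi> x)" using ab(1) pi_in x bl by blast
    then have "exp a * cyl_sup X f u \<le> exp (birkhoff_sum ?F n x)"
      unfolding x(3) bs[OF x(1)] exp_add[symmetric] by simp
    also have "\<dots> \<le> cyl_sup X ?F u" using cyl_sup_upper[OF X F x(1), of n] by (simp add: x(2))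
    finally show "exp a * cyl_sup X f u \<le> cyl_sup X ?F u" .
    obtain z where z: "z \<in> X" "block z 0 n = u" "cyl_sup X ?F u = exp (birkhoff_sum ?F n z)"
        "\<forall>y\<in>X. block y 0 n = u \<longrightarrow> birkhoff_sum ?F n y \<le> birkhoff_sum ?F n z"
      by (rule cyl_sup_attained[OF X F u'(1)])
    have "birkhoff_sum h n (\<pi> z) \<le> b" using ab(2) pi_in z bl by blast
    then have "cyl_sup X ?F u \<le> exp b * exp (birkhoff_sum f n z)"
      unfolding z(3) bs[OF z(1)] exp_add[symmetric] by simp
    also have "\<dots> \<le> exp b * cyl_sup X f u" using cyl_sup_upper[OF X f z(1), of n] by (simp add: z(2))
    finally show "cyl_sup X ?F u \<le> exp b * cyl_sup X f u" .
  qed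
  show "exp a * fibre_weight f n v \<le> fibre_weight ?F n v" "fibre_weight ?F n v \<le> exp b * fibre_weight f n v"
    unfolding fibre_weight_def sum_distrib_left using one by (auto intro: sum_mono)
qed

definition ln_weight :: "((nat \<Rightarrow> nat) \<Rightarrow> real) \<Rightarrow> nat \<Rightarrow> (nat \<Rightarrow> nat) \<Rightarrow> real" where
  "ln_weight f n y = ln (fibre_weight f n (block y 0 n))"

lemma fibre_weight_pos': "continuous_on X f \<Longrightarrow> y \<in> Y \<Longrightarrow> fibre_weight f n (block y i n) > 0"
  by (rule fibre_weight_pos[OF _ block_in_words])

lemma exp_ln_weight: "continuous_on X f \<Longrightarrow> y \<in> Y \<Longrightarrow> exp (ln_weight f n y) = fibre_weight f n (block y 0 n)"
  using fibre_weight_pos'[of f y n 0] by (simp add: ln_weight_def)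

lemma ln_weight_cong: "block y 0 n = block z 0 n \<Longrightarrow> ln_weight f n y = ln_weight f n z"
  by (simp add: ln_weight_def)

lemma ln_weight_add:
  assumes f: "continuous_on X f" and y: "y \<in> Y"
  shows "ln_weight f (n + m) y \<le> ln_weight f n y + ln_weight f m ((shift ^^ n) y)"
proof -
  have "fibre_weight f (n + m) (block y 0 (n + m)) \<le> fibre_weight f n (block y 0 n) * fibre_weight f m (block y n m)"
    using fibre_weight_append[OF f, of "block y 0 n" n "block y n m" m] by (simp add: block_add)
  then have "ln (fibre_weight f (n + m) (block y 0 (n + m))) \<le> ln (fibre_weight f n (block y 0 n) * fibre_weight f m (block y n m))"
    using fibre_weight_pos'[OF f y] by (subst ln_le_cancel_iff) auto
  then show ?thesis using fibre_weight_pos'[OF f y, of n 0] fibre_weight_pos'[OF f y, of m n]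
    by (simp add: ln_weight_def ln_mult_pos)
qed

text \<open>There are at most k ^ n fibre words, each of weight between exp (- n * B) and exp (n *
  B).\<close>

lemma ln_weight_bound:
  assumes f: "continuous_on X f"
  obtains C where "C \<ge> 0" "\<forall>n. \<forall>y\<in>Y. \<bar>ln_weight f n y\<bar> \<le> C * real n"
proof -
  obtain B where B: "B \<ge> 0" "\<And>x. x \<in> X \<Longrightarrow> \<bar>f x\<bar> \<le> B"
    by (rule continuous_on_subshift_bounded[OF X f]) blast
  obtain k where k: "k \<ge> 1" "\<And>n. card (words X n) \<le> k ^ n"
    by (rule card_words_le[OF X]) blast
  have "\<bar>ln_weight f n y\<bar> \<le> (ln (real k) + B) * real n" if y: "y \<in> Y" for n y
  proof -
    let ?v = "block y 0 n"
    have v: "?v \<in> words Y n" by (rule block_in_words[OF y])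
    have pos: "fibre_weight f n ?v > 0" by (rule fibre_weight_pos[OF f v])
    obtain u where u: "u \<in> fibre_words n ?v" using fib_nonempty[OF v] by blast
    have w: "exp (- (real n * B)) \<le> cyl_sup X f u \<and> cyl_sup X f u \<le> exp (real n * B)" if u: "u \<in> fibre_words n ?v" for u
    proof -
      have u': "u \<in> words X n" using u by (simp add: fibre_words_def)
      obtain x where x: "x \<in> X" "block x 0 n = u" "cyl_sup X f u = exp (birkhoff_sum f n x)"
          "\<forall>y\<in>X. block y 0 n = u \<longrightarrow> birkhoff_sum f n y \<le> birkhoff_sum f n x"
        by (rule cyl_sup_attained[OF X f u'])
      have "\<bar>birkhoff_sum f n x\<bar> \<le> real n * B" by (rule birkhoff_sum_bound[OF X B(2) x(1)])
      then show ?thesis unfolding x(3) by (auto simp: abs_le_iff)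
    qed
    have "cyl_sup X f u \<le> fibre_weight f n ?v"
      unfolding fibre_weight_def using u w by (intro member_le_sum) (auto intro: order_trans[OF less_imp_le[OF exp_gt_zero]])
    then have "exp (- (real n * B)) \<le> fibre_weight f n ?v" using w[OF u] by linarith
    then have 1: "- (real n * B) \<le> ln_weight f n y" using pos by (simp add: ln_weight_def ln_ge_iff)
    have "fibre_weight f n ?v \<le> (\<Sum>u\<in>fibre_words n ?v. exp (real n * B))" unfolding fibre_weight_def using w by (intro sum_mono) blast
    also have "\<dots> = real (card (fibre_words n ?v)) * exp (real n * B)" by simp
    also have "\<dots> \<le> real (k ^ n) * exp (real n * B)"
    proof (intro mult_right_mono)
      have "card (fibre_words n ?v) \<le> card (words X n)"
        by (rule card_mono[OF finite_words[OF X]]) (auto simp: fibre_words_def)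
      then show "real (card (fibre_words n ?v)) \<le> real (k ^ n)" using k(2)[of n] by (simp only: of_nat_le_iff)
    qed simp
    finally have "ln_weight f n y \<le> ln (real (k ^ n) * exp (real n * B))"
      unfolding ln_weight_def using pos k(1) by (subst ln_le_cancel_iff) auto
    also have "\<dots> = real n * ln (real k) + real n * B" using k(1) by (simp add: ln_mult_pos ln_realpow)
    finally have 2: "ln_weight f n y \<le> real n * ln (real k) + real n * B" .
    have "0 \<le> real n * ln (real k)" using k(1) by simp
    then show ?thesis using 1 2 by (simp add: abs_le_iff algebra_simps)
  qed
  moreover have "ln (real k) + B \<ge> 0" using k(1) B(1) by simp
  ultimately show ?thesis using that by blast
qed

text \<open>On a cylinder of Y the Birkhoff sums of h vary by at most \<epsilon> * n + K, so their
  exponential can be pulled out of the fibre weight.\<close>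

lemma ln_weight_perturb:
  assumes f: "continuous_on X f" and h: "continuous_on Y h" and e: "\<epsilon> > 0"
  obtains K where "\<forall>n. \<forall>y\<in>Y. \<bar>ln_weight (\<lambda>x. f x + h (\<pi> x)) n y - (ln_weight f n y + birkhoff_sum h n y)\<bar> \<le> \<epsilon> * real n + K"
proof -
  obtain K where K: "K \<ge> 0" "\<And>n x y. x \<in> Y \<Longrightarrow> y \<in> Y \<Longrightarrow> block x 0 n = block y 0 n \<Longrightarrow>
    \<bar>birkhoff_sum h n x - birkhoff_sum h n y\<bar> \<le> \<epsilon> * real n + K"
    by (rule birkhoff_sum_variation[OF Y h e]) blast
  let ?F = "\<lambda>x. f x + h (\<pi> x)"
  have F: "continuous_on X ?F" using f continuous_comp[OF h] by (intro continuous_intros)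
  have "\<bar>ln_weight ?F n y - (ln_weight f n y + birkhoff_sum h n y)\<bar> \<le> \<epsilon> * real n + K" if y: "y \<in> Y" for n y
  proof -
    let ?E = "\<epsilon> * real n + K" and ?s = "birkhoff_sum h n y"
    have *: "?s - ?E \<le> birkhoff_sum h n z \<and> birkhoff_sum h n z \<le> ?s + ?E"
      if "z \<in> Y" "block z 0 n = block y 0 n" for z
      using K(2)[OF that(1) y that(2)] by (simp add: abs_le_iff)
    have "exp (?s - ?E) * fibre_weight f n (block y 0 n) \<le> fibre_weight ?F n (block y 0 n)"
      "fibre_weight ?F n (block y 0 n) \<le> exp (?s + ?E) * fibre_weight f n (block y 0 n)"
      by (rule fibre_weight_perturb[OF f h, where a = "?s - ?E" and b = "?s + ?E"]; use * in blast)+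
    then have "exp (?s - ?E + ln_weight f n y) \<le> exp (ln_weight ?F n y)" "exp (ln_weight ?F n y) \<le> exp (?s + ?E + ln_weight f n y)"
      unfolding exp_add[of _ "ln_weight f n y"] exp_ln_weight[OF f y] exp_ln_weight[OF F y] by blast+
    then show ?thesis by (simp add: abs_le_iff)
  qed
  then show ?thesis using that by blast
qed

text \<open>The uniform o(n) statement of the overview without division: one K serves all points and
  all lengths.\<close>

definition shadows :: "((nat \<Rightarrow> nat) \<Rightarrow> real) \<Rightarrow> ((nat \<Rightarrow> nat) \<Rightarrow> real) \<Rightarrow> bool" where
  "shadows f h \<longleftrightarrow> (\<forall>\<epsilon>>0. \<exists>K. \<forall>n. \<forall>y\<in>Y. \<bar>ln_weight f n y - birkhoff_sum h n y\<bar> \<le> \<epsilon> * real n + K)"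

text \<open>Group the words of X by their images. The fibre weight of v for f - h \<circ> \<pi> +
  \<phi> \<circ> \<pi> is the weight of v for \<phi> up to a factor exp (\<epsilon> * n + K); a
  third of \<epsilon> each goes to the perturbation, to the assumption on h and to the variation of
  \<phi>.\<close>

lemma shadows_imp_top_pressure_eq:
  assumes f: "continuous_on X f" and h: "continuous_on Y h" and \<phi>: "continuous_on Y \<phi>" and sh: "shadows f h"
  shows "top_pressure X (\<lambda>x. f x - h (\<pi> x) + \<phi> (\<pi> x)) = top_pressure Y \<phi>"
proof -
  let ?F = "\<lambda>x. f x + (\<lambda>y. \<phi> y - h y) (\<pi> x)"
  have ch: "continuous_on Y (\<lambda>y. \<phi> y - h y)" using h \<phi> by (intro continuous_intros)
  have F: "continuous_on X ?F" by (rule continuous_on_add[OF f continuous_comp[OF ch]])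
  let ?a = "\<lambda>n. ln (cyl_sum X ?F n)" and ?b = "\<lambda>n. ln (cyl_sum Y \<phi> n)"
  have "(\<lambda>n. (?a n - ?b n) / real n) \<longlonglongrightarrow> 0"
  proof (rule tendsto_zero_if_sublinear)
    fix \<epsilon> :: real assume e: "\<epsilon> > 0"
    then have e3: "\<epsilon> / 3 > 0" by simp
    obtain K1 where K1: "\<forall>n. \<forall>y\<in>Y. \<bar>ln_weight ?F n y - (ln_weight f n y + birkhoff_sum (\<lambda>y. \<phi> y - h y) n y)\<bar> \<le> \<epsilon> / 3 * real n + K1"
      by (rule ln_weight_perturb[OF f ch e3])
    obtain K2 where K2: "\<forall>n. \<forall>y\<in>Y. \<bar>ln_weight f n y - birkhoff_sum h n y\<bar> \<le> \<epsilon> / 3 * real n + K2"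
      using sh e3 unfolding shadows_def by blast
    obtain K3 where K3: "K3 \<ge> 0" "\<And>n x. x \<in> Y \<Longrightarrow> ln (cyl_sup Y \<phi> (block x 0 n)) - (\<epsilon> / 3 * real n + K3) \<le> birkhoff_sum \<phi> n x"
        "\<And>n x. x \<in> Y \<Longrightarrow> birkhoff_sum \<phi> n x \<le> ln (cyl_sup Y \<phi> (block x 0 n))"
      by (rule cyl_sup_variation[OF Y \<phi> e3]) blast
    have "\<bar>?a n - ?b n\<bar> \<le> \<epsilon> * real n + (K1 + K2 + K3)" for n
    proof -
      let ?D = "\<epsilon> * real n + (K1 + K2 + K3)"
      have *: "\<bar>ln (fibre_weight ?F n v) - ln (cyl_sup Y \<phi> v)\<bar> \<le> ?D" if vW: "v \<in> words Y n" for v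
      proof -
        obtain y where y: "y \<in> Y" "v = block y 0 n" by (rule wordsE[OF Y vW])
        show ?thesis
          using K1[rule_format, OF y(1), of n] K2[rule_format, OF y(1), of n] K3(2,3)[OF y(1), of n]
          unfolding ln_weight_def y(2)[symmetric] birkhoff_sum_diff abs_le_iff by linarith
      qed
      have fin: "finite (words Y n)" "words Y n \<noteq> {}"
        using finite_words[OF Y, of n] Yne by (auto simp: words_eq[OF Y])
      have "?a n \<le> ?b n + ?D"
        unfolding cyl_sum_eq_fibre_weight cyl_sum_def[of Y]
      proof (rule ln_sum_diff_le[OF fin])
        fix v assume "v \<in> words Y n"
        from *[OF this] show "ln (fibre_weight ?F n v) \<le> ln (cyl_sup Y \<phi> v) + ?D" by linarith
      qed (use fibre_weight_pos[OF F] cyl_sup_pos[OF Y \<phi>] in auto)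
      moreover have "?b n \<le> ?a n + ?D"
        unfolding cyl_sum_eq_fibre_weight cyl_sum_def[of Y]
      proof (rule ln_sum_diff_le[OF fin])
        fix v assume "v \<in> words Y n"
        from *[OF this] show "ln (cyl_sup Y \<phi> v) \<le> ln (fibre_weight ?F n v) + ?D" by linarith
      qed (use fibre_weight_pos[OF F] cyl_sup_pos[OF Y \<phi>] in auto)
      ultimately show ?thesis by (simp add: abs_le_iff)
    qed
    then show "\<exists>K. \<forall>n\<ge>1. \<bar>?a n - ?b n\<bar> \<le> \<epsilon> * real n + K" by blast
  qed
  moreover have "(\<lambda>n. ?a n / real n - ?b n / real n) \<longlonglongrightarrow> top_pressure X ?F - top_pressure Y \<phi>"
    by (intro tendsto_diff top_pressure(1) X ne F Y Yne \<phi>)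
  then have "(\<lambda>n. (?a n - ?b n) / real n) \<longlonglongrightarrow> top_pressure X ?F - top_pressure Y \<phi>"
    by (simp add: diff_divide_distrib)
  ultimately have "top_pressure X ?F - top_pressure Y \<phi> = 0" using LIMSEQ_unique by blast
  then show ?thesis by (simp add: algebra_simps)
qed

text \<open>Points over the initial block of y can pay a penalty only at the last M times, where the
  window of M symbols reaches beyond length n.\<close>

lemma penalty_lower:
  assumes f: "continuous_on X f" and y: "y \<in> Y" "(shift ^^ l) y = y" "l \<ge> 1" and t: "t \<ge> 0"
  shows "ln_weight f n y - t * real M \<le> ln (cyl_sum X (\<lambda>x. f x + penalty y l M t (\<pi> x)) n)"
proof -
  let ?P = "penalty y l M t" and ?v = "block y 0 n"
  let ?F = "\<lambda>x. f x + ?P (\<pi> x)"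
  have F: "continuous_on X ?F" using f continuous_comp[OF continuous_on_penalty] by (intro continuous_intros)
  have a: "- (t * real M) \<le> birkhoff_sum ?P n z" if z: "z \<in> Y" "block z 0 n = ?v" for z
  proof -
    have "(\<Sum>i<n. if i \<in> {n - M..<n} then - t else 0) \<le> birkhoff_sum ?P n z"
      unfolding birkhoff_sum_def
    proof (rule sum_mono)
      fix i assume i: "i \<in> {..<n}"
      show "(if i \<in> {n - M..<n} then - t else 0) \<le> ?P ((shift ^^ i) z)"
      proof (cases "i + M \<le> n")
        case True
        then have "block z i M = block y i M" using block_eqD[OF z(2)] by (auto simp: block_eq_iff)
        then have "?P ((shift ^^ i) z) = 0" using orbit_blocksI[OF y(2,3)] by (simp add: penalty_def)
        then show ?thesis using t by simp
      next
        case False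
        then show ?thesis using t i by (auto simp: penalty_def)
      qed
    qed
    moreover have "(\<Sum>i<n. if i \<in> {n - M..<n} then - t else 0) = (\<Sum>i\<in>{..<n} \<inter> {n - M..<n}. - t)"
      by (rule sum.inter_restrict[symmetric]) simp
    moreover have "- (real (card ({..<n} \<inter> {n - M..<n})) * t) \<ge> - (t * real M)"
    proof -
      have "card ({..<n} \<inter> {n - M..<n}) \<le> card {n - M..<n}" by (intro card_mono) auto
      then have "card ({..<n} \<inter> {n - M..<n}) \<le> M" by simp
      then have "real (card ({..<n} \<inter> {n - M..<n})) * t \<le> real M * t" using t by (intro mult_right_mono) auto
      then show ?thesis by (simp add: mult.commute)
    qed
    ultimately show ?thesis by simp
  qed
  obtain b where b: "\<And>z. z \<in> Y \<Longrightarrow> birkhoff_sum ?P n z \<le> b"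
  proof -
    have "birkhoff_sum ?P n z \<le> 0" for z
      unfolding birkhoff_sum_def using t by (intro sum_nonpos) (simp add: penalty_def)
    then show ?thesis using that by blast
  qed
  have "exp (- (t * real M)) * fibre_weight f n ?v \<le> fibre_weight ?F n ?v"
    by (rule fibre_weight_perturb(1)[OF f continuous_on_penalty, where n = n and v = ?v and a = "- (t * real M)" and b = b])
       (use a b in auto)
  also have "\<dots> \<le> cyl_sum X ?F n"
    unfolding cyl_sum_eq_fibre_weight using block_in_words[OF y(1)] finite_words[OF Y] fibre_weight_pos[OF F]
    by (intro member_le_sum) (auto intro: less_imp_le)
  finally have "exp (- (t * real M) + ln_weight f n y) \<le> cyl_sum X ?F n"
    unfolding exp_add exp_ln_weight[OF f y(1)] .
  then show ?thesis using cyl_sum_pos[OF X F ne, of n] by (simp add: ln_ge_iff)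
qed

text \<open>A stretch of length m + l from one point of the orbit contains a stretch of length m
  from any other, so subadditivity bounds the longer value by the shorter one plus a
  constant.\<close>

lemma ln_weight_orbit:
  assumes f: "continuous_on X f" and y: "y \<in> Y" "(shift ^^ l) y = y"
    and B: "B \<ge> 0" "\<forall>n. \<forall>y\<in>Y. \<bar>ln_weight f n y\<bar> \<le> B * real n" and j: "j < l"
  shows "ln_weight f (m + l) ((shift ^^ j) y) \<le> ln_weight f m y + 2 * B * real l"
    "ln_weight f (m + l) y \<le> ln_weight f m ((shift ^^ j) y) + 2 * B * real l"
proof -
  have jY: "(shift ^^ i) y \<in> Y" for i by (rule subshift_funpow[OF Y y(1)])
  have bd: "ln_weight f i z \<le> B * real l" if "z \<in> Y" "i \<le> l" for i z
  proof -
    have "ln_weight f i z \<le> B * real i" using B(2) that(1) abs_le_D1 by blast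
    also have "\<dots> \<le> B * real l" using B(1) that(2) by (intro mult_left_mono) auto
    finally show ?thesis .
  qed
  have M: "m + l = (l - j) + (m + j)" "m + l = j + (m + (l - j))" using j by auto
  have sh: "(shift ^^ (l - j)) ((shift ^^ j) y) = y"
    using j y(2) funpow_add[of "l - j" j shift] by (simp add: fun_eq_iff)
  have "ln_weight f (m + l) ((shift ^^ j) y) \<le> ln_weight f (l - j) ((shift ^^ j) y) + ln_weight f (m + j) y"
    using ln_weight_add[OF f jY, of "l - j" "m + j" j] unfolding sh M(1)[symmetric] .
  moreover have "ln_weight f (m + j) y \<le> ln_weight f m y + ln_weight f j ((shift ^^ m) y)" by (rule ln_weight_add[OF f y(1)])
  ultimately show "ln_weight f (m + l) ((shift ^^ j) y) \<le> ln_weight f m y + 2 * B * real l"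
    using bd[OF jY, of "l - j" j] bd[OF jY, of j m] j by linarith
  have "ln_weight f (m + l) y \<le> ln_weight f j y + ln_weight f (m + (l - j)) ((shift ^^ j) y)"
    using ln_weight_add[OF f y(1), of j "m + (l - j)"] unfolding M(2)[symmetric] .
  moreover have "ln_weight f (m + (l - j)) ((shift ^^ j) y) \<le> ln_weight f m ((shift ^^ j) y) + ln_weight f (l - j) ((shift ^^ m) ((shift ^^ j) y))"
    by (rule ln_weight_add[OF f jY])
  ultimately show "ln_weight f (m + l) y \<le> ln_weight f m ((shift ^^ j) y) + 2 * B * real l"
    using bd[OF y(1), of j] bd[OF subshift_funpow[OF Y jY], of "l - j" m j] j by linarith
qed

text \<open>At length exactly M = m + l a word off the orbit is penalised already by its first
  window, which is the whole word. For large t these words are negligible and only the at most l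
  orbit words remain, each bounded by a constant times g_m(y). The threshold T depends on m, the
  constant C does not.\<close>

lemma penalty_upper:
  assumes f: "continuous_on X f" and y: "y \<in> Y" "(shift ^^ l) y = y" "l \<ge> 1"
  obtains C where "\<forall>m. \<exists>T\<ge>0. \<forall>t\<ge>T. ln (cyl_sum X (\<lambda>x. f x + penalty y l (m + l) t (\<pi> x)) (m + l)) \<le> ln_weight f m y + C"
proof -
  obtain B where B: "B \<ge> 0" "\<forall>n. \<forall>y\<in>Y. \<bar>ln_weight f n y\<bar> \<le> B * real n" by (rule ln_weight_bound[OF f])
  define C where "C = ln (real l * exp (2 * B * real l) + 1)"
  have "\<exists>T\<ge>0. \<forall>t\<ge>T. ln (cyl_sum X (\<lambda>x. f x + penalty y l (m + l) t (\<pi> x)) (m + l)) \<le> ln_weight f m y + C" for m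
  proof -
    define M where "M = m + l"
    define O' where "O' = orbit_blocks y l M"
    \<comment> \<open>The threshold for t brings exp (- t) times the full partition function, which
      bounds all words off the orbit, below g_m(y).\<close>
    have "ln (cyl_sum X (\<lambda>x. f x + penalty y l M t (\<pi> x)) M) \<le> ln_weight f m y + C"
      if t: "t \<ge> max 0 (ln (cyl_sum X f M) - ln_weight f m y)" for t
    proof -
      let ?P = "penalty y l M t"
      let ?F = "\<lambda>x. f x + ?P (\<pi> x)"
      have t0: "t \<ge> 0" using t by simp
      have F: "continuous_on X ?F" using f continuous_comp[OF continuous_on_penalty] by (intro continuous_intros)
      have nonpos: "birkhoff_sum ?P n z \<le> 0" for n z
        unfolding birkhoff_sum_def using t0 by (intro sum_nonpos) (simp add: penalty_def)
      have lowex: "- (real M * t) \<le> birkhoff_sum ?P M z" for z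
      proof -
        have "(\<Sum>i<M. - t) \<le> birkhoff_sum ?P M z"
          unfolding birkhoff_sum_def using t0 by (intro sum_mono) (simp add: penalty_def)
        then show ?thesis by simp
      qed
      have inO: "fibre_weight ?F M v \<le> fibre_weight f M v" for v
        using fibre_weight_perturb(2)[OF f continuous_on_penalty, where n = M and v = v and a = "- (real M * t)" and b = 0] nonpos lowex by simp
      have notO: "fibre_weight ?F M v \<le> exp (- t) * fibre_weight f M v" if v: "v \<notin> O'" for v
      proof (rule fibre_weight_perturb(2)[OF f continuous_on_penalty])
        show "- (real M * t) \<le> birkhoff_sum ?P M z" for z by (rule lowex)
        fix z assume z: "z \<in> Y" "block z 0 M = v"
        have "M = 1 + (M - 1)" using y(3) by (simp add: M_def)
        then have "birkhoff_sum ?P M z = birkhoff_sum ?P 1 z + birkhoff_sum ?P (M - 1) (shift z)"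
          using birkhoff_sum_add[of ?P 1 "M - 1" z] by simp
        also have "birkhoff_sum ?P 1 z = - t" using z(2) v by (simp add: birkhoff_sum_def penalty_def O'_def)
        finally show "birkhoff_sum ?P M z \<le> - t" using nonpos[of "M - 1" "shift z"] by simp
      qed
      have fin: "finite (words Y M)" by (rule finite_words[OF Y])
      have OY: "O' \<subseteq> words Y M" unfolding O'_def orbit_blocks_def using block_in_words[OF y(1)] by blast
      have finO: "finite O'" using finite_subset[OF OY fin] .
      have lgj: "ln_weight f M ((shift ^^ j) y) \<le> ln_weight f m y + 2 * B * real l" if j: "j < l" for j
        unfolding M_def by (rule ln_weight_orbit(1)[OF f y(1,2) B j])
      have "(\<Sum>v\<in>O'. fibre_weight ?F M v) \<le> (\<Sum>v\<in>O'. fibre_weight f M v)" by (intro sum_mono inO)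
      also have "\<dots> \<le> sum (fibre_weight f M \<circ> (\<lambda>j. block y j M)) {..<l}"
        unfolding O'_def orbit_blocks_def using fibre_weight_pos'[OF f y(1)]
        by (intro sum_image_le) (auto intro: less_imp_le)
      also have "\<dots> = (\<Sum>j<l. fibre_weight f M (block y j M))" by simp
      also have "\<dots> \<le> (\<Sum>j<l. exp (ln_weight f m y + 2 * B * real l))"
      proof (rule sum_mono)
        fix j assume "j \<in> {..<l}"
        then have "exp (ln_weight f M ((shift ^^ j) y)) \<le> exp (ln_weight f m y + 2 * B * real l)" using lgj by simp
        then show "fibre_weight f M (block y j M) \<le> exp (ln_weight f m y + 2 * B * real l)"
          unfolding exp_ln_weight[OF f subshift_funpow[OF Y y(1)]] by simp
      qed
      also have "\<dots> = exp (ln_weight f m y) * (real l * exp (2 * B * real l))" by (simp add: exp_add)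
      finally have 1: "(\<Sum>v\<in>O'. fibre_weight ?F M v) \<le> exp (ln_weight f m y) * (real l * exp (2 * B * real l))" .
      have pp: "cyl_sum X f M > 0" by (rule cyl_sum_pos[OF X f ne])
      have "(\<Sum>v\<in>words Y M - O'. fibre_weight ?F M v) \<le> (\<Sum>v\<in>words Y M - O'. exp (- t) * fibre_weight f M v)"
        by (intro sum_mono notO) simp
      also have "\<dots> \<le> (\<Sum>v\<in>words Y M. exp (- t) * fibre_weight f M v)"
        using fin fibre_weight_pos[OF f] by (intro sum_mono2) (auto intro: less_imp_le)
      also have "\<dots> = exp (- t) * cyl_sum X f M" by (simp add: cyl_sum_eq_fibre_weight sum_distrib_left)
      also have "\<dots> = exp (- t + ln (cyl_sum X f M))" using pp by (simp only: exp_add exp_ln)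
      also have "\<dots> \<le> exp (ln_weight f m y)" using t by simp
      finally have 2: "(\<Sum>v\<in>words Y M - O'. fibre_weight ?F M v) \<le> exp (ln_weight f m y)" .
      have "cyl_sum X ?F M = (\<Sum>v\<in>words Y M - O'. fibre_weight ?F M v) + (\<Sum>v\<in>O'. fibre_weight ?F M v)"
        unfolding cyl_sum_eq_fibre_weight by (rule sum.subset_diff[OF OY fin])
      also have "\<dots> \<le> exp (ln_weight f m y) * (real l * exp (2 * B * real l) + 1)"
        using 1 2 by (simp add: algebra_simps)
      finally have "ln (cyl_sum X ?F M) \<le> ln (exp (ln_weight f m y) * (real l * exp (2 * B * real l) + 1))"
        using cyl_sum_pos[OF X F ne, of M] by (subst ln_le_cancel_iff) (auto intro!: mult_pos_pos add_nonneg_pos)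
      also have "\<dots> = ln_weight f m y + C"
        unfolding C_def by (subst ln_mult_pos) (auto intro!: add_nonneg_pos)
      finally show ?thesis .
    qed
    then show ?thesis unfolding M_def by (intro exI[of _ "max 0 (ln (cyl_sum X f (m + l)) - ln_weight f m y)"]) auto
  qed
  then show ?thesis using that by blast
qed

end

section \<open>Growth rates along a periodic orbit\<close>

lemma linear_le:
  fixes a b K :: real
  assumes "\<And>q :: nat. real q * a \<le> real q * b + K"
  shows "a \<le> b"
proof (rule ccontr)
  assume "\<not> a \<le> b"
  obtain q :: nat where "K / (a - b) < real q" using reals_Archimedean2 by blast
  then have "K < real q * (a - b)" using \<open>\<not> a \<le> b\<close> by (simp add: divide_less_eq)
  then show False using assms[of q] by (simp add: algebra_simps)
qed

context factor
begin

text \<open>With Y as a factor of itself the fibre weight of v is the weight of v, and the penalty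
  estimates become available for h on Y.\<close>

lemma factor_id: "factor Y Y id id"
  using Y Yne by unfold_locales auto

lemma ln_weight_id: "factor.ln_weight Y id h n y = ln (cyl_sup Y h (block y 0 n))" if "y \<in> Y"
proof -
  interpret I: factor Y Y id id by (rule factor_id)
  have "I.fibre_words n (block y 0 n) = {block y 0 n}"
    using block_in_words[OF that] by (auto simp: I.fibre_words_def)
  then show ?thesis by (simp add: I.ln_weight_def I.fibre_weight_def)
qed

text \<open>Testing with \<phi> = h + penalty gives f and h, each with the penalty added, a common
  pressure c. As m grows, with t large depending on m, c is squeezed to the growth rate of g_m(y) on
  the one hand and to the mean of h along the orbit on the other, so the two coincide.\<close>

lemma top_pressure_eq_imp_periodic:
  assumes f: "continuous_on X f" and h: "continuous_on Y h"
    and eq: "\<And>\<phi>. continuous_on Y \<phi> \<Longrightarrow> top_pressure X (\<lambda>x. f x - h (\<pi> x) + \<phi> (\<pi> x)) = top_pressure Y \<phi>"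
    and y: "y \<in> Y" "(shift ^^ l) y = y" "l \<ge> 1"
  shows "(\<lambda>n. (ln_weight f n y - birkhoff_sum h n y) / real n) \<longlonglongrightarrow> 0"
proof -
  interpret I: factor Y Y id id by (rule factor_id)
  define hb where "hb = birkhoff_sum h l y / real l"
  obtain Cb where Cb: "\<forall>n. \<bar>birkhoff_sum h n y - real n * hb\<bar> \<le> Cb"
    unfolding hb_def by (rule birkhoff_sum_periodic[OF Y h y])
  obtain C1 where C1: "\<forall>m. \<exists>T\<ge>0. \<forall>t\<ge>T. ln (cyl_sum X (\<lambda>x. f x + penalty y l (m + l) t (\<pi> x)) (m + l)) \<le> ln_weight f m y + C1"
    by (rule penalty_upper[OF f y])
  obtain C2 where C2: "\<forall>m. \<exists>T\<ge>0. \<forall>t\<ge>T. ln (cyl_sum Y (\<lambda>x. h x + penalty y l (m + l) t (id x)) (m + l)) \<le> I.ln_weight h m y + C2"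
    by (rule I.penalty_upper[OF h y])
  \<comment> \<open>For each m a single c lies, up to O(1 / m), below the averages at length m for
    both f and h, and above both growth rates.\<close>
  have key: "\<exists>c. c * real (m + l) \<le> ln_weight f m y + C1 \<and> c * real (m + l) \<le> I.ln_weight h m y + C2 \<and>
      (\<forall>\<epsilon>>0. \<exists>K. \<forall>n. ln_weight f n y \<le> (c + \<epsilon>) * real n + K) \<and> (\<forall>\<epsilon>>0. \<exists>K. \<forall>n. I.ln_weight h n y \<le> (c + \<epsilon>) * real n + K)" for m
  proof -
    obtain T1 where T1: "T1 \<ge> 0" "\<forall>t\<ge>T1. ln (cyl_sum X (\<lambda>x. f x + penalty y l (m + l) t (\<pi> x)) (m + l)) \<le> ln_weight f m y + C1"
      using C1 by blast
    obtain T2 where T2: "T2 \<ge> 0" "\<forall>t\<ge>T2. ln (cyl_sum Y (\<lambda>x. h x + penalty y l (m + l) t (id x)) (m + l)) \<le> I.ln_weight h m y + C2"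
      using C2 by blast
    define t where "t = max T1 T2"
    have t: "t \<ge> T1" "t \<ge> T2" "t \<ge> 0" using T1(1) by (auto simp: t_def)
    let ?P = "penalty y l (m + l) t"
    let ?F = "\<lambda>x. f x + ?P (\<pi> x)" and ?H = "\<lambda>x. h x + ?P (id x)"
    have F: "continuous_on X ?F" by (rule continuous_on_add[OF f continuous_comp[OF continuous_on_penalty]])
    have H: "continuous_on Y ?H" by (rule continuous_on_add[OF h I.continuous_comp[OF continuous_on_penalty]])
    define c where "c = top_pressure Y ?H"
    have cF: "top_pressure X ?F = c" using eq[OF H] by (simp add: c_def)
    have "c * real (m + l) \<le> ln_weight f m y + C1"
      using top_pressure(2)[OF X ne F, of "m + l"] T1(2) t(1) unfolding cF by force
    moreover have "c * real (m + l) \<le> I.ln_weight h m y + C2"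
      using top_pressure(2)[OF Y Yne H, of "m + l"] T2(2) t(2) unfolding c_def[symmetric] by force
    moreover have "\<exists>K. \<forall>n. ln_weight f n y \<le> (c + \<epsilon>) * real n + K" if e: "\<epsilon> > 0" for \<epsilon>
    proof -
      obtain K where K: "\<forall>n. ln (cyl_sum X ?F n) \<le> (c + \<epsilon>) * real n + K"
        using cyl_sum_le_top_pressure[OF X ne F e] unfolding cF by blast
      have "ln_weight f n y \<le> (c + \<epsilon>) * real n + (K + t * real (m + l))" for n
        using penalty_lower[OF f y t(3), of n "m + l"] K[rule_format, of n] by linarith
      then show ?thesis by blast
    qed
    moreover have "\<exists>K. \<forall>n. I.ln_weight h n y \<le> (c + \<epsilon>) * real n + K" if e: "\<epsilon> > 0" for \<epsilon>
    proof -
      obtain K where K: "\<forall>n. ln (cyl_sum Y ?H n) \<le> (c + \<epsilon>) * real n + K"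
        using cyl_sum_le_top_pressure[OF Y Yne H e] unfolding c_def[symmetric] by blast
      have "I.ln_weight h n y \<le> (c + \<epsilon>) * real n + (K + t * real (m + l))" for n
        using I.penalty_lower[OF h y t(3), of n "m + l"] K[rule_format, of n] by linarith
      then show ?thesis by blast
    qed
    ultimately show ?thesis by blast
  qed
  have LY: "birkhoff_sum h n y \<le> I.ln_weight h n y" for n
    unfolding ln_weight_id[OF y(1)] using cyl_sup_upper[OF Y h y(1), of n] cyl_sup_pos[OF Y h block_in_words[OF y(1), of 0 n]]
    by (simp add: ln_ge_iff)
  \<comment> \<open>The mean of h is at most the c that belongs to n, and this c bounds
    \<open>ln_weight f n y\<close> from below.\<close>
  have lower: "hb * real n - (C1 + \<bar>hb\<bar> * real l) \<le> ln_weight f n y" for n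
  proof -
    obtain c where c: "c * real (n + l) \<le> ln_weight f n y + C1" "\<forall>\<epsilon>>0. \<exists>K. \<forall>n. I.ln_weight h n y \<le> (c + \<epsilon>) * real n + K"
      using key[of n] by blast
    have "hb \<le> c + \<epsilon>" if e: "\<epsilon> > 0" for \<epsilon>
    proof -
      obtain K where K: "\<forall>n. I.ln_weight h n y \<le> (c + \<epsilon>) * real n + K" using c(2) e by blast
      show ?thesis
      proof (rule linear_le[of _ _ "K + Cb"])
        fix q :: nat
        show "real q * hb \<le> real q * (c + \<epsilon>) + (K + Cb)"
          using K[rule_format, of q] LY[of q] Cb[rule_format, of q] by (simp add: abs_le_iff mult.commute)
      qed
    qed
    then have "hb \<le> c" by (rule field_le_epsilon)
    then have "hb * real (n + l) \<le> c * real (n + l)" by (intro mult_right_mono) auto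
    moreover have "- (\<bar>hb\<bar> * real l) \<le> hb * real l" by (simp add: abs_if)
    ultimately show ?thesis using c(1) by (simp add: algebra_simps)
  qed
  have "\<exists>K. \<forall>n\<ge>1. \<bar>ln_weight f n y - birkhoff_sum h n y\<bar> \<le> \<epsilon> * real n + K" if e: "\<epsilon> > 0" for \<epsilon>
  proof -
    have e3: "\<epsilon> / 3 > 0" using e by simp
    obtain K3 where K3: "K3 \<ge> 0" "\<And>n x. x \<in> Y \<Longrightarrow> ln (cyl_sup Y h (block x 0 n)) - (\<epsilon> / 3 * real n + K3) \<le> birkhoff_sum h n x"
        "\<And>n x. x \<in> Y \<Longrightarrow> birkhoff_sum h n x \<le> ln (cyl_sup Y h (block x 0 n))"
      by (rule cyl_sup_variation[OF Y h e3]) blast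
    \<comment> \<open>The length m is taken so large that all constants fit into \<epsilon> / 3 * m;
      the c of this m then exceeds the mean of h by at most 2 / 3 * \<epsilon>.\<close>
    define D where "D = Cb + K3 + C2 + \<bar>hb\<bar> * real l"
    obtain m :: nat where m: "D / (\<epsilon> / 3) < real m" using reals_Archimedean2 by blast
    have Dm: "D < \<epsilon> / 3 * real m" using m e3 by (metis divide_less_eq mult.commute)
    obtain c where c: "c * real (m + l) \<le> I.ln_weight h m y + C2" "\<forall>\<epsilon>>0. \<exists>K. \<forall>n. ln_weight f n y \<le> (c + \<epsilon>) * real n + K"
      using key[of m] by blast
    have "I.ln_weight h m y \<le> real m * hb + Cb + \<epsilon> / 3 * real m + K3"
      using K3(2)[OF y(1), of m] Cb[rule_format, of m] unfolding ln_weight_id[OF y(1)] abs_le_iff by linarith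
    then have "c * real (m + l) \<le> real m * hb + 2 * (\<epsilon> / 3 * real m) - \<bar>hb\<bar> * real l"
      using c(1) Dm unfolding D_def by linarith
    also have "\<dots> \<le> (hb + 2 * (\<epsilon> / 3)) * real (m + l)"
    proof -
      have "- (\<bar>hb\<bar> * real l) \<le> hb * real l" by (simp add: abs_if)
      moreover have "0 \<le> 2 * (\<epsilon> / 3) * real l" using e by simp
      moreover have "(hb + 2 * (\<epsilon> / 3)) * real (m + l) = real m * hb + 2 * (\<epsilon> / 3 * real m) + hb * real l + 2 * (\<epsilon> / 3) * real l"
        by (simp add: algebra_simps)
      ultimately show ?thesis by linarith
    qed
    finally have cl: "c \<le> hb + 2 * (\<epsilon> / 3)" using y(3) by simp
    obtain K where K: "\<forall>n. ln_weight f n y \<le> (c + \<epsilon> / 3) * real n + K" using c(2) e3 by blast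
    have "\<bar>ln_weight f n y - birkhoff_sum h n y\<bar> \<le> \<epsilon> * real n + (\<bar>K\<bar> + Cb + \<bar>C1 + \<bar>hb\<bar> * real l\<bar>)" for n
    proof -
      have "(c + \<epsilon> / 3) * real n \<le> (hb + \<epsilon>) * real n" using cl by (intro mult_right_mono) auto
      then have "ln_weight f n y \<le> hb * real n + \<epsilon> * real n + K" using K[rule_format, of n] by (simp add: algebra_simps)
      moreover have "0 \<le> \<epsilon> * real n" using e by simp
      ultimately show ?thesis
        using lower[of n] Cb[rule_format, of n] unfolding abs_le_iff by (simp add: mult.commute) linarith
    qed
    then show ?thesis by blast
  qed
  then show ?thesis by (rule tendsto_zero_if_sublinear)
qed

text \<open>The orbit average arises as the integral of log g_n against the orbit measure. By
  \<open>ln_weight_orbit\<close> it is squeezed, up to constants, between values of log g at y for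
  lengths that differ from n by l.\<close>

lemma orbit_average_imp_periodic:
  assumes f: "continuous_on X f" and h: "continuous_on Y h"
    and y: "y \<in> Y" "(shift ^^ l) y = y" "l \<ge> 1"
    and lim: "(\<lambda>n. ((\<Sum>j<l. ln_weight f n ((shift ^^ j) y)) / real l) / real n) \<longlonglongrightarrow> birkhoff_sum h l y / real l"
  shows "(\<lambda>n. (ln_weight f n y - birkhoff_sum h n y) / real n) \<longlonglongrightarrow> 0"
proof -
  define hb where "hb = birkhoff_sum h l y / real l"
  obtain Cb where Cb: "\<forall>n. \<bar>birkhoff_sum h n y - real n * hb\<bar> \<le> Cb"
    unfolding hb_def by (rule birkhoff_sum_periodic[OF Y h y])
  obtain B where B: "B \<ge> 0" "\<forall>n. \<forall>y\<in>Y. \<bar>ln_weight f n y\<bar> \<le> B * real n" by (rule ln_weight_bound[OF f])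
  define s where "s n = (\<Sum>j<l. ln_weight f n ((shift ^^ j) y)) / real l" for n
  note orb = ln_weight_orbit[OF f y(1,2) B]
  have l0: "real l > 0" using y(3) by simp
  have s1: "s (n + l) \<le> ln_weight f n y + 2 * B * real l" for n
  proof -
    have "(\<Sum>j<l. ln_weight f (n + l) ((shift ^^ j) y)) \<le> (\<Sum>j<l. ln_weight f n y + 2 * B * real l)"
      using orb(1) by (intro sum_mono) auto
    then show ?thesis using l0 by (simp add: s_def divide_le_eq mult.commute)
  qed
  have s2: "ln_weight f (n + l) y \<le> s n + 2 * B * real l" for n
  proof -
    have "(\<Sum>j<l. ln_weight f (n + l) y) \<le> (\<Sum>j<l. ln_weight f n ((shift ^^ j) y) + 2 * B * real l)"
      using orb(2) by (intro sum_mono) auto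
    then have "real l * ln_weight f (n + l) y \<le> (\<Sum>j<l. ln_weight f n ((shift ^^ j) y)) + real l * (2 * B * real l)"
      by (simp add: sum.distrib)
    then have "real l * (ln_weight f (n + l) y - 2 * B * real l) \<le> (\<Sum>j<l. ln_weight f n ((shift ^^ j) y))"
      by (simp add: algebra_simps)
    then have "ln_weight f (n + l) y - 2 * B * real l \<le> s n"
      using l0 by (simp add: s_def le_divide_eq mult.commute)
    then show ?thesis by simp
  qed
  have slim: "(\<lambda>n. s n / real n) \<longlonglongrightarrow> hb" using lim by (simp add: s_def hb_def)
  show ?thesis
  proof (rule tendsto_zero_if_sublinear)
    fix \<epsilon> :: real assume e: "\<epsilon> > 0"
    obtain K where K: "\<forall>n. \<bar>s n - hb * real n\<bar> \<le> \<epsilon> * real n + K"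
      using sublinear_if_tendsto[OF slim e] by blast
    define D where "D = \<bar>K\<bar> + Cb + 2 * B * real l + \<epsilon> * real l + \<bar>hb\<bar> * real l + B * real l"
    have "\<bar>ln_weight f n y - birkhoff_sum h n y\<bar> \<le> \<epsilon> * real n + D" for n
    proof -
      have h1: "\<bar>hb * real l\<bar> \<le> \<bar>hb\<bar> * real l" by (simp add: abs_mult)
      have Bl: "0 \<le> B * real l" "0 \<le> \<epsilon> * real l" "0 \<le> \<epsilon> * real n" "0 \<le> \<bar>hb\<bar> * real l" using B(1) e by simp_all
      have Cb0: "\<bar>birkhoff_sum h n y - hb * real n\<bar> \<le> Cb" using Cb by (simp add: mult.commute)
      have "hb * real n - ln_weight f n y \<le> \<epsilon> * real n + \<bar>K\<bar> + 2 * B * real l + \<epsilon> * real l + \<bar>hb\<bar> * real l"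
      proof -
        have "hb * real (n + l) = hb * real n + hb * real l" "\<epsilon> * real (n + l) = \<epsilon> * real n + \<epsilon> * real l"
          by (simp_all add: algebra_simps)
        then show ?thesis using K[rule_format, of "n + l"] s1[of n] h1 by linarith
      qed
      moreover have "ln_weight f n y - hb * real n \<le> \<epsilon> * real n + \<bar>K\<bar> + 2 * B * real l + \<bar>hb\<bar> * real l + B * real l"
      proof (cases "n \<ge> l")
        case True
        then obtain k where k: "n = k + l" by (metis add.commute le_Suc_ex)
        have "hb * real n = hb * real k + hb * real l" "\<epsilon> * real n = \<epsilon> * real k + \<epsilon> * real l"
          by (simp_all add: k algebra_simps)
        then show ?thesis using K[rule_format, of k] s2[of k] h1 Bl unfolding k[symmetric] by linarith
      next
        case False
        have "B * real n \<le> B * real l" using False B(1) by (intro mult_left_mono) auto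
        then have "ln_weight f n y \<le> B * real l" using B(2)[rule_format, OF y(1), of n] by linarith
        moreover have "\<bar>hb * real n\<bar> \<le> \<bar>hb\<bar> * real l"
          using False by (simp add: abs_mult mult_left_mono)
        ultimately show ?thesis using Bl by linarith
      qed
      ultimately show ?thesis using Cb0 Bl unfolding D_def abs_le_iff by linarith
    qed
    then show "\<exists>K. \<forall>n\<ge>1. \<bar>ln_weight f n y - birkhoff_sum h n y\<bar> \<le> \<epsilon> * real n + K" by blast
  qed
qed

end

text \<open>The words can be read off the concatenation at multiples of the period; u0 only fills
  the places from q on.\<close>

lemma inj_on_concat_blocks:
  assumes n: "n \<ge> 1" and S: "\<And>u. u \<in> S \<Longrightarrow> length u = n"
    and ab: "a \<in> {..<q} \<rightarrow>\<^sub>E S" "b \<in> {..<q} \<rightarrow>\<^sub>E S" and u0: "u0 \<in> S"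
    and eq: "block (concat_blocks (n + length z) (\<lambda>i. (if i < q then a i else u0) @ z)) 0 (q * (n + length z)) =
      block (concat_blocks (n + length z) (\<lambda>i. (if i < q then b i else u0) @ z)) 0 (q * (n + length z))"
  shows "a = b"
proof (rule PiE_ext[OF ab])
  fix i assume i: "i \<in> {..<q}"
  let ?N = "n + length z"
  have "Suc i * ?N \<le> q * ?N" using i by (intro mult_le_mono1) auto
  then have iN: "i * ?N + ?N \<le> q * ?N" by simp
  have "block (concat_blocks ?N (\<lambda>i. (if i < q then a i else u0) @ z)) (i * ?N) n = block (concat_blocks ?N (\<lambda>i. (if i < q then b i else u0) @ z)) (i * ?N) n"
    using block_eqD[OF eq] iN by (auto simp: block_eq_iff)
  moreover have "block (concat_blocks ?N (\<lambda>i. (if i < q then c i else u0) @ z)) (i * ?N) n = c i" if "c \<in> {..<q} \<rightarrow>\<^sub>E S" for c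
  proof -
    have "length (c i) = n" using that i S by auto
    then show ?thesis using block_concat_blocks[of 0 n ?N "\<lambda>i. (if i < q then c i else u0) @ z" i] i by simp
  qed
  ultimately show "a i = b i" using ab by simp
qed

section \<open>From periodic points to the uniform estimate\<close>

context factor
begin

text \<open>For fixed n and v, the q-fold concatenations bound \<open>ln_weight f (q * N) y'\<close>
  from below by q * (ln r - D), and subadditivity bounds it from above by q * (ln g_n(v) + B * K).
  The Birkhoff sum of h over q periods is exactly q times that over one, so division by q removes
  the constant belonging to y' and leaves estimates that are uniform in v.\<close>

lemma periodic_imp_shadows:
  assumes f: "continuous_on X f" and h: "continuous_on Y h" and K: "K \<ge> 1" "free_concat X K"
    and per: "\<And>y. y \<in> Y \<Longrightarrow> periodic_point y \<Longrightarrow> (\<lambda>n. (ln_weight f n y - birkhoff_sum h n y) / real n) \<longlonglongrightarrow> 0"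
  shows "shadows f h"
  unfolding shadows_def
proof (intro allI impI)
  fix \<epsilon> :: real assume "\<epsilon> > 0"
  then have e: "\<epsilon> / 2 > 0" by simp
  obtain Bf where Bf: "Bf \<ge> 0" "\<And>x. x \<in> X \<Longrightarrow> \<bar>f x\<bar> \<le> Bf"
    by (rule continuous_on_subshift_bounded[OF X f]) blast
  obtain Bh where Bh: "Bh \<ge> 0" "\<And>x. x \<in> Y \<Longrightarrow> \<bar>h x\<bar> \<le> Bh"
    by (rule continuous_on_subshift_bounded[OF Y h]) blast
  obtain V0 where V0: "V0 \<ge> 0" "\<And>n x. x \<in> X \<Longrightarrow> ln (cyl_sup X f (block x 0 n)) - (\<epsilon> / 2 * real n + V0) \<le> birkhoff_sum f n x"
    by (rule cyl_sup_variation[OF X f e]) blast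
  obtain Kh where Kh: "Kh \<ge> 0" "\<And>n x y. x \<in> Y \<Longrightarrow> y \<in> Y \<Longrightarrow> block x 0 n = block y 0 n \<Longrightarrow>
    \<bar>birkhoff_sum h n x - birkhoff_sum h n y\<bar> \<le> \<epsilon> / 2 * real n + Kh"
    by (rule birkhoff_sum_variation[OF Y h e]) blast
  obtain B where B: "B \<ge> 0" "\<forall>n. \<forall>y\<in>Y. \<bar>ln_weight f n y\<bar> \<le> B * real n" by (rule ln_weight_bound[OF f])
  \<comment> \<open>Collects every constant that is met below; none of them depends on n or
    y.\<close>
  define KT where "KT = ln (real K) + V0 + real K * Bf + Kh + real K * Bh + B * real K"
  have "\<bar>ln_weight f n y - birkhoff_sum h n y\<bar> \<le> \<epsilon> * real n + KT" if n: "n \<ge> 1" and y: "y \<in> Y" for n y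
  proof -
    define v where "v = block y 0 n"
    have vW: "v \<in> words Y n" unfolding v_def by (rule block_in_words[OF y])
    have wpos: "cyl_sup X f u > 0" if "u \<in> fibre_words n v" for u
      using cyl_sup_pos[OF X f, of u n] that by (simp add: fibre_words_def)
    obtain S z where S: "S \<subseteq> fibre_words n v" "length z \<le> K" "concat_closed X n S z"
        "sum (cyl_sup X f) (fibre_words n v) \<le> real K * sum (cyl_sup X f) S"
      by (rule free_concatD[OF K(2) n, of "fibre_words n v" "cyl_sup X f"])
         (use wpos in \<open>auto simp: fibre_words_def intro: less_imp_le\<close>)
    define r where "r = sum (cyl_sup X f) S"
    have gr: "fibre_weight f n v \<le> real K * r" using S(4) by (simp add: fibre_weight_def r_def)
    have gpos: "fibre_weight f n v > 0" by (rule fibre_weight_pos[OF f vW])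
    have r: "r > 0" using gr gpos K(1) by (metis not_less mult_nonneg_nonpos of_nat_0_le_iff order_less_le_trans)
    have finS: "finite S" using S(1) finite_fib finite_subset by blast
    have "S \<noteq> {}" using r by (auto simp: r_def)
    then obtain u0 where u0: "u0 \<in> S" by blast
    have len: "length u = n" if "u \<in> S" for u using that S(1) length_words[of u X n] by (auto simp: fibre_words_def)
    have mp: "map p u = v" if "u \<in> S" for u using that S(1) by (auto simp: fibre_words_def)
    define N where "N = n + length z"
    have N: "N \<ge> 1" using n by (simp add: N_def)
    define y' where "y' = concat_blocks N (\<lambda>_. v @ map p z)"
    have xX: "concat_blocks N (\<lambda>i. \<omega> i @ z) \<in> X" if "\<And>i. \<omega> i \<in> S" for \<omega>
      using S(3)[unfolded concat_closed_def, rule_format, of \<omega>] that by (simp add: N_def)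
    have xpi: "\<pi> (concat_blocks N (\<lambda>i. \<omega> i @ z)) = y'" if "\<And>i. \<omega> i \<in> S" for \<omega>
    proof
      fix i
      have "i mod N < N" using N by (intro mod_less_divisor) simp
      then have "i mod N < length (\<omega> (i div N) @ z)" using len[OF that] by (simp add: N_def)
      then have "p ((\<omega> (i div N) @ z) ! (i mod N)) = map p (\<omega> (i div N) @ z) ! (i mod N)" by (rule nth_map[symmetric])
      also have "map p (\<omega> (i div N) @ z) = v @ map p z" by (simp add: mp[OF that])
      finally show "\<pi> (concat_blocks N (\<lambda>i. \<omega> i @ z)) i = y' i"
        using pi[OF xX[of \<omega>, OF that]] by (simp add: concat_blocks_def y'_def)
    qed
    have y': "y' \<in> Y" using xpi[of "\<lambda>_. u0"] pi_in[OF xX[of "\<lambda>_. u0"]] u0 by simp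
    have perN: "(shift ^^ N) y' = y'" using shift_concat_blocks[OF N, of 1] by (simp add: y'_def)
    note perqN = shift_funpow_mult[OF perN]
    have pp: "periodic_point y'" unfolding periodic_point_def using N perN by blast
    define D where "D = \<epsilon> / 2 * real n + V0 + real (length z) * Bf"
    have lenv: "length v = n" by (simp add: v_def)
    have by': "block y' 0 n = v"
      using block_concat_blocks[of 0 n N "\<lambda>_. v @ map p z" 0] lenv by (simp add: y'_def N_def)
    have low: "real q * (ln r - D) \<le> ln_weight f (q * N) y'" for q
    proof -
      \<comment> \<open>Only the first q words are counted; u0 continues the sequence to a point of
        X over y'.\<close>
      define x where "x \<omega> = concat_blocks N (\<lambda>i. (if i < q then \<omega> i else u0) @ z)" for \<omega> :: "nat \<Rightarrow> nat list"
      let ?E = "{..<q} \<rightarrow>\<^sub>E S"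
      let ?b = "\<lambda>\<omega>. block (x \<omega>) 0 (q * N)"
      have inS: "(if i < q then \<omega> i else u0) \<in> S" if "\<omega> \<in> ?E" for \<omega> i using that u0 by auto
      have x: "x \<omega> \<in> X" "\<pi> (x \<omega>) = y'" if "\<omega> \<in> ?E" for \<omega>
        unfolding x_def using xX[of "\<lambda>i. if i < q then \<omega> i else u0"] xpi[of "\<lambda>i. if i < q then \<omega> i else u0"] inS[OF that] by blast+
      have finE: "finite ?E" using finS by (intro finite_PiE) auto
      have inj: "inj_on ?b ?E"
        by (intro inj_onI inj_on_concat_blocks[OF n len _ _ u0, of _ q _ z])
           (simp_all add: x_def N_def)
      have tm: "(\<Prod>i<q. cyl_sup X f (\<omega> i) * exp (- D)) \<le> cyl_sup X f (?b \<omega>)" if w: "\<omega> \<in> ?E" for \<omega>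
      proof -
        have wi: "cyl_sup X f (\<omega> i) > 0" if "i < q" for i
          using w that S(1) wpos by auto
        have "(\<Prod>i<q. cyl_sup X f (\<omega> i) * exp (- D)) = exp (\<Sum>i<q. ln (cyl_sup X f (\<omega> i)) - D)"
          using wi by (simp add: exp_sum exp_diff exp_minus field_simps)
        also have "(\<Sum>i<q. ln (cyl_sup X f (\<omega> i)) - D) \<le> (\<Sum>i<q. birkhoff_sum f N ((shift ^^ (i * N)) (x \<omega>)))"
        proof (rule sum_mono)
          fix i assume i: "i \<in> {..<q}"
          have xi: "(shift ^^ (i * N)) (x \<omega>) \<in> X" by (rule subshift_funpow[OF X x(1)[OF w]])
          have "length (\<omega> i) = n" using w i len by auto
          then have "block ((shift ^^ (i * N)) (x \<omega>)) 0 n = \<omega> i"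
            using block_concat_blocks[of 0 n N "\<lambda>i. (if i < q then \<omega> i else u0) @ z" i] i by (simp add: x_def N_def)
          then have "ln (cyl_sup X f (\<omega> i)) - (\<epsilon> / 2 * real n + V0) \<le> birkhoff_sum f n ((shift ^^ (i * N)) (x \<omega>))"
            using V0(2)[OF xi, of n] by simp
          moreover have "\<bar>birkhoff_sum f (length z) ((shift ^^ n) ((shift ^^ (i * N)) (x \<omega>)))\<bar> \<le> real (length z) * Bf"
            by (rule birkhoff_sum_bound[OF X Bf(2) subshift_funpow[OF X xi]])
          moreover have "birkhoff_sum f N ((shift ^^ (i * N)) (x \<omega>)) =
              birkhoff_sum f n ((shift ^^ (i * N)) (x \<omega>)) + birkhoff_sum f (length z) ((shift ^^ n) ((shift ^^ (i * N)) (x \<omega>)))"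
            unfolding N_def by (rule birkhoff_sum_add)
          ultimately show "ln (cyl_sup X f (\<omega> i)) - D \<le> birkhoff_sum f N ((shift ^^ (i * N)) (x \<omega>))"
            unfolding D_def by linarith
        qed
        also have "\<dots> = birkhoff_sum f (q * N) (x \<omega>)" by (rule birkhoff_sum_mult_blocks[symmetric])
        finally have "(\<Prod>i<q. cyl_sup X f (\<omega> i) * exp (- D)) \<le> exp (birkhoff_sum f (q * N) (x \<omega>))" by simp
        also have "\<dots> \<le> cyl_sup X f (?b \<omega>)" by (rule cyl_sup_upper[OF X f x(1)[OF w]])
        finally show ?thesis .
      qed
      \<comment> \<open>Multiplying out turns the power into a sum over all choices of q words, and
        distinct choices give distinct words of the fibre.\<close>
      have "(r * exp (- D)) ^ q = (\<Prod>i<q. \<Sum>u\<in>S. cyl_sup X f u * exp (- D))"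
        by (simp add: r_def sum_distrib_right)
      also have "\<dots> = (\<Sum>\<omega>\<in>?E. \<Prod>i<q. cyl_sup X f (\<omega> i) * exp (- D))"
        by (rule sum_prod_PiE[OF finS, symmetric])
      also have "\<dots> \<le> (\<Sum>\<omega>\<in>?E. cyl_sup X f (?b \<omega>))" by (intro sum_mono tm)
      also have "\<dots> = (\<Sum>u\<in>?b ` ?E. cyl_sup X f u)" using inj by (simp add: sum.reindex)
      also have "\<dots> \<le> fibre_weight f (q * N) (block y' 0 (q * N))"
        unfolding fibre_weight_def
      proof (rule sum_mono2)
        show "?b ` ?E \<subseteq> fibre_words (q * N) (block y' 0 (q * N))"
        proof
          fix u assume "u \<in> ?b ` ?E"
          then obtain \<omega> where w: "\<omega> \<in> ?E" "u = ?b \<omega>" by blast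
          then show "u \<in> fibre_words (q * N) (block y' 0 (q * N))"
            using block_pi[OF x(1)[OF w(1)], of 0 "q * N"] x(2)[OF w(1)] block_in_words[OF x(1)[OF w(1)], of 0 "q * N"]
            by (simp add: fibre_words_def)
        qed
        fix u assume "u \<in> fibre_words (q * N) (block y' 0 (q * N)) - ?b ` ?E"
        then show "0 \<le> cyl_sup X f u" using cyl_sup_pos[OF X f, of u "q * N"] by (auto simp: fibre_words_def)
      qed simp
      also have "\<dots> = exp (ln_weight f (q * N) y')" by (rule exp_ln_weight[OF f y', symmetric])
      finally have le: "(r * exp (- D)) ^ q \<le> exp (ln_weight f (q * N) y')" .
      have "r * exp (- D) = exp (ln r - D)" using r by (simp add: exp_diff exp_minus field_simps)
      then have "(r * exp (- D)) ^ q = exp (real q * (ln r - D))" by (simp only: exp_of_nat_mult)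
      with le have "exp (real q * (ln r - D)) \<le> exp (ln_weight f (q * N) y')" by (simp only:)
      then show ?thesis by simp
    qed
    have up: "ln_weight f (q * N) y' \<le> real q * (ln_weight f n y + B * real K)" for q
    proof (induction q)
      case 0
      have "ln_weight f 0 y' \<le> B * real 0" using B(2)[rule_format, OF y', of 0] by linarith
      then show ?case by simp
    next
      case (Suc q)
      have "ln_weight f (q * N + N) y' \<le> ln_weight f (q * N) y' + ln_weight f N y'"
        using ln_weight_add[OF f y', of "q * N" N] by (simp only: perqN)
      moreover have "ln_weight f N y' \<le> ln_weight f n y' + ln_weight f (length z) ((shift ^^ n) y')"
        unfolding N_def by (rule ln_weight_add[OF f y'])
      moreover have "ln_weight f n y' = ln_weight f n y" by (rule ln_weight_cong) (simp add: by' v_def)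
      moreover have "ln_weight f (length z) ((shift ^^ n) y') \<le> B * real (length z)"
        using B(2)[rule_format, OF subshift_funpow[OF Y y'], of "length z" n] by linarith
      moreover have "B * real (length z) \<le> B * real K" using S(2) B(1) by (intro mult_left_mono) auto
      moreover have "ln_weight f (Suc q * N) y' = ln_weight f (q * N + N) y'" by (simp add: add.commute)
      ultimately have "ln_weight f (Suc q * N) y' \<le> ln_weight f (q * N) y' + (ln_weight f n y + B * real K)" by linarith
      then show ?case using Suc by (simp add: algebra_simps)
    qed
    have hq: "birkhoff_sum h (q * N) y' = real q * birkhoff_sum h N y'" for q
      by (simp add: birkhoff_sum_mult_blocks perqN)
    have lim: "\<forall>\<delta>>0. \<exists>K. \<forall>m. \<bar>ln_weight f m y' - birkhoff_sum h m y'\<bar> \<le> \<delta> * real m + K"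
      using per[OF y' pp] tendsto_zero_iff_sublinear[of "\<lambda>m. ln_weight f m y' - birkhoff_sum h m y'"] by simp
    have est: "ln r - D \<le> birkhoff_sum h N y' + \<delta>' \<and> birkhoff_sum h N y' \<le> ln_weight f n y + B * real K + \<delta>'"
      if d': "\<delta>' > 0" for \<delta>'
    proof -
      \<comment> \<open>An error of \<delta> per symbol amounts to \<delta>' per period of length N;
        letting q grow then removes K'.\<close>
      define \<delta> where "\<delta> = \<delta>' / real N"
      have d: "\<delta> > 0" "\<delta> * real N = \<delta>'" using d' N by (simp_all add: \<delta>_def)
      obtain K' where K': "\<forall>m. \<bar>ln_weight f m y' - birkhoff_sum h m y'\<bar> \<le> \<delta> * real m + K'" using lim d(1) by blast
      have dq: "\<delta> * real (q * N) = real q * \<delta>'" for q using d(2) by (simp add: algebra_simps)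
      have a: "\<bar>ln_weight f (q * N) y' - real q * birkhoff_sum h N y'\<bar> \<le> real q * \<delta>' + K'" for q
        using K'[rule_format, of "q * N"] unfolding hq dq .
      show ?thesis
      proof
        show "ln r - D \<le> birkhoff_sum h N y' + \<delta>'"
        proof (rule linear_le[of _ _ K'])
          fix q :: nat
          show "real q * (ln r - D) \<le> real q * (birkhoff_sum h N y' + \<delta>') + K'"
            using a[of q] low[of q] unfolding distrib_left abs_le_iff by linarith
        qed
        show "birkhoff_sum h N y' \<le> ln_weight f n y + B * real K + \<delta>'"
        proof (rule linear_le[of _ _ K'])
          fix q :: nat
          show "real q * birkhoff_sum h N y' \<le> real q * (ln_weight f n y + B * real K + \<delta>') + K'"
            using a[of q] up[of q] unfolding distrib_left abs_le_iff by linarith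
        qed
      qed
    qed
    have e1: "ln r - D \<le> birkhoff_sum h N y'" by (rule field_le_epsilon) (use est in blast)
    have e2: "birkhoff_sum h N y' \<le> ln_weight f n y + B * real K" by (rule field_le_epsilon) (use est in blast)
    have hN: "birkhoff_sum h N y' = birkhoff_sum h n y' + birkhoff_sum h (length z) ((shift ^^ n) y')"
      unfolding N_def by (rule birkhoff_sum_add)
    have hz: "\<bar>birkhoff_sum h (length z) ((shift ^^ n) y')\<bar> \<le> real (length z) * Bh"
      by (rule birkhoff_sum_bound[OF Y Bh(2) subshift_funpow[OF Y y']])
    have zK: "real (length z) * Bh \<le> real K * Bh" "real (length z) * Bf \<le> real K * Bf"
      using S(2) Bh(1) Bf(1) by (auto intro!: mult_right_mono)
    have hn: "\<bar>birkhoff_sum h n y' - birkhoff_sum h n y\<bar> \<le> \<epsilon> / 2 * real n + Kh"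
      by (rule Kh(2)[OF y' y]) (simp add: by' v_def)
    have "ln_weight f n y \<le> ln (real K * r)"
      using gr gpos r K(1) unfolding ln_weight_def v_def[symmetric] by (subst ln_le_cancel_iff) auto
    also have "\<dots> = ln (real K) + ln r" using r K(1) by (simp add: ln_mult_pos)
    finally have lgr: "ln_weight f n y \<le> ln (real K) + ln r" .
    have nn: "0 \<le> ln (real K)" "0 \<le> real K * Bf" "0 \<le> real K * Bh" "0 \<le> B * real K"
      using K(1) Bf(1) Bh(1) B(1) by auto
    have half: "\<epsilon> * real n = \<epsilon> / 2 * real n + \<epsilon> / 2 * real n" by simp
    have nn2: "0 \<le> \<epsilon> / 2 * real n" using e by simp
    show ?thesis
      using e1 e2 hN hz zK hn lgr nn nn2 V0(1) Kh(1) unfolding half KT_def D_def abs_le_iff by linarith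
  qed
  then have "\<bar>ln_weight f n y - birkhoff_sum h n y\<bar> \<le> \<epsilon> * real n + KT" if "y \<in> Y" for n y
  proof (cases "n = 0")
    case True
    have "\<bar>ln_weight f 0 y\<bar> \<le> B * real 0" using B(2)[rule_format, OF that, of 0] .
    moreover have "0 \<le> KT" using K(1) Bf(1) Bh(1) B(1) V0(1) Kh(1) by (simp add: KT_def)
    ultimately show ?thesis using True by simp
  next
    case False
    then show ?thesis using \<open>\<And>y n. 1 \<le> n \<Longrightarrow> y \<in> Y \<Longrightarrow> \<bar>ln_weight f n y - birkhoff_sum h n y\<bar> \<le> \<epsilon> * real n + KT\<close> that by simp
  qed
  then show "\<exists>K. \<forall>n. \<forall>y\<in>Y. \<bar>ln_weight f n y - birkhoff_sum h n y\<bar> \<le> \<epsilon> * real n + K" by blast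
qed

end

section \<open>Relative pressure over periodic points\<close>

lemma shift_dist_le:
  assumes "\<And>k. k < j \<Longrightarrow> x k = x' k"
  shows "shift_dist x x' \<le> (1 / 2) ^ j"
proof (cases "x = x'")
  case False
  then obtain k where k: "x k \<noteq> x' k" by auto
  have "x (LEAST k. x k \<noteq> x' k) \<noteq> x' (LEAST k. x k \<noteq> x' k)" by (rule LeastI[of "\<lambda>k. x k \<noteq> x' k", OF k])
  then have "j \<le> (LEAST k. x k \<noteq> x' k)" using assms by (metis not_less)
  then show ?thesis using False by (simp add: shift_dist_def power_decreasing)
qed (simp add: shift_dist_def)

lemma shift_dist_eq_1: "x 0 \<noteq> x' 0 \<Longrightarrow> shift_dist x x' = 1"
proof -
  assume x: "x 0 \<noteq> x' 0"
  then have "(LEAST k. x k \<noteq> x' k) = 0" by (rule Least_eq_0)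
  then show ?thesis using x by (auto simp: shift_dist_def)
qed

text \<open>At some time i < n the distance exceeds (1 / 2) ^ j, so the points disagree before
  coordinate i + j, which the block of length n + j shows.\<close>

lemma separated_blocks:
  assumes "separated n \<delta> E" "n \<ge> 1" "(1 / 2) ^ j \<le> \<delta>" "x \<in> E" "x' \<in> E" "block x 0 (n + j) = block x' 0 (n + j)"
  shows "x = x'"
proof (rule ccontr)
  assume "x \<noteq> x'"
  then have "(MAX i\<in>{..<n}. shift_dist ((shift ^^ i) x) ((shift ^^ i) x')) > \<delta>"
    using assms(1,4,5) unfolding separated_def by blast
  then obtain i where i: "i < n" "shift_dist ((shift ^^ i) x) ((shift ^^ i) x') > \<delta>"
    using assms(2) by (subst (asm) Max_gr_iff) (auto simp: lessThan_empty_iff)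
  have "shift_dist ((shift ^^ i) x) ((shift ^^ i) x') \<le> (1 / 2) ^ j"
    by (rule shift_dist_le) (use i(1) block_eqD[OF assms(6)] in \<open>auto simp: shift_funpow\<close>)
  then show False using i(2) assms(3) by linarith
qed

text \<open>A disagreement at coordinate i < n becomes one of first symbols, hence distance 1, after
  i shifts.\<close>

lemma separatedI:
  assumes "\<delta> < 1" "inj_on (\<lambda>x. block x 0 n) E"
  shows "separated n \<delta> E"
  unfolding separated_def
proof (intro ballI impI)
  fix x x' assume x: "x \<in> E" "x' \<in> E" "x \<noteq> x'"
  then have "block x 0 n \<noteq> block x' 0 n" using assms(2) by (auto dest: inj_onD)
  then obtain i where i: "i < n" "x i \<noteq> x' i" by (auto simp: block_eq_iff)
  have "shift_dist ((shift ^^ i) x) ((shift ^^ i) x') = 1"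
    by (rule shift_dist_eq_1) (simp add: shift_funpow i)
  then have "1 \<le> (MAX i\<in>{..<n}. shift_dist ((shift ^^ i) x) ((shift ^^ i) x'))"
    using i(1) by (intro Max_ge) (auto intro!: image_eqI[of _ _ i])
  then show "\<delta> < (MAX i\<in>{..<n}. shift_dist ((shift ^^ i) x) ((shift ^^ i) x'))" using assms(1) by linarith
qed

context factor
begin

text \<open>Sample x at the k + 1 times n, n + l, ..., n + l * k. With k symbols two samples
  coincide, and the stretch between them can be repeated for ever: the seam is allowed in a one-step
  shift, and the length of the stretch is a multiple of l, so the image keeps following y.\<close>

lemma extend_fibre_word:
  assumes sft: "one_step_sft X" and y: "(shift ^^ l) y = y" "l \<ge> 1"
    and k: "\<forall>x\<in>X. \<forall>i. x i \<in> {1..k}"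
    and x: "x \<in> X" and xy: "block (\<pi> x) 0 (n + (l * k + 1)) = block y 0 (n + (l * k + 1))"
  obtains z where "z \<in> X" "\<pi> z = y" "block z 0 n = block x 0 n"
proof -
  have per: "y (i + q * l) = y i" for i q
  proof -
    have "(shift ^^ (q * l)) y i = y i" by (simp only: shift_funpow_mult[OF y(1)])
    then show ?thesis by (simp add: shift_funpow add.commute)
  qed
  have "\<not> inj_on (\<lambda>t. x (n + l * t)) {..k}"
  proof
    assume "inj_on (\<lambda>t. x (n + l * t)) {..k}"
    then have "card {..k} \<le> card {1..k}" using bspec[OF k x] by (intro card_inj_on_le) auto
    then show False by simp
  qed
  then obtain s t where "s \<le> k" "t \<le> k" "s \<noteq> t" "x (n + l * s) = x (n + l * t)"
    by (auto simp: inj_on_def)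
  then have "\<exists>t1 t2. t1 < t2 \<and> t2 \<le> k \<and> x (n + l * t1) = x (n + l * t2)"
    by (metis linorder_neqE_nat)
  then obtain t1 t2 where t: "t1 < t2" "t2 \<le> k" "x (n + l * t1) = x (n + l * t2)" by blast
  define q where "q = n + l * t1"
  define r where "r = l * (t2 - t1)"
  have r: "r \<ge> 1" using t(1) y(2) by (simp add: r_def Suc_le_eq)
  have qr: "q + r = n + l * t2" using t(1) by (simp add: q_def r_def add_mult_distrib2[symmetric])
  have xqr: "x (q + r) = x q" unfolding qr unfolding q_def by (rule t(3)[symmetric])
  have "l * t2 \<le> l * k" using t(2) by simp
  then have bnd: "q + r < n + (l * k + 1)" using qr by linarith
  have pxy: "p (x i) = y i" if "i < n + (l * k + 1)" for i
    using block_eqD[OF xy that] pi[OF x] by simp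
  \<comment> \<open>Follow x up to q, then run periodically through the stretch of length r that
    starts at q.\<close>
  define z where "z i = (if i < q then x i else x (q + (i - q) mod r))" for i
  have zin: "z \<in> X"
  proof (rule one_step_sft_memI[OF sft])
    fix i
    show "block z i 2 \<in> words X 2"
    proof (cases "i < q")
      case True
      have "z (Suc i) = x (Suc i)"
      proof (cases "Suc i < q")
        case False
        then have "Suc i = q" using True by simp
        then show ?thesis by (simp add: z_def)
      qed (simp add: z_def)
      then have "block z i 2 = block x i 2" using True by (simp add: block_2 z_def)
      then show ?thesis using block_in_words[OF x] by simp
    next
      case False
      define m where "m = (i - q) mod r"
      have mr: "m < r" using r by (simp add: m_def)
      have zi: "z i = x (q + m)" using False by (simp add: z_def m_def)
      have "z (Suc i) = x (q + Suc (i - q) mod r)" using False by (simp add: z_def Suc_diff_le)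
      also have "Suc (i - q) mod r = (if Suc m = r then 0 else Suc m)" by (simp add: m_def mod_Suc)
      also have "x (q + (if Suc m = r then 0 else Suc m)) = x (q + Suc m)" using xqr by auto
      finally have "block z i 2 = block x (q + m) 2" using zi by (simp add: block_2)
      then show ?thesis using block_in_words[OF x] by simp
    qed
  qed
  moreover have "\<pi> z = y"
  proof
    fix i
    show "\<pi> z i = y i"
    proof (cases "i < q")
      case True
      then show ?thesis using pxy[of i] bnd pi[OF zin] by (simp add: z_def)
    next
      case False
      define m c where "m = (i - q) mod r" and "c = (i - q) div r"
      have mr: "m < r" using r by (simp add: m_def)
      have "i - q = c * r + m" by (simp add: m_def c_def)
      then have i: "i = (q + m) + (c * (t2 - t1)) * l" using False by (simp add: r_def algebra_simps)
      have "\<pi> z i = p (x (q + m))" using False pi[OF zin] by (simp add: z_def m_def)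
      also have "\<dots> = y (q + m)" using pxy[of "q + m"] bnd mr by simp
      also have "\<dots> = y i" by (subst i) (rule per[symmetric])
      finally show ?thesis .
    qed
  qed
  moreover have "block z 0 n = block x 0 n" by (simp add: block_eq_iff z_def q_def)
  ultimately show ?thesis by (rule that)
qed

text \<open>Points of a separated set over y are told apart by their blocks of length n + j, which
  are fibre words; the j extra symbols cost a constant. Boundedness is recorded too, because the
  supremum in the definition is one of reals and has to be bounded for lower estimates.\<close>

lemma rel_pressure_sup_upper:
  assumes F: "continuous_on X F" and d: "\<delta> > 0"
  obtains D where "\<forall>n\<ge>1. \<forall>y\<in>Y. bdd_above ((\<lambda>E. \<Sum>x\<in>E. exp (birkhoff_sum F n x)) ` {E. E \<subseteq> {x \<in> X. \<pi> x = y} \<and> separated n \<delta> E}) \<and>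
     rel_pressure_sup X \<pi> F \<delta> n y \<le> exp (ln_weight F n y + D)"
proof -
  obtain B where B: "B \<ge> 0" "\<And>x. x \<in> X \<Longrightarrow> \<bar>F x\<bar> \<le> B"
    by (rule continuous_on_subshift_bounded[OF X F]) blast
  obtain C where C: "C \<ge> 0" "\<forall>n. \<forall>y\<in>Y. \<bar>ln_weight F n y\<bar> \<le> C * real n" by (rule ln_weight_bound[OF F])
  obtain j :: nat where j0: "(1 / 2 :: real) ^ j < \<delta>" using real_arch_pow_inv[OF d, of "1 / 2"] by auto
  then have j: "(1 / 2 :: real) ^ j \<le> \<delta>" by simp
  define D where "D = C * real j + real j * B"
  have le: "(\<Sum>x\<in>E. exp (birkhoff_sum F n x)) \<le> exp (ln_weight F n y + D)"
    if n: "n \<ge> 1" and y: "y \<in> Y" and E: "E \<subseteq> {x \<in> X. \<pi> x = y}" "separated n \<delta> E" for n y E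
  proof -
    let ?b = "\<lambda>x. block x 0 (n + j)"
    have inj: "inj_on ?b E" by (intro inj_onI separated_blocks[OF E(2) n j])
    have sub: "?b ` E \<subseteq> fibre_words (n + j) (block y 0 (n + j))"
    proof
      fix u assume "u \<in> ?b ` E"
      then obtain x where "x \<in> X" "\<pi> x = y" "u = ?b x" using E(1) by auto
      then show "u \<in> fibre_words (n + j) (block y 0 (n + j))"
        using block_in_words[of x X 0 "n + j"] block_pi[of x 0 "n + j"] by (simp add: fibre_words_def)
    qed
    have "(\<Sum>x\<in>E. exp (birkhoff_sum F n x)) \<le> (\<Sum>x\<in>E. exp (real j * B) * cyl_sup X F (?b x))"
    proof (rule sum_mono)
      fix x assume "x \<in> E"
      then have x: "x \<in> X" using E(1) by blast
      have "\<bar>birkhoff_sum F j ((shift ^^ n) x)\<bar> \<le> real j * B"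
        by (rule birkhoff_sum_bound[OF X B(2) subshift_funpow[OF X x]])
      then have "birkhoff_sum F n x \<le> real j * B + birkhoff_sum F (n + j) x"
        unfolding birkhoff_sum_add by linarith
      then have "exp (birkhoff_sum F n x) \<le> exp (real j * B) * exp (birkhoff_sum F (n + j) x)"
        by (simp add: exp_add[symmetric])
      also have "\<dots> \<le> exp (real j * B) * cyl_sup X F (?b x)"
        using cyl_sup_upper[OF X F x, of "n + j"] by simp
      finally show "exp (birkhoff_sum F n x) \<le> exp (real j * B) * cyl_sup X F (?b x)" .
    qed
    also have "\<dots> = exp (real j * B) * (\<Sum>u\<in>?b ` E. cyl_sup X F u)"
      using inj by (simp add: sum.reindex sum_distrib_left)
    also have "\<dots> \<le> exp (real j * B) * fibre_weight F (n + j) (block y 0 (n + j))"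
      unfolding fibre_weight_def
    proof (intro mult_left_mono sum_mono2[OF finite_fib sub])
      fix u assume "u \<in> fibre_words (n + j) (block y 0 (n + j)) - ?b ` E"
      then show "0 \<le> cyl_sup X F u" using cyl_sup_pos[OF X F, of u "n + j"] by (auto simp: fibre_words_def)
    qed simp
    also have "\<dots> = exp (real j * B + ln_weight F (n + j) y)" by (simp add: exp_add exp_ln_weight[OF F y])
    also have "\<dots> \<le> exp (ln_weight F n y + D)"
    proof -
      have "ln_weight F (n + j) y \<le> ln_weight F n y + ln_weight F j ((shift ^^ n) y)" by (rule ln_weight_add[OF F y])
      moreover have "ln_weight F j ((shift ^^ n) y) \<le> C * real j"
        using C(2)[rule_format, OF subshift_funpow[OF Y y], of j n] by linarith
      ultimately show ?thesis by (simp add: D_def)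
    qed
    finally show ?thesis .
  qed
  show ?thesis
  proof (rule that[of D], intro allI impI ballI conjI)
    fix n :: nat and y assume ny: "n \<ge> 1" "y \<in> Y"
    show "bdd_above ((\<lambda>E. \<Sum>x\<in>E. exp (birkhoff_sum F n x)) ` {E. E \<subseteq> {x \<in> X. \<pi> x = y} \<and> separated n \<delta> E})"
      by (rule bdd_aboveI2[of _ _ "exp (ln_weight F n y + D)"]) (use le[OF ny] in auto)
    show "rel_pressure_sup X \<pi> F \<delta> n y \<le> exp (ln_weight F n y + D)"
      unfolding rel_pressure_sup_def
    proof (rule cSUP_least)
      have "{} \<in> {E. E \<subseteq> {x \<in> X. \<pi> x = y} \<and> separated n \<delta> E}" by (simp add: separated_def)
      then show "{E. E \<subseteq> {x \<in> X. \<pi> x = y} \<and> separated n \<delta> E} \<noteq> {}" by blast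
    qed (use le[OF ny] in auto)
  qed
qed

text \<open>Every n-prefix of a fibre word of length n + c starts a point of the fibre of y itself,
  and one point for each prefix gives a separated set. Forgetting the last c symbols costs at most
  the factor \<open>cyl_sum X F c\<close>.\<close>

lemma rel_pressure_sup_lower:
  assumes sft: "one_step_sft X" and F: "continuous_on X F" and d: "0 < \<delta>" "\<delta> < 1"
    and y: "y \<in> Y" "(shift ^^ l) y = y" "l \<ge> 1" and e: "\<epsilon> > 0"
  obtains D c where "\<forall>n\<ge>1. exp (ln_weight F (n + c) y - (\<epsilon> * real n + D)) \<le> rel_pressure_sup X \<pi> F \<delta> n y"
proof -
  obtain k where k: "\<forall>x\<in>X. \<forall>i. x i \<in> {1..k}" using subshift_symbols[OF X] by blast
  obtain V where V: "V \<ge> 0" "\<And>n x. x \<in> X \<Longrightarrow> ln (cyl_sup X F (block x 0 n)) - (\<epsilon> * real n + V) \<le> birkhoff_sum F n x"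
    by (rule cyl_sup_variation[OF X F e]) blast
  obtain D0 where D0: "\<forall>n\<ge>1. \<forall>y\<in>Y. bdd_above ((\<lambda>E. \<Sum>x\<in>E. exp (birkhoff_sum F n x)) ` {E. E \<subseteq> {x \<in> X. \<pi> x = y} \<and> separated n \<delta> E}) \<and>
     rel_pressure_sup X \<pi> F \<delta> n y \<le> exp (ln_weight F n y + D0)"
    by (rule rel_pressure_sup_upper[OF F d(1)])
  define c where "c = l * k + 1"
  define D where "D = V + ln (cyl_sum X F c)"
  have pc: "cyl_sum X F c > 0" by (rule cyl_sum_pos[OF X F ne])
  have "exp (ln_weight F (n + c) y - (\<epsilon> * real n + D)) \<le> rel_pressure_sup X \<pi> F \<delta> n y" if n: "n \<ge> 1" for n
  proof -
    let ?U = "fibre_words (n + c) (block y 0 (n + c))"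
    define W where "W = take n ` ?U"
    have "\<exists>z. z \<in> X \<and> \<pi> z = y \<and> block z 0 n = w" if w: "w \<in> W" for w
    proof -
      obtain u where u: "u \<in> ?U" "w = take n u" using w by (auto simp: W_def)
      then have uW: "u \<in> words X (n + c)" by (simp add: fibre_words_def)
      obtain x where x: "x \<in> X" "u = block x 0 (n + c)" by (rule wordsE[OF X uW])
      have "block (\<pi> x) 0 (n + c) = block y 0 (n + c)" using u(1) x by (simp add: fibre_words_def block_pi)
      then obtain z where "z \<in> X" "\<pi> z = y" "block z 0 n = block x 0 n"
        unfolding c_def by (rule extend_fibre_word[OF sft y(2,3) k x(1)])
      then show ?thesis using u(2) x(2) by (auto simp: take_block)
    qed
    then obtain g where g: "\<And>w. w \<in> W \<Longrightarrow> g w \<in> X \<and> \<pi> (g w) = y \<and> block (g w) 0 n = w" by metis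
    have finW: "finite W" by (simp add: W_def)
    have gb: "(\<lambda>x. block x 0 n) ` (g ` W) = W" using g by force
    have "inj_on (\<lambda>x. block x 0 n) (g ` W)" using g by (intro inj_onI) auto
    then have "separated n \<delta> (g ` W)" by (rule separatedI[OF d(2)])
    moreover have "g ` W \<subseteq> {x \<in> X. \<pi> x = y}" using g by blast
    ultimately have mem: "g ` W \<in> {E. E \<subseteq> {x \<in> X. \<pi> x = y} \<and> separated n \<delta> E}" by blast
    have injg: "inj_on g W" using g by (metis inj_onI)
    have wpos: "cyl_sup X F w > 0" if "w \<in> W" for w
      using cyl_sup_pos[OF X F, of w n] g[OF that] block_in_words[of "g w" X 0 n] by auto
    have "fibre_weight F (n + c) (block y 0 (n + c)) \<le> (\<Sum>u\<in>?U. cyl_sup X F (take n u) * cyl_sup X F (drop n u))"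
      unfolding fibre_weight_def
    proof (rule sum_mono)
      fix u assume "u \<in> ?U"
      then have uW: "u \<in> words X (n + c)" by (simp add: fibre_words_def)
      have "take n u @ drop n u \<in> words X (length (take n u) + length (drop n u))"
        using uW length_words[OF uW] by simp
      from cyl_sup_append(3)[OF X F this] show "cyl_sup X F u \<le> cyl_sup X F (take n u) * cyl_sup X F (drop n u)" by simp
    qed
    also have "\<dots> = (\<Sum>(a, b)\<in>(\<lambda>u. (take n u, drop n u)) ` ?U. cyl_sup X F a * cyl_sup X F b)"
    proof -
      have "inj_on (\<lambda>u. (take n u, drop n u)) ?U"
        by (intro inj_onI) (metis append_take_drop_id prod.inject)
      then show ?thesis by (simp add: sum.reindex)
    qed
    also have "\<dots> \<le> (\<Sum>(a, b)\<in>W \<times> words X c. cyl_sup X F a * cyl_sup X F b)"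
    proof (rule sum_mono2)
      show "(\<lambda>u. (take n u, drop n u)) ` ?U \<subseteq> W \<times> words X c"
      proof safe
        fix u assume u: "u \<in> ?U"
        show "take n u \<in> W" using u by (auto simp: W_def)
        have uW: "u \<in> words X (n + c)" using u by (simp add: fibre_words_def)
        obtain x where x: "x \<in> X" "u = block x 0 (n + c)" by (rule wordsE[OF X uW])
        show "drop n u \<in> words X c" using block_in_words[OF x(1), of n c] by (simp add: x(2) drop_block)
      qed
      show "finite (W \<times> words X c)" using finW finite_words[OF X] by blast
      fix ab assume "ab \<in> W \<times> words X c - (\<lambda>u. (take n u, drop n u)) ` ?U"
      then show "0 \<le> (case ab of (a, b) \<Rightarrow> cyl_sup X F a * cyl_sup X F b)"
        using wpos[of "fst ab"] cyl_sup_pos[OF X F, of "snd ab" c] by auto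
    qed
    also have "\<dots> = (\<Sum>w\<in>W. cyl_sup X F w) * cyl_sum X F c"
      by (simp add: cyl_sum_def sum_product sum.cartesian_product)
    finally have "exp (ln_weight F (n + c) y) \<le> (\<Sum>w\<in>W. cyl_sup X F w) * cyl_sum X F c" unfolding exp_ln_weight[OF F y(1)] .
    then have "exp (ln_weight F (n + c) y) / cyl_sum X F c \<le> (\<Sum>w\<in>W. cyl_sup X F w)" using pc by (simp add: divide_le_eq)
    then have "exp (ln_weight F (n + c) y) / cyl_sum X F c * exp (- (\<epsilon> * real n + V)) \<le> (\<Sum>w\<in>W. cyl_sup X F w) * exp (- (\<epsilon> * real n + V))"
      by (intro mult_right_mono) auto
    also have "(\<Sum>w\<in>W. cyl_sup X F w) * exp (- (\<epsilon> * real n + V)) \<le> (\<Sum>w\<in>W. exp (birkhoff_sum F n (g w)))"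
      unfolding sum_distrib_right
    proof (rule sum_mono)
      fix w assume w: "w \<in> W"
      have "ln (cyl_sup X F w) - (\<epsilon> * real n + V) \<le> birkhoff_sum F n (g w)"
        using V(2)[of "g w" n] g[OF w] by simp
      then have "exp (ln (cyl_sup X F w) + - (\<epsilon> * real n + V)) \<le> exp (birkhoff_sum F n (g w))" by simp
      then show "cyl_sup X F w * exp (- (\<epsilon> * real n + V)) \<le> exp (birkhoff_sum F n (g w))"
        unfolding exp_add using wpos[OF w] by simp
    qed
    also have "\<dots> = (\<Sum>x\<in>g ` W. exp (birkhoff_sum F n x))" using injg by (simp add: sum.reindex)
    also have "\<dots> \<le> rel_pressure_sup X \<pi> F \<delta> n y"
      unfolding rel_pressure_sup_def using D0 n y(1) mem by (intro cSUP_upper) auto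
    finally have "exp (ln_weight F (n + c) y) / cyl_sum X F c * exp (- (\<epsilon> * real n + V)) \<le> rel_pressure_sup X \<pi> F \<delta> n y" .
    moreover have "exp (ln_weight F (n + c) y - (\<epsilon> * real n + D)) = exp (ln_weight F (n + c) y) / cyl_sum X F c * exp (- (\<epsilon> * real n + V))"
      using pc by (simp add: D_def exp_diff exp_add exp_minus field_simps)
    ultimately show ?thesis by simp
  qed
  then show ?thesis using that by blast
qed

text \<open>The growth rate of the fibre weights along y exists by Fekete's lemma with l the period
  of y; the two preceding bounds tie the separated sums to these weights up to exp (o(n)).\<close>

lemma rel_pressure_periodic:
  assumes sft: "one_step_sft X" and F: "continuous_on X F"
    and y: "y \<in> Y" "(shift ^^ l) y = y" "l \<ge> 1"
  obtains c where "(\<lambda>n. ln_weight F n y / real n) \<longlonglongrightarrow> c" "rel_pressure X \<pi> F y = ereal c"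
proof -
  obtain B where B: "B \<ge> 0" "\<forall>n. \<forall>y\<in>Y. \<bar>ln_weight F n y\<bar> \<le> B * real n" by (rule ln_weight_bound[OF F])
  note per = shift_funpow_mult[OF y(2)]
  obtain c where c: "(\<lambda>n. ln_weight F n y / real n) \<longlonglongrightarrow> c"
  proof (rule Fekete[of l B "\<lambda>n. ln_weight F n y"])
    show "l \<ge> 1" "B \<ge> 0" by fact+
    show "ln_weight F (n * l + m) y \<le> ln_weight F (n * l) y + ln_weight F m y" for n m
      using ln_weight_add[OF F y(1), of "n * l" m] by (simp add: per)
    show "ln_weight F (n + m) y \<le> ln_weight F n y + B * real m" for n m
      using ln_weight_add[OF F y(1), of n m] B(2)[rule_format, OF subshift_funpow[OF Y y(1)], of m n] by linarith
    show "- B * real n \<le> ln_weight F n y" for n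
      using B(2)[rule_format, OF y(1), of n] by (simp add: abs_le_iff)
  qed
  \<comment> \<open>Every scale below 1 already gives the growth rate, so the limit \<delta>
    \<rightarrow> 0 is that of an eventually constant function.\<close>
  have scale: "rel_pressure_scale X \<pi> F \<delta> y = ereal c" if d: "0 < \<delta>" "\<delta> < 1" for \<delta>
  proof -
    let ?s = "\<lambda>n. ln (rel_pressure_sup X \<pi> F \<delta> n y)"
    obtain D0 where D0: "\<forall>n\<ge>1. \<forall>y\<in>Y. bdd_above ((\<lambda>E. \<Sum>x\<in>E. exp (birkhoff_sum F n x)) ` {E. E \<subseteq> {x \<in> X. \<pi> x = y} \<and> separated n \<delta> E}) \<and>
       rel_pressure_sup X \<pi> F \<delta> n y \<le> exp (ln_weight F n y + D0)"
      by (rule rel_pressure_sup_upper[OF F d(1)])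
    have "(\<lambda>n. ?s n / real n) \<longlonglongrightarrow> c"
    proof (rule tendsto_if_sublinear)
      fix \<epsilon> :: real assume "\<epsilon> > 0"
      then have e: "\<epsilon> / 2 > 0" by simp
      obtain D k where Dk: "\<forall>n\<ge>1. exp (ln_weight F (n + k) y - (\<epsilon> / 2 * real n + D)) \<le> rel_pressure_sup X \<pi> F \<delta> n y"
        by (rule rel_pressure_sup_lower[OF sft F d y e])
      obtain K where K: "\<forall>n. \<bar>ln_weight F n y - c * real n\<bar> \<le> \<epsilon> / 2 * real n + K" using sublinear_if_tendsto[OF c e] by blast
      define K' where "K' = \<bar>K\<bar> + \<bar>D\<bar> + \<bar>D0\<bar> + (\<epsilon> / 2 + \<bar>c\<bar>) * real k"
      have "\<bar>?s n - c * real n\<bar> \<le> \<epsilon> * real n + K'" if n: "n \<ge> 1" for n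
      proof -
        have lo: "exp (ln_weight F (n + k) y - (\<epsilon> / 2 * real n + D)) \<le> rel_pressure_sup X \<pi> F \<delta> n y" using Dk n by blast
        then have pos: "rel_pressure_sup X \<pi> F \<delta> n y > 0" using exp_gt_zero order_less_le_trans by blast
        have 1: "ln_weight F (n + k) y - (\<epsilon> / 2 * real n + D) \<le> ?s n" using lo pos by (simp add: ln_ge_iff)
        have "?s n \<le> ln (exp (ln_weight F n y + D0))"
          using D0 n y(1) pos by (subst ln_le_cancel_iff) auto
        then have 2: "?s n \<le> ln_weight F n y + D0" by simp
        have a: "c * real (n + k) = c * real n + c * real k" "\<epsilon> / 2 * real (n + k) = \<epsilon> / 2 * real n + \<epsilon> / 2 * real k"
          by (simp_all add: algebra_simps)
        have b: "\<bar>c * real k\<bar> = \<bar>c\<bar> * real k" by (simp add: abs_mult)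
        have d: "K' = \<bar>K\<bar> + \<bar>D\<bar> + \<bar>D0\<bar> + \<epsilon> / 2 * real k + \<bar>c\<bar> * real k" by (simp add: K'_def algebra_simps)
        have h: "\<epsilon> * real n = \<epsilon> / 2 * real n + \<epsilon> / 2 * real n" by simp
        have nn: "0 \<le> \<epsilon> / 2 * real n" "0 \<le> \<epsilon> / 2 * real k" "0 \<le> \<bar>c\<bar> * real k" using e by simp_all
        show ?thesis
          using K[rule_format, of n] K[rule_format, of "n + k"] 1 2 a b nn unfolding d h by linarith
      qed
      then show "\<exists>K. \<forall>n\<ge>1. \<bar>?s n - c * real n\<bar> \<le> \<epsilon> * real n + K" by blast
    qed
    then have "(\<lambda>n. ereal (?s n / real n)) \<longlonglongrightarrow> ereal c" by simp
    then show ?thesis unfolding rel_pressure_scale_def by (intro lim_imp_Limsup) auto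
  qed
  have "\<forall>\<^sub>F \<delta> in at_right 0. rel_pressure_scale X \<pi> F \<delta> y = ereal c"
    by (rule eventually_mono[OF eventually_at_right_real[of 0 "1 :: real"]]) (auto intro: scale)
  then have "((\<lambda>\<delta>. rel_pressure_scale X \<pi> F \<delta> y) \<longlongrightarrow> ereal c) (at_right 0)"
    by (rule tendsto_eventually)
  then have "rel_pressure X \<pi> F y = ereal c"
    unfolding rel_pressure_def by (intro tendsto_Lim) (auto simp: trivial_limit_at_right_real)
  with c show ?thesis by (rule that)
qed

end

section \<open>Weak Gibbs measures\<close>

text \<open>Take logarithms; positivity of a is kept as a separate conjunct since \<open>ln\<close>
  carries no information at arguments \<le> 0.\<close>

lemma gibbs_ratio_iff:
  fixes a b x C :: real
  assumes "b > 0" "C > 0"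
  shows "(1 / C < a / (exp (- x) * b) \<and> a / (exp (- x) * b) < C) \<longleftrightarrow> (a > 0 \<and> \<bar>ln a + x - ln b\<bar> < ln C)"
proof (cases "a > 0")
  case True
  let ?q = "a / (exp (- x) * b)"
  have q: "?q > 0" using True assms by simp
  have lnq: "ln ?q = ln a + x - ln b" using True assms by (simp add: ln_div ln_mult_pos)
  have "?q < C \<longleftrightarrow> ln ?q < ln C" using q assms by simp
  moreover have "1 / C < ?q \<longleftrightarrow> ln (1 / C) < ln ?q" using q assms by (subst ln_less_cancel_iff) auto
  moreover have "ln (1 / C) = - ln C" using assms by (simp add: ln_div)
  ultimately show ?thesis unfolding lnq using True by (auto simp: abs_less_iff)
next
  case False
  then have "a / (exp (- x) * b) \<le> 0" using assms by (simp add: divide_nonpos_pos)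
  moreover have "1 / C > 0" using assms by simp
  ultimately show ?thesis using False by linarith
qed

text \<open>In logarithmic form Gibbs inequalities can be added and compared linearly, with the same
  C.\<close>

lemma weak_gibbs_iff:
  assumes "pressure X f = ereal P"
  shows "weak_gibbs X f \<mu> \<longleftrightarrow> potential_seq X f \<and> \<mu> \<in> invariant_measures X \<and>
     (\<exists>C. (\<forall>n\<ge>1. C n > 0) \<and> (\<lambda>n. ln (C n) / real n) \<longlonglongrightarrow> 0 \<and>
       (\<forall>x\<in>X. \<forall>n\<ge>1. measure \<mu> (cylinder X (block x 0 n)) > 0 \<and>
          \<bar>ln (measure \<mu> (cylinder X (block x 0 n))) + real n * P - ln (f n x)\<bar> < ln (C n)))"
    (is "?L \<longleftrightarrow> ?R")
proof -
  have iff: "(1 / C < measure \<mu> (cylinder X (block x 0 n)) / (exp (- real n * P) * f n x) \<and>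
       measure \<mu> (cylinder X (block x 0 n)) / (exp (- real n * P) * f n x) < C) \<longleftrightarrow>
      (measure \<mu> (cylinder X (block x 0 n)) > 0 \<and>
          \<bar>ln (measure \<mu> (cylinder X (block x 0 n))) + real n * P - ln (f n x)\<bar> < ln C)"
    if "potential_seq X f" "C > 0" "x \<in> X" "n \<ge> 1" for C :: real and x n
  proof -
    have "f n x > 0" using that unfolding potential_seq_def by blast
    from gibbs_ratio_iff[OF this that(2), of "measure \<mu> (cylinder X (block x 0 n))" "real n * P"]
    show ?thesis by simp
  qed
  have eq: "(\<forall>x\<in>X. \<forall>n\<ge>1. 1 / C n < measure \<mu> (cylinder X (block x 0 n)) / (exp (- real n * P) * f n x) \<and>
       measure \<mu> (cylinder X (block x 0 n)) / (exp (- real n * P) * f n x) < C n) \<longleftrightarrow>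
      (\<forall>x\<in>X. \<forall>n\<ge>1. measure \<mu> (cylinder X (block x 0 n)) > 0 \<and>
          \<bar>ln (measure \<mu> (cylinder X (block x 0 n))) + real n * P - ln (f n x)\<bar> < ln (C n))"
    if ps: "potential_seq X f" and C: "\<forall>n\<ge>1. C n > 0" for C :: "nat \<Rightarrow> real"
  proof (intro ball_cong[OF refl] all_cong)
    fix x and n :: nat assume x: "x \<in> X" and n: "1 \<le> n"
    show "(1 / C n < measure \<mu> (cylinder X (block x 0 n)) / (exp (- real n * P) * f n x) \<and>
       measure \<mu> (cylinder X (block x 0 n)) / (exp (- real n * P) * f n x) < C n) \<longleftrightarrow>
      (measure \<mu> (cylinder X (block x 0 n)) > 0 \<and>
          \<bar>ln (measure \<mu> (cylinder X (block x 0 n))) + real n * P - ln (f n x)\<bar> < ln (C n))"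
      by (rule iff[OF ps C[rule_format, OF n] x n])
  qed
  have fin: "pressure X f \<noteq> - \<infinity>" "pressure X f \<noteq> \<infinity>" by (simp_all add: assms)
  show ?thesis
  proof
    assume ?L
    then obtain C where "potential_seq X f" "\<mu> \<in> invariant_measures X" "\<forall>n\<ge>1. C n > 0" "(\<lambda>n. ln (C n) / real n) \<longlonglongrightarrow> 0"
      "\<forall>x\<in>X. \<forall>n\<ge>1. 1 / C n < measure \<mu> (cylinder X (block x 0 n)) / (exp (- real n * P) * f n x) \<and>
       measure \<mu> (cylinder X (block x 0 n)) / (exp (- real n * P) * f n x) < C n"
      unfolding weak_gibbs_def Let_def assms real_of_ereal.simps by (elim conjE exE)
    then show ?R using eq[of C] by (intro conjI exI[of _ C]) simp_all
  next
    assume ?R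
    then obtain C where "potential_seq X f" "\<mu> \<in> invariant_measures X" "\<forall>n\<ge>1. C n > 0" "(\<lambda>n. ln (C n) / real n) \<longlonglongrightarrow> 0"
      "\<forall>x\<in>X. \<forall>n\<ge>1. measure \<mu> (cylinder X (block x 0 n)) > 0 \<and>
          \<bar>ln (measure \<mu> (cylinder X (block x 0 n))) + real n * P - ln (f n x)\<bar> < ln (C n)"
      by (elim conjE exE)
    then show ?L unfolding weak_gibbs_def Let_def using eq[of C] fin by (intro conjI exI[of _ C]) (simp_all add: assms)
  qed
qed

text \<open>The limsup in the definition is a limit by Fekete's lemma, so the pressure is a real
  number.\<close>

lemma pressure_exp_birkhoff:
  assumes X: "subshift X" "X \<noteq> {}" and f: "continuous_on X f"
  shows "pressure X (exp_birkhoff f) = ereal (top_pressure X f)"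
proof -
  have "(\<Sum>u\<in>words X n. SUP x\<in>cylinder X u. exp_birkhoff f n x) = cyl_sum X f n" for n
    unfolding cyl_sum_def
    by (intro sum.cong refl) (auto simp: cyl_sup_def exp_birkhoff_def dest!: length_words)
  then have "pressure X (exp_birkhoff f) = limsup (\<lambda>n. ereal (ln (cyl_sum X f n) / real n))"
    by (simp add: pressure_def)
  also have "\<dots> = ereal (top_pressure X f)"
    using top_pressure(1)[OF X f] by (intro lim_imp_Limsup) auto
  finally show ?thesis .
qed

lemma potential_seq_exp_birkhoff:
  assumes "subshift X" "continuous_on X f"
  shows "potential_seq X (exp_birkhoff f)"
  unfolding potential_seq_def exp_birkhoff_def
  using continuous_on_exp[OF continuous_on_birkhoff_sum[OF assms]] by simp

context factor
begin

text \<open>A choice set meets each cylinder of the fibre exactly once, so its sum is at most the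
  sum of the suprema; choosing maximising points attains it.\<close>

lemma fiber_sum_eq_fibre_weight:
  assumes f: "continuous_on X f" and y: "y \<in> Y"
  shows "fiber_sum X p f n y = fibre_weight f n (block y 0 n)"
proof -
  let ?W = "fibre_words n (block y 0 n)"
  let ?ch = "cylinder_choices X p n y"
  let ?b = "\<lambda>x. block x 0 n"
  have ch: "E \<in> ?ch \<longleftrightarrow> E \<subseteq> (\<Union>u\<in>?W. cylinder X u) \<and> (\<forall>u\<in>?W. \<exists>!x. x \<in> E \<inter> cylinder X u)" for E
    unfolding cylinder_choices_def Let_def fibre_words_def by simp
  have cyl: "x \<in> cylinder X u \<longleftrightarrow> x \<in> X \<and> ?b x = u" if "u \<in> ?W" for x u
    using that length_words[of u X n] by (auto simp: cylinder_def fibre_words_def)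
  have up: "(\<Sum>x\<in>E. exp (birkhoff_sum f n x)) \<le> fibre_weight f n (block y 0 n)" if E: "E \<in> ?ch" for E
  proof -
    have EX: "x \<in> X \<and> ?b x \<in> ?W" if x: "x \<in> E" for x
    proof -
      obtain u where u: "u \<in> ?W" "x \<in> cylinder X u" using E x unfolding ch by blast
      then show ?thesis using cyl[OF u(1), of x] by simp
    qed
    have ex1: "\<exists>!x. x \<in> E \<inter> cylinder X u" if "u \<in> ?W" for u using E that unfolding ch by blast
    have bij: "bij_betw ?b E ?W"
    proof (rule bij_betwI')
      fix x x' assume x: "x \<in> E" "x' \<in> E"
      show "?b x = ?b x' \<longleftrightarrow> x = x'"
      proof
        assume "?b x = ?b x'"
        then have "x \<in> E \<inter> cylinder X (?b x)" "x' \<in> E \<inter> cylinder X (?b x)"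
          using x EX by (auto simp: cylinder_def)
        then show "x = x'" using ex1[of "?b x"] EX[OF x(1)] by blast
      qed simp
    next
      fix x assume "x \<in> E" then show "?b x \<in> ?W" using EX by blast
    next
      fix u assume u: "u \<in> ?W"
      then obtain x where x: "x \<in> E \<inter> cylinder X u" using ex1 by blast
      then have "u = ?b x" using cyl[OF u, of x] by simp
      then show "\<exists>x\<in>E. u = ?b x" using x by (intro bexI[of _ x]) simp_all
    qed
    have "(\<Sum>x\<in>E. exp (birkhoff_sum f n x)) \<le> (\<Sum>x\<in>E. cyl_sup X f (?b x))"
      using EX cyl_sup_upper[OF X f] by (intro sum_mono) blast
    also have "\<dots> = fibre_weight f n (block y 0 n)"
      unfolding fibre_weight_def by (rule sum.reindex_bij_betw[OF bij])
    finally show ?thesis .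
  qed
  have "\<exists>x. x \<in> X \<and> ?b x = u \<and> cyl_sup X f u = exp (birkhoff_sum f n x)" if u: "u \<in> ?W" for u
  proof -
    have u': "u \<in> words X n" using u by (simp add: fibre_words_def)
    obtain x where "x \<in> X" "block x 0 n = u" "cyl_sup X f u = exp (birkhoff_sum f n x)"
        "\<forall>y\<in>X. block y 0 n = u \<longrightarrow> birkhoff_sum f n y \<le> birkhoff_sum f n x"
      by (rule cyl_sup_attained[OF X f u'])
    then show ?thesis by blast
  qed
  then obtain m where m: "\<And>u. u \<in> ?W \<Longrightarrow> m u \<in> X \<and> ?b (m u) = u \<and> cyl_sup X f u = exp (birkhoff_sum f n (m u))"
    by metis
  have mch: "m ` ?W \<in> ?ch"
    unfolding ch
  proof (intro conjI ballI)
    have mcyl: "m u \<in> cylinder X u" if "u \<in> ?W" for u using m[OF that] cyl[OF that, of "m u"] by simp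
    show "m ` ?W \<subseteq> (\<Union>u\<in>?W. cylinder X u)" using mcyl by blast
    fix u assume u: "u \<in> ?W"
    show "\<exists>!x. x \<in> m ` ?W \<inter> cylinder X u"
    proof (rule ex1I[of _ "m u"])
      show "m u \<in> m ` ?W \<inter> cylinder X u" using u m[OF u] cyl[OF u, of "m u"] by simp
      fix x assume "x \<in> m ` ?W \<inter> cylinder X u"
      then obtain u' where u': "u' \<in> ?W" "x = m u'" "x \<in> cylinder X u" by blast
      then have "u' = u" using cyl[OF u, of x] m[OF u'(1)] by simp
      then show "x = m u" using u'(2) by simp
    qed
  qed
  have "inj_on m ?W" using m by (metis inj_onI)
  then have eq: "(\<Sum>x\<in>m ` ?W. exp (birkhoff_sum f n x)) = fibre_weight f n (block y 0 n)"
    unfolding fibre_weight_def using m by (simp add: sum.reindex)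
  show ?thesis
    unfolding fiber_sum_def
    by (rule cSup_eq_maximum) (use mch eq up in \<open>force+\<close>)
qed

lemma ln_fiber_sum: "continuous_on X f \<Longrightarrow> y \<in> Y \<Longrightarrow> ln (fiber_sum X p f n y) = ln_weight f n y"
  by (simp add: fiber_sum_eq_fibre_weight ln_weight_def)

lemma fiber_sum_pos: "continuous_on X f \<Longrightarrow> y \<in> Y \<Longrightarrow> fiber_sum X p f n y > 0"
  by (simp add: fiber_sum_eq_fibre_weight fibre_weight_pos')

lemma ln_fiber_sum_ratio:
  "continuous_on X f \<Longrightarrow> y \<in> Y \<Longrightarrow>
    ln (fiber_sum X p f n y / exp_birkhoff h n y) = ln_weight f n y - birkhoff_sum h n y"
  using fiber_sum_pos[of f y n] by (simp add: ln_div exp_birkhoff_def ln_fiber_sum)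

lemma continuous_on_ln_weight: "continuous_on Y (ln_weight f n)"
  by (rule continuous_on_if_block[of _ n]) (rule ln_weight_cong)

lemma potential_seq_fiber_sum:
  assumes f: "continuous_on X f"
  shows "potential_seq Y (fiber_sum X p f)"
  unfolding potential_seq_def
proof (intro allI impI conjI ballI)
  fix n :: nat
  show "continuous_on Y (fiber_sum X p f n)"
    by (rule continuous_on_if_block[of _ n]) (simp add: fiber_sum_eq_fibre_weight[OF f])
qed (rule fiber_sum_pos[OF f])

text \<open>g_n is constant on the n-cylinders of Y, and summing it over the words of Y regroups the
  sum over the words of X.\<close>

lemma pressure_fiber_sum:
  assumes f: "continuous_on X f"
  shows "pressure Y (fiber_sum X p f) = ereal (top_pressure X f)"
proof -
  have "(SUP y\<in>cylinder Y v. fiber_sum X p f n y) = fibre_weight f n v" if v: "v \<in> words Y n" for v n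
  proof -
    have len: "length v = n" using length_words[OF v] .
    obtain y where y: "y \<in> Y" "v = block y 0 n" by (rule wordsE[OF Y v])
    have "fiber_sum X p f n ` cylinder Y v = {fibre_weight f n v}"
      using y len by (auto simp: cylinder_def fiber_sum_eq_fibre_weight[OF f] image_iff)
    then show ?thesis by simp
  qed
  then have "(\<Sum>v\<in>words Y n. SUP y\<in>cylinder Y v. fiber_sum X p f n y) = cyl_sum X f n" for n
    unfolding cyl_sum_eq_fibre_weight by (intro sum.cong) auto
  then have "pressure Y (fiber_sum X p f) = limsup (\<lambda>n. ereal (ln (cyl_sum X f n) / real n))"
    by (simp add: pressure_def)
  also have "\<dots> = ereal (top_pressure X f)"
    using top_pressure(1)[OF X ne f] by (intro lim_imp_Limsup) auto
  finally show ?thesis .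
qed

text \<open>Invariance passes through \<pi> because \<pi> commutes with the shift; the preimage of a
  cylinder of Y is the disjoint union of the cylinders of its fibre words.\<close>

lemma push_forward_invariant:
  assumes \<mu>: "\<mu> \<in> invariant_measures X"
  shows "push_forward Y \<pi> \<mu> \<in> invariant_measures Y"
    "v \<in> words Y n \<Longrightarrow> measure (push_forward Y \<pi> \<mu>) (cylinder Y v) = (\<Sum>u\<in>fibre_words n v. measure \<mu> (cylinder X u))"
proof -
  interpret m: invariant_measure X \<mu> using X \<mu> by unfold_locales
  define R where "R = (restrict_space borel Y :: (nat \<Rightarrow> nat) measure)"
  have pim: "\<pi> \<in> measurable \<mu> R"
  proof -
    have "\<pi> \<in> measurable (restrict_space borel X) R"
      unfolding R_def using pi_in
      by (intro measurable_restrict_space2 borel_measurable_continuous_on_restrict continuous_pi)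
         (auto simp: space_restrict_space)
    then show ?thesis using measurable_cong_sets[OF m.sets_eq refl] by blast
  qed
  have shR: "shift -` A \<inter> Y \<in> sets R" if "A \<in> sets R" for A
    using vimage_shift_sets[OF Y] that by (simp add: R_def)
  have pf: "push_forward Y \<pi> \<mu> = distr \<mu> R \<pi>" by (simp add: push_forward_def R_def)
  have "prob_space (distr \<mu> R \<pi>)" using m.prob_space_distr[OF pim] .
  moreover have "emeasure (distr \<mu> R \<pi>) (shift -` A \<inter> Y) = emeasure (distr \<mu> R \<pi>) A" if A: "A \<in> sets R" for A
  proof -
    have "emeasure (distr \<mu> R \<pi>) (shift -` A \<inter> Y) = emeasure \<mu> (\<pi> -` (shift -` A \<inter> Y) \<inter> X)"
      using emeasure_distr[OF pim shR[OF A]] by (simp add: m.space_eq)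
    also have "\<pi> -` (shift -` A \<inter> Y) \<inter> X = shift -` (\<pi> -` A \<inter> X) \<inter> X"
      using pi_shift1 pi_in subshift_shift[OF X] by auto
    also have "emeasure \<mu> \<dots> = emeasure \<mu> (\<pi> -` A \<inter> X)"
    proof -
      have "\<forall>A\<in>sets \<mu>. emeasure \<mu> (shift -` A \<inter> X) = emeasure \<mu> A" using \<mu> by (simp add: invariant_measures_def)
      moreover have "\<pi> -` A \<inter> X \<in> sets \<mu>" using measurable_sets[OF pim A] by (simp add: m.space_eq)
      ultimately show ?thesis by (rule bspec)
    qed
    also have "\<dots> = emeasure (distr \<mu> R \<pi>) A"
      using emeasure_distr[OF pim A] by (simp add: m.space_eq)
    finally show ?thesis .
  qed
  ultimately show "push_forward Y \<pi> \<mu> \<in> invariant_measures Y"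
    unfolding pf invariant_measures_def by (simp add: R_def)
  assume v: "v \<in> words Y n"
  have cylY: "cylinder Y v = Y \<inter> {y. block y 0 n = v}" using length_words[OF v] by (auto simp: cylinder_def)
  have cylX: "cylinder X u = {x \<in> X. block x 0 n = u}" if "u \<in> fibre_words n v" for u
    using that length_words[of u X n] by (auto simp: cylinder_def fibre_words_def)
  have "cylinder Y v \<in> sets R"
    unfolding cylY R_def using borel_open[OF open_block[of n v]] by (auto simp: sets_restrict_space)
  then have "measure (distr \<mu> R \<pi>) (cylinder Y v) = measure \<mu> (\<pi> -` cylinder Y v \<inter> X)"
    using measure_distr[OF pim] by (simp add: m.space_eq)
  also have "\<pi> -` cylinder Y v \<inter> X = (\<Union>u\<in>fibre_words n v. {x \<in> X. block x 0 n = u})"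
    using pi_in block_pi block_in_words by (auto simp: cylY fibre_words_def)
  also have "measure \<mu> \<dots> = (\<Sum>u\<in>fibre_words n v. measure \<mu> {x \<in> X. block x 0 n = u})"
    using m.block_sets by (intro m.finite_measure_finite_Union) (auto simp: disjoint_family_on_def)
  finally show "measure (push_forward Y \<pi> \<mu>) (cylinder Y v) = (\<Sum>u\<in>fibre_words n v. measure \<mu> (cylinder X u))"
    unfolding pf by (simp add: cylX)
qed

text \<open>Use the Gibbs inequality of \<mu> at a maximising point of each fibre word and sum over
  the fibre. The bounds are linear in the weights, so the same C works, and both potentials have the
  same pressure.\<close>

lemma weak_gibbs_push_forward:
  assumes f: "continuous_on X f" and g: "weak_gibbs X (exp_birkhoff f) \<mu>"
  shows "weak_gibbs Y (fiber_sum X p f) (push_forward Y \<pi> \<mu>)"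
proof -
  let ?P = "top_pressure X f" and ?\<nu> = "push_forward Y \<pi> \<mu>"
  obtain C where mu: "\<mu> \<in> invariant_measures X" and C: "\<forall>n\<ge>1. C n > 0" "(\<lambda>n. ln (C n) / real n) \<longlonglongrightarrow> 0"
    "\<forall>x\<in>X. \<forall>n\<ge>1. measure \<mu> (cylinder X (block x 0 n)) > 0 \<and>
          \<bar>ln (measure \<mu> (cylinder X (block x 0 n))) + real n * ?P - ln (exp_birkhoff f n x)\<bar> < ln (C n)"
    using g unfolding weak_gibbs_iff[OF pressure_exp_birkhoff[OF X ne f]] by blast
  have "measure ?\<nu> (cylinder Y (block y 0 n)) > 0 \<and>
      \<bar>ln (measure ?\<nu> (cylinder Y (block y 0 n))) + real n * ?P - ln (fiber_sum X p f n y)\<bar> < ln (C n)"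
    if y: "y \<in> Y" and n: "n \<ge> 1" for y n
  proof -
    let ?v = "block y 0 n"
    have v: "?v \<in> words Y n" by (rule block_in_words[OF y])
    have Cn: "C n > 0" using C(1) n by blast
    have fs: "fiber_sum X p f n y > 0" by (rule fiber_sum_pos[OF f y])
    let ?E = "exp (- (real n * ?P))"
    have one: "1 / C n * (?E * cyl_sup X f u) < measure \<mu> (cylinder X u) \<and> measure \<mu> (cylinder X u) < C n * (?E * cyl_sup X f u)"
      if u: "u \<in> fibre_words n ?v" for u
    proof -
      have u': "u \<in> words X n" using u by (simp add: fibre_words_def)
      obtain x where x: "x \<in> X" "block x 0 n = u" "cyl_sup X f u = exp (birkhoff_sum f n x)"
          "\<forall>y\<in>X. block y 0 n = u \<longrightarrow> birkhoff_sum f n y \<le> birkhoff_sum f n x"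
        by (rule cyl_sup_attained[OF X f u'])
      have w: "cyl_sup X f u > 0" by (rule cyl_sup_pos[OF X f u'])
      have "measure \<mu> (cylinder X u) > 0 \<and> \<bar>ln (measure \<mu> (cylinder X u)) + real n * ?P - ln (cyl_sup X f u)\<bar> < ln (C n)"
        using C(3)[rule_format, OF x(1) n] by (simp add: x(2,3) exp_birkhoff_def)
      then have "1 / C n < measure \<mu> (cylinder X u) / (?E * cyl_sup X f u) \<and> measure \<mu> (cylinder X u) / (?E * cyl_sup X f u) < C n"
        using gibbs_ratio_iff[OF w Cn] by blast
      moreover have pos: "?E * cyl_sup X f u > 0" using w by simp
      ultimately show ?thesis by (simp only: pos_less_divide_eq[OF pos] pos_divide_less_eq[OF pos])
    qed
    have ne': "fibre_words n ?v \<noteq> {}" by (rule fib_nonempty[OF v])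
    have G: "fiber_sum X p f n y = (\<Sum>u\<in>fibre_words n ?v. cyl_sup X f u)" by (simp add: fiber_sum_eq_fibre_weight[OF f y] fibre_weight_def)
    have M: "measure ?\<nu> (cylinder Y ?v) = (\<Sum>u\<in>fibre_words n ?v. measure \<mu> (cylinder X u))"
      by (rule push_forward_invariant(2)[OF mu v])
    have "1 / C n * (?E * fiber_sum X p f n y) < measure ?\<nu> (cylinder Y ?v)"
      unfolding G M sum_distrib_left using one ne' by (intro sum_strict_mono) auto
    moreover have "measure ?\<nu> (cylinder Y ?v) < C n * (?E * fiber_sum X p f n y)"
      unfolding G M sum_distrib_left using one ne' by (intro sum_strict_mono) auto
    moreover have pos: "?E * fiber_sum X p f n y > 0" using fs by simp
    ultimately have "1 / C n < measure ?\<nu> (cylinder Y ?v) / (?E * fiber_sum X p f n y) \<and>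
        measure ?\<nu> (cylinder Y ?v) / (?E * fiber_sum X p f n y) < C n"
      by (simp only: pos_less_divide_eq[OF pos] pos_divide_less_eq[OF pos])
    then show ?thesis using gibbs_ratio_iff[OF fs Cn] by blast
  qed
  then show ?thesis
    unfolding weak_gibbs_iff[OF pressure_fiber_sum[OF f]]
    using C(1,2) potential_seq_fiber_sum[OF f] push_forward_invariant(1)[OF mu] by blast
qed

section \<open>The equivalent conditions on h\<close>

lemma shadows_sup:
  assumes "shadows f h"
  defines "s \<equiv> \<lambda>n. SUP y\<in>Y. \<bar>ln_weight f n y - birkhoff_sum h n y\<bar>"
  shows "y \<in> Y \<Longrightarrow> \<bar>ln_weight f n y - birkhoff_sum h n y\<bar> \<le> s n"
    and "(\<lambda>n. s n / real n) \<longlonglongrightarrow> 0"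
proof -
  have bdd: "bdd_above ((\<lambda>y. \<bar>ln_weight f n y - birkhoff_sum h n y\<bar>) ` Y)" for n
  proof -
    obtain K where "\<forall>n. \<forall>y\<in>Y. \<bar>ln_weight f n y - birkhoff_sum h n y\<bar> \<le> 1 * real n + K"
      using assms(1) zero_less_one unfolding shadows_def by blast
    then show ?thesis by (intro bdd_aboveI2[of _ _ "1 * real n + K"]) blast
  qed
  have up: "\<bar>ln_weight f n y - birkhoff_sum h n y\<bar> \<le> s n" if "y \<in> Y" for y n
    unfolding s_def using bdd that by (intro cSUP_upper)
  then show "y \<in> Y \<Longrightarrow> \<bar>ln_weight f n y - birkhoff_sum h n y\<bar> \<le> s n" .
  show "(\<lambda>n. s n / real n) \<longlonglongrightarrow> 0"
  proof (rule tendsto_zero_if_sublinear)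
    fix \<epsilon> :: real assume "\<epsilon> > 0"
    then obtain K where K: "\<forall>n. \<forall>y\<in>Y. \<bar>ln_weight f n y - birkhoff_sum h n y\<bar> \<le> \<epsilon> * real n + K"
      using assms(1) unfolding shadows_def by blast
    obtain y where y: "y \<in> Y" using Yne by blast
    have "\<bar>s n\<bar> \<le> \<epsilon> * real n + K" for n
    proof -
      have "s n \<le> \<epsilon> * real n + K" unfolding s_def using K Yne by (intro cSUP_least) auto
      then show ?thesis using up[OF y, of n] by linarith
    qed
    then show "\<exists>K. \<forall>n\<ge>1. \<bar>s n\<bar> \<le> \<epsilon> * real n + K" by blast
  qed
qed

text \<open>If h shadows f it has the pressure of f (test with \<phi> = h), and C only grows by the
  subexponential factor exp (s n). Conversely, two Gibbs inequalities for one measure force log g_n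
  - n * P and the Birkhoff sum of \<phi> minus n * Q to agree up to o(n), with P and Q the two
  pressures.\<close>

lemma shadows_iff_weak_gibbs:
  assumes f: "continuous_on X f" and \<nu>: "weak_gibbs Y (fiber_sum X p f) \<nu>"
  shows "(\<exists>h. continuous_on Y h \<and> shadows f h) \<longleftrightarrow> (\<exists>\<phi>. continuous_on Y \<phi> \<and> weak_gibbs Y (exp_birkhoff \<phi>) \<nu>)"
proof -
  let ?P = "top_pressure X f" and ?m = "\<lambda>y n. measure \<nu> (cylinder Y (block y 0 n))"
  obtain C where nu: "\<nu> \<in> invariant_measures Y" and C: "\<forall>n\<ge>1. C n > 0" "(\<lambda>n. ln (C n) / real n) \<longlonglongrightarrow> 0"
    "\<forall>y\<in>Y. \<forall>n\<ge>1. ?m y n > 0 \<and> \<bar>ln (?m y n) + real n * ?P - ln (fiber_sum X p f n y)\<bar> < ln (C n)"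
    using \<nu> unfolding weak_gibbs_iff[OF pressure_fiber_sum[OF f]] by blast
  show ?thesis
  proof
    assume "\<exists>h. continuous_on Y h \<and> shadows f h"
    then obtain h where h: "continuous_on Y h" "shadows f h" by blast
    have P: "top_pressure Y h = ?P" using shadows_imp_top_pressure_eq[OF f h(1) h(1) h(2)] by simp
    define s where "s n = (SUP y\<in>Y. \<bar>ln_weight f n y - birkhoff_sum h n y\<bar>)" for n
    note s_up = shadows_sup(1)[OF h(2), folded s_def] and slim = shadows_sup(2)[OF h(2), folded s_def]
    define C' where "C' n = C n * exp (s n)" for n
    have lnC: "ln (C' n) = ln (C n) + s n" if "n \<ge> 1" for n
    proof -
      have "C n > 0" using C(1) that by blast
      then show ?thesis by (simp add: C'_def ln_mult_pos)
    qed
    have "(\<lambda>n. ln (C n) / real n + s n / real n) \<longlonglongrightarrow> 0 + 0" by (intro tendsto_add C(2) slim)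
    moreover have "\<forall>\<^sub>F n in sequentially. ln (C n) / real n + s n / real n = ln (C' n) / real n"
      by (rule eventually_sequentiallyI[of 1]) (simp add: lnC add_divide_distrib)
    ultimately have limC: "(\<lambda>n. ln (C' n) / real n) \<longlonglongrightarrow> 0" using Lim_transform_eventually by fastforce
    have "?m y n > 0 \<and> \<bar>ln (?m y n) + real n * ?P - ln (exp_birkhoff h n y)\<bar> < ln (C' n)" if y: "y \<in> Y" and n: "n \<ge> 1" for y n
      using C(3)[rule_format, OF y n] s_up[OF y, of n] unfolding lnC[OF n] ln_fiber_sum[OF f y]
      by (simp add: exp_birkhoff_def abs_less_iff abs_le_iff)
    then have "weak_gibbs Y (exp_birkhoff h) \<nu>"
      unfolding weak_gibbs_iff[OF pressure_exp_birkhoff[OF Y Yne h(1)]] P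
      using limC C(1) nu potential_seq_exp_birkhoff[OF Y h(1)] by (auto simp: C'_def intro!: exI[of _ C'])
    then show "\<exists>\<phi>. continuous_on Y \<phi> \<and> weak_gibbs Y (exp_birkhoff \<phi>) \<nu>" using h(1) by blast
  next
    assume "\<exists>\<phi>. continuous_on Y \<phi> \<and> weak_gibbs Y (exp_birkhoff \<phi>) \<nu>"
    then obtain \<phi> where phi: "continuous_on Y \<phi>" "weak_gibbs Y (exp_birkhoff \<phi>) \<nu>" by blast
    let ?Q = "top_pressure Y \<phi>"
    obtain C' where C': "\<forall>n\<ge>1. C' n > 0" "(\<lambda>n. ln (C' n) / real n) \<longlonglongrightarrow> 0"
      "\<forall>y\<in>Y. \<forall>n\<ge>1. ?m y n > 0 \<and> \<bar>ln (?m y n) + real n * ?Q - ln (exp_birkhoff \<phi> n y)\<bar> < ln (C' n)"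
      using phi(2) unfolding weak_gibbs_iff[OF pressure_exp_birkhoff[OF Y Yne phi(1)]] by blast
    \<comment> \<open>The added constant corrects the difference of the two pressures.\<close>
    define h where "h y = \<phi> y + (?P - ?Q)" for y
    have h: "continuous_on Y h" unfolding h_def using phi(1) by (intro continuous_intros)
    have bs: "birkhoff_sum h n y = birkhoff_sum \<phi> n y + real n * (?P - ?Q)" for n y
      unfolding h_def by (rule birkhoff_sum_plus_const)
    have "shadows f h"
      unfolding shadows_def
    proof (intro allI impI)
      fix \<epsilon> :: real assume "\<epsilon> > 0"
      have "(\<lambda>n. ln (C n) / real n + ln (C' n) / real n) \<longlonglongrightarrow> 0 + 0" by (intro tendsto_add C(2) C'(2))
      then have "(\<lambda>n. (ln (C n) + ln (C' n)) / real n) \<longlonglongrightarrow> 0" by (simp add: add_divide_distrib)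
      then obtain K where K: "\<forall>n. \<bar>ln (C n) + ln (C' n)\<bar> \<le> \<epsilon> * real n + K"
        using tendsto_zero_iff_sublinear[of "\<lambda>n. ln (C n) + ln (C' n)"] \<open>\<epsilon> > 0\<close> by blast
      have "\<bar>ln_weight f n y - birkhoff_sum h n y\<bar> \<le> \<epsilon> * real n + K" if y: "y \<in> Y" for n y
      proof (cases "n = 0")
        case True
        obtain B where "\<forall>n. \<forall>y\<in>Y. \<bar>ln_weight f n y\<bar> \<le> B * real n" by (rule ln_weight_bound[OF f])
        then have "\<bar>ln_weight f 0 y\<bar> \<le> B * real 0" using y by blast
        moreover have "0 \<le> K" using K[rule_format, of 0] by simp
        ultimately show ?thesis using True by simp
      next
        case False
        then have n: "n \<ge> 1" by simp
        have "\<bar>ln (?m y n) + real n * ?P - ln_weight f n y\<bar> < ln (C n)"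
          using C(3)[rule_format, OF y n] by (simp add: ln_fiber_sum[OF f y])
        moreover have "\<bar>ln (?m y n) + real n * ?Q - birkhoff_sum \<phi> n y\<bar> < ln (C' n)"
          using C'(3)[rule_format, OF y n] by (simp add: exp_birkhoff_def)
        moreover have "real n * (?P - ?Q) = real n * ?P - real n * ?Q" by (simp add: algebra_simps)
        ultimately show ?thesis using K[rule_format, of n] unfolding bs by linarith
      qed
      then show "\<exists>K. \<forall>n. \<forall>y\<in>Y. \<bar>ln_weight f n y - birkhoff_sum h n y\<bar> \<le> \<epsilon> * real n + K" by blast
    qed
    then show "\<exists>h. continuous_on Y h \<and> shadows f h" using h by blast
  qed
qed

lemma shadows_tendsto:
  assumes "shadows f h" "y \<in> Y"
  shows "(\<lambda>n. (ln_weight f n y - birkhoff_sum h n y) / real n) \<longlonglongrightarrow> 0"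
proof (rule tendsto_zero_if_sublinear)
  fix \<epsilon> :: real assume "\<epsilon> > 0"
  then obtain K where "\<forall>n. \<forall>y\<in>Y. \<bar>ln_weight f n y - birkhoff_sum h n y\<bar> \<le> \<epsilon> * real n + K"
    using assms(1) unfolding shadows_def by blast
  then show "\<exists>K. \<forall>n\<ge>1. \<bar>ln_weight f n y - birkhoff_sum h n y\<bar> \<le> \<epsilon> * real n + K" using assms(2) by blast
qed

text \<open>The relative pressure is the growth rate of the fibre weights of f - h \<circ> \<pi>,
  and their logarithm is log g_n minus the Birkhoff sum of h, up to o(n).\<close>

lemma rel_pressure_eq_0_iff:
  assumes sft: "one_step_sft X" and f: "continuous_on X f" and h: "continuous_on Y h"
    and y: "y \<in> Y" "periodic_point y"
  shows "rel_pressure X \<pi> (\<lambda>x. f x - h (\<pi> x)) y = 0 \<longleftrightarrow>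
    (\<lambda>n. (ln_weight f n y - birkhoff_sum h n y) / real n) \<longlonglongrightarrow> 0"
proof -
  obtain l where l: "l \<ge> 1" "(shift ^^ l) y = y" using y(2) unfolding periodic_point_def by blast
  let ?F = "\<lambda>x. f x - h (\<pi> x)"
  let ?d = "\<lambda>n. (ln_weight f n y - birkhoff_sum h n y) / real n"
  have F: "continuous_on X ?F" by (rule continuous_on_diff[OF f continuous_comp[OF h]])
  obtain c where c: "(\<lambda>n. ln_weight ?F n y / real n) \<longlonglongrightarrow> c" "rel_pressure X \<pi> ?F y = ereal c"
    by (rule rel_pressure_periodic[OF sft F y(1) l(2,1)])
  have mh: "continuous_on Y (\<lambda>y. - h y)" by (rule continuous_on_minus[OF h])
  have "(\<lambda>n. (ln_weight ?F n y - (ln_weight f n y - birkhoff_sum h n y)) / real n) \<longlonglongrightarrow> 0"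
  proof (rule tendsto_zero_if_sublinear)
    fix \<epsilon> :: real assume e: "\<epsilon> > 0"
    obtain K where K: "\<forall>n. \<forall>y\<in>Y. \<bar>ln_weight (\<lambda>x. f x + - h (\<pi> x)) n y - (ln_weight f n y + birkhoff_sum (\<lambda>y. - h y) n y)\<bar> \<le> \<epsilon> * real n + K"
      by (rule ln_weight_perturb[OF f mh e])
    have neg: "birkhoff_sum (\<lambda>y. - h y) n y = - birkhoff_sum h n y" for n
      by (simp add: birkhoff_sum_def sum_negf)
    have "\<bar>ln_weight ?F n y - (ln_weight f n y - birkhoff_sum h n y)\<bar> \<le> \<epsilon> * real n + K" for n
      using K[rule_format, OF y(1), of n] by (simp add: neg)
    then show "\<exists>K. \<forall>n\<ge>1. \<bar>ln_weight ?F n y - (ln_weight f n y - birkhoff_sum h n y)\<bar> \<le> \<epsilon> * real n + K" by blast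
  qed
  then have "(\<lambda>n. ln_weight ?F n y / real n - (ln_weight ?F n y - (ln_weight f n y - birkhoff_sum h n y)) / real n) \<longlonglongrightarrow> c - 0"
    by (intro tendsto_diff c(1))
  then have d: "?d \<longlonglongrightarrow> c" by (simp add: diff_divide_distrib)
  have "?d \<longlonglongrightarrow> 0 \<longleftrightarrow> c = 0"
  proof
    assume "?d \<longlonglongrightarrow> 0"
    with d show "c = 0" by (rule LIMSEQ_unique)
  qed (use d in simp)
  then show ?thesis by (simp add: c(2))
qed

text \<open>In one direction it is enough to test orbit measures, for which the integral is an orbit
  average; in the other the uniform estimate is integrated against m.\<close>

lemma integral_ln_weight_tendsto_iff:
  assumes f: "continuous_on X f" and h: "continuous_on Y h" and K: "K \<ge> 1" "free_concat X K"
  shows "(\<forall>m\<in>invariant_measures Y.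
      (\<lambda>n. (\<integral>y. ln (fiber_sum X p f n y) \<partial>m) / real n) \<longlonglongrightarrow> (\<integral>y. h y \<partial>m)) \<longleftrightarrow> shadows f h"
proof
  assume lim: "\<forall>m\<in>invariant_measures Y.
      (\<lambda>n. (\<integral>y. ln (fiber_sum X p f n y) \<partial>m) / real n) \<longlonglongrightarrow> (\<integral>y. h y \<partial>m)"
  show "shadows f h"
  proof (rule periodic_imp_shadows[OF f h K])
    fix y assume y: "y \<in> Y" "periodic_point y"
    obtain l where l: "l \<ge> 1" "(shift ^^ l) y = y" using y(2) unfolding periodic_point_def by blast
    obtain m where m: "m \<in> invariant_measures Y"
      "\<And>\<phi>. continuous_on Y \<phi> \<Longrightarrow> (\<integral>x. \<phi> x \<partial>m) = birkhoff_sum \<phi> l y / real l"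
      using orbit_measure[OF Y y(1) l] by metis
    interpret m: invariant_measure Y m using Y m(1) by unfold_locales
    have "(\<integral>y. ln (fiber_sum X p f n y) \<partial>m) = (\<Sum>j<l. ln_weight f n ((shift ^^ j) y)) / real l" for n
    proof -
      have "(\<integral>y. ln (fiber_sum X p f n y) \<partial>m) = (\<integral>y. ln_weight f n y \<partial>m)"
        by (intro Bochner_Integration.integral_cong refl) (simp add: m.space_eq ln_fiber_sum[OF f])
      also have "\<dots> = (\<Sum>j<l. ln_weight f n ((shift ^^ j) y)) / real l"
        using m(2)[OF continuous_on_ln_weight] by (simp add: birkhoff_sum_def)
      finally show ?thesis .
    qed
    then have "(\<lambda>n. ((\<Sum>j<l. ln_weight f n ((shift ^^ j) y)) / real l) / real n) \<longlonglongrightarrow> birkhoff_sum h l y / real l"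
      using lim[rule_format, OF m(1)] m(2)[OF h] by simp
    then show "(\<lambda>n. (ln_weight f n y - birkhoff_sum h n y) / real n) \<longlonglongrightarrow> 0"
      by (rule orbit_average_imp_periodic[OF f h y(1) l(2,1)])
  qed
next
  assume sh: "shadows f h"
  show "\<forall>m\<in>invariant_measures Y.
      (\<lambda>n. (\<integral>y. ln (fiber_sum X p f n y) \<partial>m) / real n) \<longlonglongrightarrow> (\<integral>y. h y \<partial>m)"
  proof
    fix m assume "m \<in> invariant_measures Y"
    then interpret m: invariant_measure Y m using Y by unfold_locales
    show "(\<lambda>n. (\<integral>y. ln (fiber_sum X p f n y) \<partial>m) / real n) \<longlonglongrightarrow> (\<integral>y. h y \<partial>m)"
    proof (rule tendsto_if_sublinear)
      fix \<epsilon> :: real assume "\<epsilon> > 0"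
      then obtain K where K: "\<forall>n. \<forall>y\<in>Y. \<bar>ln_weight f n y - birkhoff_sum h n y\<bar> \<le> \<epsilon> * real n + K"
        using sh unfolding shadows_def by blast
      have "\<bar>(\<integral>y. ln (fiber_sum X p f n y) \<partial>m) - (\<integral>y. h y \<partial>m) * real n\<bar> \<le> \<epsilon> * real n + K" for n
      proof -
        have i1: "integrable m (ln_weight f n)" by (rule m.continuous_integrable[OF continuous_on_ln_weight])
        have i2: "integrable m (birkhoff_sum h n)"
          by (rule m.continuous_integrable[OF continuous_on_birkhoff_sum[OF Y h]])
        have "(\<integral>y. ln (fiber_sum X p f n y) \<partial>m) = (\<integral>y. ln_weight f n y \<partial>m)"
          by (intro Bochner_Integration.integral_cong refl) (simp add: m.space_eq ln_fiber_sum[OF f])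
        then have eq: "(\<integral>y. ln (fiber_sum X p f n y) \<partial>m) - (\<integral>y. h y \<partial>m) * real n =
            (\<integral>y. ln_weight f n y - birkhoff_sum h n y \<partial>m)"
          using Bochner_Integration.integral_diff[OF i1 i2] m.integral_birkhoff_sum[OF h, of n]
          by (simp add: mult.commute)
        have "(\<integral>y. ln_weight f n y - birkhoff_sum h n y \<partial>m) \<le> (\<integral>y. \<epsilon> * real n + K \<partial>m)"
          by (intro integral_mono Bochner_Integration.integrable_diff i1 i2)
             (use K in \<open>auto simp: m.space_eq abs_le_iff\<close>)
        moreover have "(\<integral>y. - (\<epsilon> * real n + K) \<partial>m) \<le> (\<integral>y. ln_weight f n y - birkhoff_sum h n y \<partial>m)"
        proof (intro integral_mono Bochner_Integration.integrable_diff i1 i2)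
          fix y assume "y \<in> space m"
          then have "\<bar>ln_weight f n y - birkhoff_sum h n y\<bar> \<le> \<epsilon> * real n + K" using K by (simp add: m.space_eq)
          then show "- (\<epsilon> * real n + K) \<le> ln_weight f n y - birkhoff_sum h n y" by linarith
        qed simp
        ultimately show ?thesis unfolding eq by (simp add: m.prob_space abs_le_iff)
      qed
      then show "\<exists>K. \<forall>n\<ge>1. \<bar>(\<integral>y. ln (fiber_sum X p f n y) \<partial>m) - (\<integral>y. h y \<partial>m) * real n\<bar> \<le> \<epsilon> * real n + K" by blast
    qed
  qed
qed

text \<open>The variational principle turns both suprema into topological pressures; on Y it is
  available because free concatenation passes to the factor.\<close>

lemma compensation_function_iff:
  assumes F: "continuous_on X F" and K: "K \<ge> 1" "free_concat X K"
  shows "compensation_function X Y \<pi> F \<longleftrightarrow>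
    (\<forall>\<phi>. continuous_on Y \<phi> \<longrightarrow> top_pressure X (\<lambda>x. F x + \<phi> (\<pi> x)) = top_pressure Y \<phi>)"
proof -
  have "(SUP \<mu>\<in>invariant_measures X.
           measure_entropy \<mu> shift + ereal (\<integral>x. F x \<partial>\<mu>) + ereal (\<integral>x. \<phi> (\<pi> x) \<partial>\<mu>)) = ereal (top_pressure X (\<lambda>x. F x + \<phi> (\<pi> x)))"
    if phi: "continuous_on Y \<phi>" for \<phi>
  proof -
    have "measure_entropy \<mu> shift + ereal (\<integral>x. F x \<partial>\<mu>) + ereal (\<integral>x. \<phi> (\<pi> x) \<partial>\<mu>) =
        measure_entropy \<mu> shift + ereal (\<integral>x. F x + \<phi> (\<pi> x) \<partial>\<mu>)" if mu: "\<mu> \<in> invariant_measures X" for \<mu>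
    proof -
      interpret m: invariant_measure X \<mu> using X mu by unfold_locales
      have "(\<integral>x. F x + \<phi> (\<pi> x) \<partial>\<mu>) = (\<integral>x. F x \<partial>\<mu>) + (\<integral>x. \<phi> (\<pi> x) \<partial>\<mu>)"
        by (rule Bochner_Integration.integral_add[OF m.continuous_integrable[OF F]
            m.continuous_integrable[OF continuous_comp[OF phi]]])
      then show ?thesis by (simp add: add.assoc)
    qed
    then have "(SUP \<mu>\<in>invariant_measures X.
           measure_entropy \<mu> shift + ereal (\<integral>x. F x \<partial>\<mu>) + ereal (\<integral>x. \<phi> (\<pi> x) \<partial>\<mu>)) =
        (SUP \<mu>\<in>invariant_measures X. measure_entropy \<mu> shift + ereal (\<integral>x. F x + \<phi> (\<pi> x) \<partial>\<mu>))"
      by (intro SUP_cong refl)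
    also have "\<dots> = ereal (top_pressure X (\<lambda>x. F x + \<phi> (\<pi> x)))"
      by (rule variational_principle[OF X ne continuous_on_add[OF F continuous_comp[OF phi]] K])
    finally show ?thesis .
  qed
  moreover have "(SUP \<nu>\<in>invariant_measures Y. measure_entropy \<nu> shift + ereal (\<integral>y. \<phi> y \<partial>\<nu>)) = ereal (top_pressure Y \<phi>)"
    if phi: "continuous_on Y \<phi>" for \<phi>
    by (rule variational_principle[OF Y Yne phi K(1) free_concat_factor[OF K(2)]])
  ultimately show ?thesis
    unfolding compensation_function_def using F by simp
qed

lemma compensation_function_iff_shadows:
  assumes f: "continuous_on X f" and h: "continuous_on Y h" and K: "K \<ge> 1" "free_concat X K"
  shows "compensation_function X Y \<pi> (\<lambda>x. f x - h (\<pi> x)) \<longleftrightarrow> shadows f h"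
proof -
  have F: "continuous_on X (\<lambda>x. f x - h (\<pi> x))" by (rule continuous_on_diff[OF f continuous_comp[OF h]])
  show ?thesis
    unfolding compensation_function_iff[OF F K]
  proof
    assume eq: "\<forall>\<phi>. continuous_on Y \<phi> \<longrightarrow> top_pressure X (\<lambda>x. f x - h (\<pi> x) + \<phi> (\<pi> x)) = top_pressure Y \<phi>"
    show "shadows f h"
    proof (rule periodic_imp_shadows[OF f h K])
      fix y assume y: "y \<in> Y" "periodic_point y"
      obtain l where l: "l \<ge> 1" "(shift ^^ l) y = y" using y(2) unfolding periodic_point_def by blast
      show "(\<lambda>n. (ln_weight f n y - birkhoff_sum h n y) / real n) \<longlonglongrightarrow> 0"
        by (rule top_pressure_eq_imp_periodic[OF f h eq[rule_format] y(1) l(2,1)])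
    qed
  qed (use shadows_imp_top_pressure_eq[OF f h] in blast)
qed

text \<open>For asymptotic additivity the single function h serves for every \<epsilon>. The suprema
  are taken over bounded sets, so the norm dominates the value at each point.\<close>

lemma
  assumes f: "continuous_on X f" and h: "continuous_on Y h"
  shows shadows_imp_asymptotically_additive: "shadows f h \<Longrightarrow> asymptotically_additive Y (fiber_sum X p f) \<and>
         (\<lambda>n. sup_norm Y (\<lambda>y. ln (fiber_sum X p f n y / exp_birkhoff h n y)) / real n) \<longlonglongrightarrow> 0"
    and uniform_ratio_imp_tendsto: "(\<lambda>n. sup_norm Y (\<lambda>y. ln (fiber_sum X p f n y / exp_birkhoff h n y)) / real n) \<longlonglongrightarrow> 0 \<Longrightarrow>
      y \<in> Y \<Longrightarrow> (\<lambda>n. (ln_weight f n y - birkhoff_sum h n y) / real n) \<longlonglongrightarrow> 0"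
proof -
  let ?D = "\<lambda>n y. ln_weight f n y - birkhoff_sum h n y"
  have sn: "sup_norm Y (\<lambda>y. ln (fiber_sum X p f n y / exp_birkhoff h n y)) = (SUP y\<in>Y. \<bar>?D n y\<bar>)" for n
    unfolding sup_norm_def by (intro SUP_cong refl) (simp add: ln_fiber_sum_ratio[OF f])
  have sn': "sup_norm Y (\<lambda>y. ln (fiber_sum X p f n y) - birkhoff_sum h n y) = (SUP y\<in>Y. \<bar>?D n y\<bar>)" for n
    unfolding sup_norm_def by (intro SUP_cong refl) (simp add: ln_fiber_sum[OF f])
  obtain B where B: "B \<ge> 0" "\<forall>n. \<forall>y\<in>Y. \<bar>ln_weight f n y\<bar> \<le> B * real n" by (rule ln_weight_bound[OF f])
  obtain Bh where Bh: "Bh \<ge> 0" "\<And>x. x \<in> Y \<Longrightarrow> \<bar>h x\<bar> \<le> Bh"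
    by (rule continuous_on_subshift_bounded[OF Y h]) blast
  have bdd: "bdd_above ((\<lambda>y. \<bar>?D n y\<bar>) ` Y)" for n
  proof (rule bdd_aboveI2)
    fix y assume y: "y \<in> Y"
    have "\<bar>birkhoff_sum h n y\<bar> \<le> real n * Bh" by (rule birkhoff_sum_bound[OF Y Bh(2) y])
    then show "\<bar>?D n y\<bar> \<le> B * real n + real n * Bh" using B(2)[rule_format, OF y, of n] by linarith
  qed
  have up: "\<bar>?D n y\<bar> \<le> (SUP y\<in>Y. \<bar>?D n y\<bar>)" if "y \<in> Y" for n y
    using bdd that by (intro cSUP_upper)
  {
    assume sh: "shadows f h"
    note lim = shadows_sup(2)[OF sh]
    have "(\<lambda>n. ereal ((SUP y\<in>Y. \<bar>?D n y\<bar>) / real n)) \<longlonglongrightarrow> ereal 0" using lim by simp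
    then have "limsup (\<lambda>n. ereal ((SUP y\<in>Y. \<bar>?D n y\<bar>) / real n)) = ereal 0" by (intro lim_imp_Limsup) auto
    then have "\<exists>\<rho>. continuous_on Y \<rho> \<and>
        limsup (\<lambda>n. ereal (sup_norm Y (\<lambda>x. ln (fiber_sum X p f n x) - birkhoff_sum \<rho> n x) / real n)) < ereal \<epsilon>"
      if "\<epsilon> > 0" for \<epsilon>
      using h that by (intro exI[of _ h]) (simp add: sn')
    then have "asymptotically_additive Y (fiber_sum X p f)"
      unfolding asymptotically_additive_def using potential_seq_fiber_sum[OF f] by simp
    then show "asymptotically_additive Y (fiber_sum X p f) \<and>
         (\<lambda>n. sup_norm Y (\<lambda>y. ln (fiber_sum X p f n y / exp_birkhoff h n y)) / real n) \<longlonglongrightarrow> 0"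
      unfolding sn using lim by simp
  }
  assume lim: "(\<lambda>n. sup_norm Y (\<lambda>y. ln (fiber_sum X p f n y / exp_birkhoff h n y)) / real n) \<longlonglongrightarrow> 0" and y: "y \<in> Y"
  show "(\<lambda>n. ?D n y / real n) \<longlonglongrightarrow> 0"
  proof (rule Lim_null_comparison[OF _ lim[unfolded sn]])
    show "\<forall>\<^sub>F n in sequentially. norm (?D n y / real n) \<le> (SUP y\<in>Y. \<bar>?D n y\<bar>) / real n"
      using up[OF y] by (intro always_eventually allI) (simp add: abs_divide divide_right_mono)
  qed
qed

end

theorem theorem7p1:
  fixes X Y :: "(nat \<Rightarrow> nat) set"
    and p :: "nat \<Rightarrow> nat"
    and \<pi> :: "(nat \<Rightarrow> nat) \<Rightarrow> nat \<Rightarrow> nat"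
    and f :: "(nat \<Rightarrow> nat) \<Rightarrow> real"
    and \<mu> :: "(nat \<Rightarrow> nat) measure"
  assumes "one_step_sft X" and "irreducible_shift X"
    and "subshift Y"
    and "factor_map X Y \<pi>" and "one_block X p \<pi>"
    and "continuous_on X f"
    and "weak_gibbs X (exp_birkhoff f) \<mu>"
  shows
    "weak_gibbs Y (fiber_sum X p f) (push_forward Y \<pi> \<mu>)
     \<and>
     ((\<exists>h. continuous_on Y h \<and>
         (\<forall>m\<in>invariant_measures Y.
            (\<lambda>n. (\<integral>y. ln (fiber_sum X p f n y) \<partial>m) / real n) \<longlonglongrightarrow> (\<integral>y. h y \<partial>m)))
      \<longleftrightarrow>
      (\<exists>h. continuous_on Y h \<and>
         (\<forall>y\<in>Y. periodic_point y \<longrightarrow> rel_pressure X \<pi> (\<lambda>x. f x - h (\<pi> x)) y = 0)))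
     \<and>
     (\<forall>h. continuous_on Y h \<longrightarrow>
        ((\<forall>y\<in>Y. periodic_point y \<longrightarrow> rel_pressure X \<pi> (\<lambda>x. f x - h (\<pi> x)) y = 0)
         \<longleftrightarrow>
         (\<forall>y\<in>Y. periodic_point y \<longrightarrow>
            (\<lambda>n. ln (fiber_sum X p f n y / exp_birkhoff h n y) / real n) \<longlonglongrightarrow> 0))
        \<and>
        ((\<forall>y\<in>Y. periodic_point y \<longrightarrow> rel_pressure X \<pi> (\<lambda>x. f x - h (\<pi> x)) y = 0)
         \<longleftrightarrow>
         compensation_function X Y \<pi> (\<lambda>x. f x - h (\<pi> x)))
        \<and>
        ((\<forall>y\<in>Y. periodic_point y \<longrightarrow> rel_pressure X \<pi> (\<lambda>x. f x - h (\<pi> x)) y = 0)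
         \<longleftrightarrow>
         (\<forall>y\<in>Y. (\<lambda>n. ln (fiber_sum X p f n y / exp_birkhoff h n y) / real n) \<longlonglongrightarrow> 0))
        \<and>
        ((\<forall>y\<in>Y. periodic_point y \<longrightarrow> rel_pressure X \<pi> (\<lambda>x. f x - h (\<pi> x)) y = 0)
         \<longleftrightarrow>
         asymptotically_additive Y (fiber_sum X p f) \<and>
         (\<lambda>n. sup_norm Y (\<lambda>y. ln (fiber_sum X p f n y / exp_birkhoff h n y)) / real n)
           \<longlonglongrightarrow> 0))
     \<and>
     ((\<exists>h. continuous_on Y h \<and>
         (\<forall>m\<in>invariant_measures Y.
            (\<lambda>n. (\<integral>y. ln (fiber_sum X p f n y) \<partial>m) / real n) \<longlonglongrightarrow> (\<integral>y. h y \<partial>m)))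
      \<longleftrightarrow>
      (\<exists>\<phi>. continuous_on Y \<phi> \<and> weak_gibbs Y (exp_birkhoff \<phi>) (push_forward Y \<pi> \<mu>)))"
proof -
  \<comment> \<open>A probability measure on X exists, which is where nonemptiness of X comes
    from.\<close>
  interpret m: invariant_measure X \<mu>
    using assms(7) one_step_sft_subshift[OF assms(1)] by unfold_locales (auto simp: weak_gibbs_def)
  interpret factor X Y p \<pi>
    using one_step_sft_subshift[OF assms(1)] m.ne assms(3,4,5)
    by unfold_locales (auto simp: factor_map_def one_block_def)
  note f = assms(6)
  obtain K where K: "K \<ge> 1" "free_concat X K"
    using irreducible_sft_free_concat[OF assms(1,2) m.ne] by blast
  \<comment> \<open>Each condition is reduced to \<open>shadows f h\<close> for one and the same h,
    so the equivalences hold for every fixed h and the existence statements follow.\<close>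
  let ?rp = "\<lambda>h. \<forall>y\<in>Y. periodic_point y \<longrightarrow> rel_pressure X \<pi> (\<lambda>x. f x - h (\<pi> x)) y = 0"
  let ?lim = "\<lambda>h y. (\<lambda>n. ln (fiber_sum X p f n y / exp_birkhoff h n y) / real n) \<longlonglongrightarrow> 0"
  let ?aa = "\<lambda>h. asymptotically_additive Y (fiber_sum X p f) \<and>
         (\<lambda>n. sup_norm Y (\<lambda>y. ln (fiber_sum X p f n y / exp_birkhoff h n y)) / real n) \<longlonglongrightarrow> 0"
  let ?int = "\<lambda>h. \<forall>m\<in>invariant_measures Y.
            (\<lambda>n. (\<integral>y. ln (fiber_sum X p f n y) \<partial>m) / real n) \<longlonglongrightarrow> (\<integral>y. h y \<partial>m)"
  have lim: "?lim h y \<longleftrightarrow> (\<lambda>n. (ln_weight f n y - birkhoff_sum h n y) / real n) \<longlonglongrightarrow> 0" if "y \<in> Y" for h y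
    by (simp add: ln_fiber_sum_ratio[OF f that])
  have per: "(\<forall>y\<in>Y. periodic_point y \<longrightarrow> ?lim h y) \<longleftrightarrow> shadows f h" if h: "continuous_on Y h" for h
    using periodic_imp_shadows[OF f h K] shadows_tendsto[of f h] lim by blast
  have rp: "?rp h \<longleftrightarrow> shadows f h" if h: "continuous_on Y h" for h
    using rel_pressure_eq_0_iff[OF assms(1) f h] lim per[OF h] by simp
  have all: "(\<forall>y\<in>Y. ?lim h y) \<longleftrightarrow> shadows f h" if h: "continuous_on Y h" for h
    using shadows_tendsto[of f h] lim per[OF h] by blast
  have aa: "?aa h \<longleftrightarrow> shadows f h" if h: "continuous_on Y h" for h
    using uniform_ratio_imp_tendsto[OF f h] shadows_imp_asymptotically_additive[OF f h] all[OF h] lim by blast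
  have int: "?int h \<longleftrightarrow> shadows f h" if h: "continuous_on Y h" for h
    by (rule integral_ln_weight_tendsto_iff[OF f h K])
  have comp: "compensation_function X Y \<pi> (\<lambda>x. f x - h (\<pi> x)) \<longleftrightarrow> shadows f h" if h: "continuous_on Y h" for h
    by (rule compensation_function_iff_shadows[OF f h K])
  have wg: "weak_gibbs Y (fiber_sum X p f) (push_forward Y \<pi> \<mu>)"
    by (rule weak_gibbs_push_forward[OF f assms(7)])
  have ex_int: "(\<exists>h. continuous_on Y h \<and> ?int h) \<longleftrightarrow> (\<exists>h. continuous_on Y h \<and> shadows f h)"
    using int by blast
  have ex_rp: "(\<exists>h. continuous_on Y h \<and> ?rp h) \<longleftrightarrow> (\<exists>h. continuous_on Y h \<and> shadows f h)"
    using rp by blast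
  show ?thesis
  proof (intro conjI allI impI)
    show "weak_gibbs Y (fiber_sum X p f) (push_forward Y \<pi> \<mu>)" by (rule wg)
    show "(\<exists>h. continuous_on Y h \<and> ?int h) \<longleftrightarrow> (\<exists>h. continuous_on Y h \<and> ?rp h)"
      unfolding ex_int ex_rp ..
    show "(\<exists>h. continuous_on Y h \<and> ?int h) \<longleftrightarrow>
        (\<exists>\<phi>. continuous_on Y \<phi> \<and> weak_gibbs Y (exp_birkhoff \<phi>) (push_forward Y \<pi> \<mu>))"
      unfolding ex_int by (rule shadows_iff_weak_gibbs[OF f wg])
  next
    fix h :: "(nat \<Rightarrow> nat) \<Rightarrow> real" assume h: "continuous_on Y h"
    show "?rp h \<longleftrightarrow> (\<forall>y\<in>Y. periodic_point y \<longrightarrow> ?lim h y)" unfolding rp[OF h] per[OF h] ..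
    show "?rp h \<longleftrightarrow> compensation_function X Y \<pi> (\<lambda>x. f x - h (\<pi> x))" unfolding rp[OF h] comp[OF h] ..
    show "?rp h \<longleftrightarrow> (\<forall>y\<in>Y. ?lim h y)" unfolding rp[OF h] all[OF h] ..
    show "?rp h \<longleftrightarrow> ?aa h" unfolding rp[OF h] aa[OF h] ..
  qed
qed

end
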